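(* Let $n\ge2$. A bounded linear operator $T$ on $H^2(\triangle_n)$ is a Toeplitz operator (that is, $T=T_{\phi,\triangle_n}$ for some $\phi\in L^\infty(\mathbb T^n)$) if and only if $\mathscr M_{z_j}^*\,T\,\mathscr M_{z_j}=T$ for all $j=1,\dots,n$.
   Context: Let $n\ge2$, $\mathbb T$ the unit circle, and $\triangle_n=\{z\in\mathbb C^n:|z_1|<|z_2|<\dots<|z_n|<1\}$ the $n$-dimensional Hartogs triangle. The Hardy space $H^2(\triangle_n)$ is the Hilbert space of holomorphic functions $f$ on $\triangle_n$ with $$\|f\|^2=\sup_{r_1,\dots,r_n\in(0,1)}\int_{[0,2\pi]^n}\Big|f\Big(\prod_{j=1}^n r_je^{i\theta_1},\prod_{j=2}^n r_je^{i\theta_2},\dots,r_ne^{i\theta_n}\Big)\Big|^2\prod_{j=1}^n r_j^{2j-1}\,\frac{d\theta}{(2\pi)^n}<\infty.$$ It has orthonormal basis $\{z^\alpha:\alpha\in\mathcal I\}$, $\mathcal I=\{\alpha\in\mathbb Z^n:\sum_{j=1}^k\alpha_j+k-1\ge0,\ k=1,\dots,n\}$, and is identified, through $\sum_{\alpha\in\mathcal I}a_\alpha z^\alpha\mapsto\sum_{\alpha\in\mathcal I}a_\alpha\zeta^\alpha$ ($\zeta\in\mathbb T^n$), with the closed subspace $H^2(\partial_d(\triangle_n))=\{\sum_{\alpha\in\mathcal I}a_\alpha\zeta^\alpha:(a_\alpha)\in\ell^2\}$ of $L^2(\mathbb T^n)$ (normalized Lebesgue measure). For $\phi\in L^\infty(\mathbb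 T^n)$, the Toeplitz operator on $H^2(\triangle_n)$ is $T_{\phi,\triangle_n}(f)=P(\phi f)$, where $P$ is the orthogonal projection of $L^2(\mathbb T^n)$ onto $H^2(\partial_d(\triangle_n))$. For $j=1,\dots,n$, $\mathscr M_{z_j}$ is the bounded operator $f\mapsto z_jf$ on $H^2(\triangle_n)$. *)

theory Defs
  imports "HOL-Analysis.Analysis"
begin

text \<open>
  Coordinates are indexed by a finite linearly ordered type, whose elements in increasing
  order play the role of 1, ..., n, where n is the cardinality of the type.
\<close>

type_synonym 'n cfun = "(complex,'n) vec \<Rightarrow> complex"

definition index_pos :: "'n::{finite,linorder} \<Rightarrow> nat" where
  "index_pos j = card {..j}"

definition hartogs :: "(complex^'n::{finite,linorder}) set" where
  "hartogs = {z. (\<forall>i j. i < j \<longrightarrow> cmod (z $ i) < cmod (z $ j)) \<and> (\<forall>j. cmod (z $ j) < 1)}"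

definition holomorphic_several :: "'n::finite cfun \<Rightarrow> (complex,'n) vec set \<Rightarrow> bool" where
  "holomorphic_several f U \<longleftrightarrow>
     (\<forall>z\<in>U. \<exists>D. (f has_derivative D) (at z) \<and> (\<forall>c v. D (c *s v) = c * D v))"


subsection \<open>The Hardy space of the Hartogs triangle\<close>

text \<open>The probability measure $d\theta/(2\pi)^n$ on $[0,2\pi]^n$.\<close>

definition angle_measure :: "(real^'n) measure" where
  "angle_measure = uniform_measure lborel (cbox 0 (\<chi> j. 2 * pi))"

definition hardy_norm_sq :: "'n::{finite,linorder} cfun \<Rightarrow> ennreal" where
  "hardy_norm_sq f =
     (SUP r\<in>{r::real^'n::{finite,linorder}. \<forall>j. 0 < r $ j \<and> r $ j < 1}.
        \<integral>\<^sup>+\<theta>. ennreal ((cmod (f (\<chi> k. of_real (\<Prod>j\<in>{k..}. r $ j) * cis (\<theta> $ k))))\<^sup>2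
                    * (\<Prod>j\<in>UNIV. (r $ j) ^ (2 * index_pos j - 1))) \<partial>angle_measure)"

definition hardy_norm :: "'n::{finite,linorder} cfun \<Rightarrow> real" where
  "hardy_norm f = sqrt (enn2real (hardy_norm_sq f))"

text \<open>
  A function on the Hartogs triangle is represented by its extension by zero, so that equality
  of elements of the Hardy space is equality of functions.
\<close>

definition hardy_space :: "'n::{finite,linorder} cfun set" where
  "hardy_space = {f. holomorphic_several f hartogs \<and> (\<forall>z. z \<notin> hartogs \<longrightarrow> f z = 0) \<and>
                     hardy_norm_sq f < \<infinity>}"

text \<open>The inner product inducing the norm, by polarization; linear in the first argument.\<close>

definition hardy_inner ::
  "'n::{finite,linorder} cfun \<Rightarrow> 'n cfun \<Rightarrow> complex" where
  "hardy_inner f g =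
     (\<Sum>k<4. \<i> ^ k * of_real ((hardy_norm (\<lambda>z. f z + \<i> ^ k * g z))\<^sup>2)) / 4"

text \<open>Operators on the Hardy space: only the values on \<^const>\<open>hardy_space\<close> are relevant.\<close>

definition hardy_bounded_operator ::
  "('n::{finite,linorder} cfun \<Rightarrow> 'n cfun) \<Rightarrow> bool" where
  "hardy_bounded_operator T \<longleftrightarrow>
     (\<forall>f\<in>hardy_space. T f \<in> hardy_space) \<and>
     (\<forall>f\<in>hardy_space. \<forall>g\<in>hardy_space. T (\<lambda>z. f z + g z) = (\<lambda>z. T f z + T g z)) \<and>
     (\<forall>c. \<forall>f\<in>hardy_space. T (\<lambda>z. c * f z) = (\<lambda>z. c * T f z)) \<and>
     (\<exists>C. \<forall>f\<in>hardy_space. hardy_norm (T f) \<le> C * hardy_norm f)"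

definition hardy_adjoint ::
  "('n::{finite,linorder} cfun \<Rightarrow> 'n cfun)
     \<Rightarrow> 'n cfun \<Rightarrow> 'n cfun" where
  "hardy_adjoint A g =
     (THE h. h \<in> hardy_space \<and> (\<forall>f\<in>hardy_space. hardy_inner (A f) g = hardy_inner f h))"

definition coord_mult :: "'n::finite \<Rightarrow> 'n cfun \<Rightarrow> 'n cfun" where
  "coord_mult j f = (\<lambda>z. z $ j * f z)"


subsection \<open>Function spaces on the torus\<close>

text \<open>
  Normalized Lebesgue measure on $\mathbb T^n$, as a Borel measure on $\mathbb C^n$ concentrated
  on the torus. Elements of $L^2$ and $L^\infty$ are represented by measurable functions, which
  are to be identified when they agree almost everywhere.
\<close>

definition torus_measure :: "(complex^'n) measure" where
  "torus_measure = distr angle_measure borel (\<lambda>\<theta>. \<chi> j. cis (\<theta> $ j))"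

definition torus_L2 :: "'n::finite cfun set" where
  "torus_L2 = {g \<in> borel_measurable torus_measure.
                 integrable torus_measure (\<lambda>\<zeta>. (cmod (g \<zeta>))\<^sup>2)}"

definition torus_Linf :: "'n::finite cfun set" where
  "torus_Linf = {\<phi> \<in> borel_measurable torus_measure.
                   \<exists>C. AE \<zeta> in torus_measure. cmod (\<phi> \<zeta>) \<le> C}"

definition torus_inner :: "'n::finite cfun \<Rightarrow> 'n cfun \<Rightarrow> complex" where
  "torus_inner u v = (\<integral>\<zeta>. u \<zeta> * cnj (v \<zeta>) \<partial>torus_measure)"

definition torus_norm :: "'n::finite cfun \<Rightarrow> real" where
  "torus_norm g = sqrt (\<integral>\<zeta>. (cmod (g \<zeta>))\<^sup>2 \<partial>torus_measure)"


subsection \<open>Boundary values\<close>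

definition monomial :: "int^'n \<Rightarrow> 'n cfun" where
  "monomial \<alpha> z = (\<Prod>j\<in>UNIV. (z $ j) powi (\<alpha> $ j))"

definition hardy_index :: "(int^'n::{finite,linorder}) set" where
  "hardy_index = {\<alpha>. \<forall>k. (\<Sum>j\<in>{..k}. \<alpha> $ j) + int (index_pos k) - 1 \<ge> 0}"

definition hardy_l2 :: "(int^'n::{finite,linorder} \<Rightarrow> complex) set" where
  "hardy_l2 = {a. (\<lambda>\<alpha>. (cmod (a \<alpha>))\<^sup>2) summable_on hardy_index}"

text \<open>
  The expansions $\sum_{\alpha\in\mathcal I} a_\alpha z^\alpha$ in the Hardy space and
  $\sum_{\alpha\in\mathcal I} a_\alpha \zeta^\alpha$ in $L^2(\mathbb T^n)$, both as unordered
  sums converging in norm.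
\<close>

definition hardy_expansion ::
  "((int,'n) vec \<Rightarrow> complex) \<Rightarrow> 'n::{finite,linorder} cfun \<Rightarrow> bool" where
  "hardy_expansion a f \<longleftrightarrow>
     ((\<lambda>F. hardy_norm (\<lambda>z. f z - (if z \<in> hartogs then \<Sum>\<alpha>\<in>F. a \<alpha> * monomial \<alpha> z else 0)))
        \<longlongrightarrow> 0) (finite_subsets_at_top hardy_index)"

definition torus_expansion ::
  "((int,'n) vec \<Rightarrow> complex) \<Rightarrow> 'n::{finite,linorder} cfun \<Rightarrow> bool" where
  "torus_expansion a g \<longleftrightarrow>
     ((\<lambda>F. torus_norm (\<lambda>\<zeta>. g \<zeta> - (\<Sum>\<alpha>\<in>F. a \<alpha> * monomial \<alpha> \<zeta>)))
        \<longlongrightarrow> 0) (finite_subsets_at_top hardy_index)"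

definition hardy_boundary_space :: "'n::{finite,linorder} cfun set" where
  "hardy_boundary_space = {g \<in> torus_L2. \<exists>a\<in>hardy_l2. torus_expansion a g}"

text \<open>The graph of the identification of the Hardy space with its space of boundary values.\<close>

definition boundary_related ::
  "'n::{finite,linorder} cfun \<Rightarrow> 'n cfun \<Rightarrow> bool" where
  "boundary_related f g \<longleftrightarrow> f \<in> hardy_space \<and> g \<in> torus_L2 \<and>
     (\<exists>a\<in>hardy_l2. hardy_expansion a f \<and> torus_expansion a g)"

text \<open>
  Boundary values and projections are determined up to equality almost everywhere, hence
  \<open>SOME\<close>; the holomorphic function with given boundary values is unique.
\<close>

definition boundary_value ::
  "'n::{finite,linorder} cfun \<Rightarrow> 'n cfun" where
  "boundary_value f = (SOME g. boundary_related f g)"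

definition from_boundary ::
  "'n::{finite,linorder} cfun \<Rightarrow> 'n cfun" where
  "from_boundary g = (THE f. boundary_related f g)"

definition hardy_projection ::
  "'n::{finite,linorder} cfun \<Rightarrow> 'n cfun" where
  "hardy_projection h =
     (SOME g. g \<in> hardy_boundary_space \<and>
        (\<forall>u\<in>hardy_boundary_space. torus_inner (\<lambda>\<zeta>. h \<zeta> - g \<zeta>) u = 0))"

definition toeplitz ::
  "'n::{finite,linorder} cfun \<Rightarrow> 'n cfun \<Rightarrow> 'n cfun"
  where "toeplitz \<phi> f = from_boundary (hardy_projection (\<lambda>\<zeta>. \<phi> \<zeta> * boundary_value f \<zeta>))"

end

theory Submission
  imports Defs "HOL-Complex_Analysis.Cauchy_Integral_Formula"
begin

text \<open>
  Everything happens on the level of coefficients. A function of the Hardy space is the sum of a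
  unique series $\sum_{\alpha\in\mathcal I}a_\alpha z^\alpha$ with square-summable coefficients, its
  norm is the $\ell^2$ norm of the coefficients, and every such series occurs. Multiplication
  by $z_j$ shifts the coefficients, its adjoint shifts them back and truncates to $\mathcal I$. So the
  condition $\mathscr M_{z_j}^*T\mathscr M_{z_j}=T$ for all $j$ says that the matrix of $T$ in the basis of
  monomials is unchanged when row and column are shifted by the same unit index
  (\<open>shift_condition_iff\<close>).

  A Toeplitz operator satisfies this, because its entry at $(\alpha,\beta)$ is the Fourier coefficient
  $\hat\phi(\alpha-\beta)$ (\<open>toeplitz_satisfies_shift_condition\<close>). Conversely, a shift-invariant matrix
  depends on $\alpha-\beta$ only, since any two pairs of indices with the same difference can be shifted
  to a common pair; let $c(\alpha-\beta)$ be its entries. Any finite set of exponents in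
  $\mathbb Z^n$ can be shifted into $\mathcal I$. Applied to a column of the matrix this shows that $c$ is
  square summable, so that it is the family of Fourier coefficients of some $\phi\in L^2$ by the
  Riesz--Fischer theorem. Applied to the quadratic form it shows
  $|\int\phi|p|^2|\le\|T\|\int|p|^2$ for all trigonometric polynomials $p$, and this forces $\phi$ to be
  essentially bounded (\<open>AE_bounded_if_quadratic_form_bounded\<close>). Then $T$ and $T_\phi$ have the same
  matrix, hence coincide by continuity (\<open>ex_toeplitz\<close>).

  Most of the work lies in the description of the Hardy space. In the radial coordinates
  $r_j=|z_j|/|z_{j+1}|$ the weighted square of $z^\alpha$ is $\prod_jr_j^{2b_j+1}$, where
  $b_j=\alpha_1+\dots+\alpha_j+j-1$ are the numbers that define $\mathcal I$. For exponents in
  $\mathcal I$ the monomials are dominated, locally on the triangle, by a square-summable family, so that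
  square-summable coefficients define holomorphic functions, and Parseval's identity on each torus
  computes their norm (\<open>hardy_norm_sq_series\<close>). For the converse, the Laurent coefficient of a holomorphic
  function, an integral over a torus of given radii, does not depend on the radii
  (\<open>laurent_coeff_constant\<close>). Bessel's inequality on these tori bounds the coefficients and excludes
  exponents outside $\mathcal I$, for which some $r_j^{2b_j+1}$ is unbounded; uniqueness of Fourier
  coefficients identifies the function with its series (\<open>hardy_space_series\<close>).
\<close>

section \<open>Complex differentiability in several variables\<close>

text \<open>
  The pointwise notion behind \<^const>\<open>holomorphic_several\<close>; it lets closure properties be stated
  one point at a time.
\<close>

definition complex_differentiable_at :: "'n::finite cfun \<Rightarrow> complex^'n \<Rightarrow> bool" where
  "complex_differentiable_at f z \<longleftrightarrow>
     (\<exists>D. (f has_derivative D) (at z) \<and> (\<forall>c v. D (c *s v) = c * D v))"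

lemma holomorphic_several_iff:
  "holomorphic_several f U \<longleftrightarrow> (\<forall>z\<in>U. complex_differentiable_at f z)"
  by (simp add: holomorphic_several_def complex_differentiable_at_def)

text \<open>
  Cauchy's inequality on balls of half the radius bounds the second derivative near the centre;
  the constant 8 is $2!/(1/2)^2$. The bounds depend on $g$ through $M$ alone, and this uniformity is
  what allows them to be summed over a series and integrated over a torus.
\<close>

lemma second_order_remainder:
  fixes g :: "complex \<Rightarrow> complex"
  assumes g: "g holomorphic_on ball a R" and M: "\<And>w. w \<in> ball a R \<Longrightarrow> cmod (g w) \<le> M"
    and R: "R > 0" and t: "cmod t \<le> R / 4"
  shows "cmod (g (a + t) - g a - deriv g a * t) \<le> 8 * M / R\<^sup>2 * (cmod t)\<^sup>2"
    and "cmod (deriv g a) \<le> 2 * M / R"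
proof -
  define S where "S = cball a (R/4)"
  have sub: "cball x (R/2) \<subseteq> ball a R" if "x \<in> S" for x
  proof
    fix y assume "y \<in> cball x (R/2)"
    then have "dist a y \<le> R/4 + R/2"
      using that dist_triangle[of a y x] by (simp add: S_def)
    also have "\<dots> < R" using R by simp
    finally show "y \<in> ball a R" by simp
  qed
  have cauchy: "cmod ((deriv ^^ k) g x) \<le> fact k * M / (R/2) ^ k" if "x \<in> S" for x k
  proof (rule Cauchy_inequality)
    show "g holomorphic_on ball x (R/2)"
      using holomorphic_on_subset[OF g] sub[OF that] ball_subset_cball by blast
    show "continuous_on (cball x (R/2)) g"
      using holomorphic_on_imp_continuous_on[OF g] sub[OF that] continuous_on_subset by blast
    show "0 < R/2" using R by simp
    show "cmod (g y) \<le> M" if y: "cmod (x - y) = R/2" for y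
      using M sub[OF \<open>x \<in> S\<close>] y by (auto simp: dist_norm)
  qed
  have aS: "a \<in> S" using R by (simp add: S_def)
  show "cmod (deriv g a) \<le> 2 * M / R"
    using cauchy[OF aS, of 1] by (simp add: mult.commute)
  have Sb: "S \<subseteq> ball a R" using R by (auto simp: S_def)
  have "cmod (((deriv ^^ 0) g) (a+t) - (\<Sum>i\<le>1. (deriv ^^ i) g a * ((a+t) - a) ^ i / fact i))
     \<le> (8 * M / R\<^sup>2) * cmod ((a+t) - a) ^ (Suc 1) / fact 1"
  proof (rule complex_Taylor[where S = S])
    show "convex S" by (simp add: S_def)
    show "((deriv ^^ i) g has_field_derivative (deriv ^^ Suc i) g x) (at x within S)"
      if "x \<in> S" for i x
    proof -
      have "(deriv ^^ i) g holomorphic_on ball a R"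
        using g by (intro holomorphic_higher_deriv) auto
      then have "((deriv ^^ i) g has_field_derivative deriv ((deriv ^^ i) g) x) (at x)"
        using holomorphic_derivI[of "(deriv ^^ i) g" "ball a R" x] that Sb by blast
      then show ?thesis
        by (simp add: has_field_derivative_at_within)
    qed
    show "cmod ((deriv ^^ (Suc 1)) g x) \<le> 8 * M / R\<^sup>2" if "x \<in> S" for x
      using cauchy[OF that, of 2] by (simp add: power_divide numeral_2_eq_2)
    show "a \<in> S" by fact
    show "a + t \<in> S" using t by (simp add: S_def dist_norm)
  qed
  then show "cmod (g (a + t) - g a - deriv g a * t) \<le> 8 * M / R\<^sup>2 * (cmod t)\<^sup>2"
    by (simp add: diff_diff_eq numeral_2_eq_2)
qed

lemma norm_vector_smult: "norm (c *s (v::complex^'n::finite)) = cmod c * norm v"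
  by (simp add: norm_vec_def norm_mult L2_set_left_distrib L2_set_def power_mult_distrib
      flip: sum_distrib_left) (simp add: real_sqrt_mult)

lemma bounded_linear_smult_left: "bounded_linear (\<lambda>h. h *s (v::complex^'n::finite))"
  by (rule bounded_linear_intro[where K = "norm v"])
     (auto simp: vec_eq_iff algebra_simps norm_vector_smult)

text \<open>
  Reduces several variables to one: along a holomorphic curve a complex differentiable function is
  a holomorphic function of the parameter.
\<close>

lemma complex_differentiable_compose_curve:
  fixes f :: "'n::finite cfun"
  assumes f: "(f has_derivative D) (at (\<gamma> w))" and D: "\<forall>c v. D (c *s v) = c * D v"
    and \<gamma>: "\<And>k. ((\<lambda>w. \<gamma> w $ k) has_field_derivative (v $ k)) (at w)"
  shows "((\<lambda>w. f (\<gamma> w)) has_field_derivative D v) (at w)"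
proof -
  have "((\<lambda>w. \<Sum>k\<in>UNIV. (\<gamma> w $ k) *s axis k 1) has_derivative
         (\<lambda>h. \<Sum>k\<in>UNIV. (v $ k * h) *s axis k 1)) (at w)"
    using bounded_linear.has_derivative[OF bounded_linear_smult_left \<gamma>[unfolded has_field_derivative_def]]
    by (intro has_derivative_sum)
  moreover have "(\<lambda>h. \<Sum>k\<in>UNIV. (v $ k * h) *s axis k 1) = (\<lambda>h. h *s v)"
    using basis_expansion[of "_ *s v"] by (simp add: mult.commute)
  ultimately have "(\<gamma> has_derivative (\<lambda>h. h *s v)) (at w)"
    by (simp only: basis_expansion)
  from has_derivative_compose[OF this f]
  show ?thesis by (simp add: has_field_derivative_def D mult.commute[of _ "D v"] fun_eq_iff)
qed

lemma complex_differentiable_at_imp_continuous: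
  "complex_differentiable_at f z \<Longrightarrow> continuous (at z) f"
  by (auto simp: complex_differentiable_at_def intro: has_derivative_continuous)

lemma complex_differentiable_at_transform:
  assumes "complex_differentiable_at f z" "open S" "z \<in> S" "\<And>w. w \<in> S \<Longrightarrow> f w = g w"
  shows "complex_differentiable_at g z"
  using assms has_derivative_transform_within_open[of f _ z UNIV S g]
  unfolding complex_differentiable_at_def by blast

lemma complex_differentiable_at_const: "complex_differentiable_at (\<lambda>z. c) z"
  unfolding complex_differentiable_at_def by (rule exI[of _ "\<lambda>h. 0"]) auto

lemma complex_differentiable_at_mult:
  assumes "complex_differentiable_at f z" "complex_differentiable_at g z"
  shows "complex_differentiable_at (\<lambda>z. f z * g z) z"
proof -
  obtain D E where "(f has_derivative D) (at z)" "\<forall>c v. D (c *s v) = c * D v"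
     "(g has_derivative E) (at z)" "\<forall>c v. E (c *s v) = c * E v"
    using assms unfolding complex_differentiable_at_def by blast
  then show ?thesis
    unfolding complex_differentiable_at_def
    by (intro exI[of _ "\<lambda>h. f z * E h + D h * g z"])
       (auto intro!: has_derivative_mult simp: distrib_left mult.left_commute mult.assoc)
qed

lemma complex_differentiable_at_prod:
  assumes "\<And>i. i \<in> A \<Longrightarrow> complex_differentiable_at (f i) z"
  shows "complex_differentiable_at (\<lambda>z. \<Prod>i\<in>A. f i z) z"
  using assms
  by (induction A rule: infinite_finite_induct)
     (auto intro!: complex_differentiable_at_const complex_differentiable_at_mult)

lemma complex_differentiable_at_coord_powi:
  assumes "z $ j \<noteq> 0 \<or> m \<ge> 0"
  shows "complex_differentiable_at (\<lambda>z. (z $ j) powi m) z"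
proof -
  obtain c where "((\<lambda>w. w powi m) has_field_derivative c) (at (z $ j))"
  proof (cases "m \<ge> 0")
    case True
    then have "(\<lambda>w::complex. w powi m) = (\<lambda>w. w ^ nat m)"
      by (simp add: power_int_def)
    moreover have "((\<lambda>w. w ^ nat m) has_field_derivative of_nat (nat m) * (z $ j) ^ (nat m - 1)) (at (z $ j))"
      by (auto intro!: derivative_eq_intros)
    ultimately show ?thesis using that by metis
  next
    case False
    with assms has_derivative_power_int'[of "z $ j" m UNIV] show ?thesis
      by (intro that[of "of_int m * (z $ j) powi (m - 1)"])
         (auto simp: has_field_derivative_def mult.commute[of _ "of_int m * _"])
  qed
  then have *: "((\<lambda>w. w powi m) has_derivative (*) c) (at (z $ j))"
    by (simp add: has_field_derivative_def)
  have "((\<lambda>z. z $ j) has_derivative (\<lambda>h. h $ j)) (at z)"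
    by (intro bounded_linear_imp_has_derivative bounded_linear_vec_nth)
  from has_derivative_compose[OF this *] show ?thesis
    unfolding complex_differentiable_at_def by (auto simp: algebra_simps)
qed

lemma complex_differentiable_at_monomial:
  assumes "\<And>j. z $ j \<noteq> 0 \<or> \<alpha> $ j \<ge> 0"
  shows "complex_differentiable_at (monomial \<alpha>) z"
  unfolding monomial_def[abs_def]
  by (intro complex_differentiable_at_prod complex_differentiable_at_coord_powi assms)

lemma summable_on_norm_bound:
  fixes f :: "'i \<Rightarrow> 'b::banach"
  assumes "g summable_on A" "\<And>i. i \<in> A \<Longrightarrow> norm (f i) \<le> g i"
  shows "f summable_on A"
  by (rule abs_summable_summable[OF Infinite_Sum.abs_summable_on_comparison_test'[OF assms]])

lemma has_sum_difference:
  fixes f g :: "'i \<Rightarrow> 'b::real_normed_vector"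
  assumes "(f has_sum a) A" "(g has_sum b) A"
  shows "((\<lambda>i. f i - g i) has_sum (a - b)) A"
  using has_sum_add[OF assms(1), of "\<lambda>i. - g i" "- b"] assms(2)
  by (simp add: has_sum_uminus)

text \<open>
  Termwise differentiation for sums over arbitrary index sets, without any knowledge of the
  derivatives of the terms: on the complex line through \<open>a\<close> in direction \<open>h\<close> the one-variable
  estimates bound the derivative and the remainder of each term by multiples of its majorant, and
  these bounds can be summed.
\<close>

lemma complex_differentiable_at_infsum:
  fixes f :: "'i \<Rightarrow> 'n::finite cfun"
  assumes \<rho>: "\<rho> > 0"
    and diff: "\<And>i z. i \<in> A \<Longrightarrow> z \<in> ball a \<rho> \<Longrightarrow> complex_differentiable_at (f i) z"
    and bound: "\<And>i z. i \<in> A \<Longrightarrow> z \<in> ball a \<rho> \<Longrightarrow> cmod (f i z) \<le> M i"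
    and M: "M summable_on A"
  shows "complex_differentiable_at (\<lambda>z. \<Sum>\<^sub>\<infinity>i\<in>A. f i z) a"
proof -
  have "\<forall>i\<in>A. \<exists>D. (f i has_derivative D) (at a) \<and> (\<forall>c v. D (c *s v) = c * D v)"
    using diff \<rho> unfolding complex_differentiable_at_def by (meson centre_in_ball)
  then obtain D where DD: "\<forall>i\<in>A. (f i has_derivative D i) (at a) \<and> (\<forall>c v. D i (c *s v) = c * D i v)"
    by (rule bchoice[THEN exE])
  then have D: "\<And>i. i \<in> A \<Longrightarrow> (f i has_derivative D i) (at a)"
    and Dlin: "\<And>i. i \<in> A \<Longrightarrow> \<forall>c v. D i (c *s v) = c * D i v"
    by auto
  \<comment> \<open>Along each complex line through \<open>a\<close> the one-variable estimates apply.\<close>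
  have slice: "cmod (f i (a + h) - f i a - D i h) \<le> 8 * M i / \<rho>\<^sup>2 * (norm h)\<^sup>2
       \<and> cmod (D i h) \<le> 2 * M i / \<rho> * norm h"
    if i: "i \<in> A" and h: "norm h \<le> \<rho> / 4" for i h
  proof (cases "h = 0")
    case True
    then show ?thesis
      using linear_0[OF has_derivative_linear[OF D[OF i]]] by simp
  next
    case False
    define R where "R = \<rho> / norm h"
    define g where "g w = f i (a + w *s h)" for w
    have R: "R > 0" using \<rho> False by (simp add: R_def)
    have inb: "a + w *s h \<in> ball a \<rho>" if "w \<in> ball 0 R" for w
      using that False by (simp add: R_def dist_norm norm_vector_smult pos_less_divide_eq)
    have line: "((\<lambda>w. (a + w *s h) $ k) has_field_derivative h $ k) (at w)" for k w
      by (auto intro!: derivative_eq_intros)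
    have "g field_differentiable at w" if w: "w \<in> ball 0 R" for w
    proof -
      obtain E where E: "(f i has_derivative E) (at (a + w *s h))" "\<forall>c v. E (c *s v) = c * E v"
        using diff[OF i inb[OF w]] unfolding complex_differentiable_at_def by blast
      have "(g has_field_derivative E h) (at w)"
        unfolding g_def by (rule complex_differentiable_compose_curve[OF E line])
      then show ?thesis unfolding field_differentiable_def by (rule exI)
    qed
    then have hol: "g holomorphic_on ball 0 R"
      by (simp add: holomorphic_on_def field_differentiable_at_within)
    have bd: "cmod (g w) \<le> M i" if "w \<in> ball 0 R" for w
      using bound[OF i inb[OF that]] by (simp add: g_def)
    have "(g has_field_derivative D i h) (at 0)"
      unfolding g_def
      by (rule complex_differentiable_compose_curve[OF _ Dlin[OF i] line]) (simp add: D[OF i])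
    then have dg: "deriv g 0 = D i h"
      by (rule DERIV_imp_deriv)
    have one: "cmod 1 \<le> R / 4"
      using h False by (simp add: R_def field_simps)
    have "8 * M i / R\<^sup>2 * (cmod 1)\<^sup>2 = 8 * M i / \<rho>\<^sup>2 * (norm h)\<^sup>2"
      "2 * M i / R = 2 * M i / \<rho> * norm h"
      by (simp_all add: R_def power_divide)
    then show ?thesis
      using second_order_remainder[OF hol bd R one] unfolding dg by (simp add: g_def)
  qed
  have summable_a: "(\<lambda>i. f i z) summable_on A" if "z \<in> ball a \<rho>" for z
    by (rule summable_on_norm_bound[OF M bound[OF _ that]])
  have Dscale: "D i h = of_real c * D i ((1 / c) *\<^sub>R h)" if "i \<in> A" "c \<noteq> 0" for i h c
    unfolding linear_cmul[OF has_derivative_linear[OF D[OF that(1)]]]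
    using that by (simp add: scaleR_conv_of_real)
  \<comment> \<open>Homogeneity removes the restriction to short vectors.\<close>
  have Dbound: "cmod (D i h) \<le> 2 * M i / \<rho> * norm h" if i: "i \<in> A" for i h
  proof (cases "h = 0")
    case True
    then show ?thesis
      using linear_0[OF has_derivative_linear[OF D[OF i]]] by simp
  next
    case False
    define c where "c = 4 * norm h / \<rho>"
    have c: "c > 0" using False \<rho> by (simp add: c_def)
    have "norm ((1 / c) *\<^sub>R h) = \<rho> / 4"
      using False \<rho> by (simp add: c_def)
    then have "cmod (D i ((1 / c) *\<^sub>R h)) \<le> 2 * M i / \<rho> * (\<rho> / 4)"
      using slice[OF i, of "(1 / c) *\<^sub>R h"] by (metis order_refl)
    then have "c * cmod (D i ((1 / c) *\<^sub>R h)) \<le> c * (2 * M i / \<rho> * (\<rho> / 4))"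
      using c by (intro mult_left_mono) auto
    moreover have "cmod (D i h) = c * cmod (D i ((1 / c) *\<^sub>R h))"
      using Dscale[OF i, of c h] c by (simp add: norm_mult)
    ultimately show ?thesis
      using \<rho> by (simp add: c_def)
  qed
  have summable_D: "(\<lambda>i. D i h) summable_on A" for h
  proof (rule summable_on_norm_bound)
    show "(\<lambda>i. (2 / \<rho> * norm h) * M i) summable_on A"
      by (intro summable_on_cmult_right M)
    show "norm (D i h) \<le> (2 / \<rho> * norm h) * M i" if "i \<in> A" for i
      using Dbound[OF that, of h] by (simp add: ac_simps)
  qed
  define E where "E h = (\<Sum>\<^sub>\<infinity>i\<in>A. D i h)" for h
  define S where "S = (\<Sum>\<^sub>\<infinity>i\<in>A. M i)"
  have Elin: "E (c *s h) = c * E h" for c h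
  proof -
    have "E (c *s h) = (\<Sum>\<^sub>\<infinity>i\<in>A. c * D i h)"
      unfolding E_def using Dlin by (intro infsum_cong) auto
    then show ?thesis by (simp add: E_def infsum_cmult_right')
  qed
  have Ebound: "cmod (E h) \<le> 2 * S / \<rho> * norm h" for h
  proof -
    have "cmod (E h) \<le> (\<Sum>\<^sub>\<infinity>i\<in>A. (2 / \<rho> * norm h) * M i)"
      unfolding E_def
    proof (rule norm_infsum_le[OF has_sum_infsum[OF summable_D] has_sum_infsum])
      show "(\<lambda>i. (2 / \<rho> * norm h) * M i) summable_on A"
        by (intro summable_on_cmult_right M)
      show "norm (D i h) \<le> (2 / \<rho> * norm h) * M i" if "i \<in> A" for i
        using Dbound[OF that, of h] by (simp add: ac_simps)
    qed
    then show ?thesis unfolding infsum_cmult_right' S_def by (simp add: ac_simps)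
  qed
  have "bounded_linear E"
  proof (rule bounded_linear_intro)
    show "E (x + y) = E x + E y" for x y
      unfolding E_def infsum_add[OF summable_D summable_D, symmetric]
      using linear_add[OF has_derivative_linear[OF D]] by (intro infsum_cong) auto
    show "E (r *\<^sub>R x) = r *\<^sub>R E x" for r x
      using Elin[of "of_real r" x] by (simp add: scaleR_conv_of_real vector_scalar_mult_def scaleR_vec_def)
    show "norm (E x) \<le> norm x * (2 * S / \<rho>)" for x
      using Ebound[of x] by (simp add: mult.commute)
  qed
  have "((\<lambda>z. \<Sum>\<^sub>\<infinity>i\<in>A. f i z) has_derivative E) (at a)"
  proof (rule has_derivativeI_sandwich[where e = "\<rho> / 4" and H = "\<lambda>y. 8 * S / \<rho>\<^sup>2 * norm (y - a)"])
    show "bounded_linear E" by fact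
    show "((\<lambda>y. 8 * S / \<rho>\<^sup>2 * norm (y - a)) \<longlongrightarrow> 0) (at a)"
      by (intro tendsto_eq_intros | simp)+
    show "0 < \<rho> / 4" using \<rho> by simp
    fix y assume y: "y \<noteq> a" "dist y a < \<rho> / 4"
    define h where "h = y - a"
    have yh: "y = a + h" by (simp add: h_def)
    have h: "norm h \<le> \<rho> / 4" using y by (simp add: h_def dist_norm)
    have ya: "y \<in> ball a \<rho>" "a \<in> ball a \<rho>" using y \<rho> by (auto simp: dist_commute)
    have "((\<lambda>i. f i y - f i a - D i h) has_sum
        ((\<Sum>\<^sub>\<infinity>i\<in>A. f i y) - (\<Sum>\<^sub>\<infinity>i\<in>A. f i a) - E h)) A"
      unfolding E_def
      by (intro has_sum_difference has_sum_infsum summable_a ya summable_D)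
    then have "cmod ((\<Sum>\<^sub>\<infinity>i\<in>A. f i y) - (\<Sum>\<^sub>\<infinity>i\<in>A. f i a) - E h)
       \<le> (\<Sum>\<^sub>\<infinity>i\<in>A. 8 / \<rho>\<^sup>2 * (norm h)\<^sup>2 * M i)"
    proof (rule norm_infsum_le[OF _ has_sum_infsum])
      show "(\<lambda>i. 8 / \<rho>\<^sup>2 * (norm h)\<^sup>2 * M i) summable_on A"
        by (intro summable_on_cmult_right M)
      show "norm (f i y - f i a - D i h) \<le> 8 / \<rho>\<^sup>2 * (norm h)\<^sup>2 * M i" if "i \<in> A" for i
        using slice[OF that h] by (simp add: yh ac_simps)
    qed
    also have "\<dots> = 8 * S / \<rho>\<^sup>2 * norm h * norm h"
      unfolding infsum_cmult_right' S_def by (simp add: power2_eq_square)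
    finally show "norm ((\<Sum>\<^sub>\<infinity>i\<in>A. f i y) - (\<Sum>\<^sub>\<infinity>i\<in>A. f i a) - E (y - a)) / norm (y - a)
      \<le> 8 * S / \<rho>\<^sup>2 * norm (y - a)"
      using y by (simp add: h_def divide_le_eq)
  qed
  then show ?thesis
    unfolding complex_differentiable_at_def using Elin by blast
qed

section \<open>Normalized Lebesgue measure on the torus\<close>

lemma sets_torus_measure [simp, measurable_cong]: "sets torus_measure = sets borel"
  by (simp add: torus_measure_def)

lemma space_torus_measure [simp]: "space torus_measure = UNIV"
  by (simp add: torus_measure_def)

definition angle_cube :: "(real^'n) set" where
  "angle_cube = cbox 0 (\<chi> j. 2 * pi)"

lemma emeasure_angle_cube:
  "emeasure lborel (angle_cube :: (real^'n) set) = ennreal ((2 * pi) ^ CARD('n))"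
proof -
  have "emeasure lborel (cbox 0 (\<chi> j. 2 * pi) :: (real^'n) set)
    = (\<Prod>b\<in>(Basis :: (real^'n) set). ((\<chi> j. 2 * pi) - 0) \<bullet> b)"
    by (rule emeasure_lborel_cbox) (auto simp: Basis_vec_def inner_axis)
  also have "(\<Prod>b\<in>(Basis :: (real^'n) set). ((\<chi> j. 2 * pi) - 0) \<bullet> b) = (\<Prod>b\<in>(Basis :: (real^'n) set). 2 * pi)"
    by (rule prod.cong) (auto simp: Basis_vec_def inner_axis)
  finally show ?thesis by (simp add: angle_cube_def)
qed

lemma angle_cube_measurable [measurable]: "angle_cube \<in> sets borel"
  by (simp add: angle_cube_def)

lemma emeasure_angle_measure_UNIV: "emeasure (angle_measure :: (real^'n) measure) UNIV = 1"
  unfolding angle_measure_def angle_cube_def[symmetric]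
  by (subst emeasure_uniform_measure)
     (auto simp: emeasure_angle_cube divide_ennreal)

lemma sets_angle_measure [simp, measurable_cong]: "sets angle_measure = sets borel"
  by (simp add: angle_measure_def)

lemma space_angle_measure [simp]: "space angle_measure = UNIV"
  by (simp add: angle_measure_def)

lemma cis_map_measurable [measurable]:
  "(\<lambda>\<theta>::real^'n. (\<chi> j. cis (\<theta> $ j))) \<in> borel_measurable borel"
  by (intro borel_measurable_continuous_onI continuous_intros continuous_on_vec_lambda)

lemma emeasure_torus_measure_UNIV: "emeasure (torus_measure :: (complex^'n) measure) UNIV = 1"
  unfolding torus_measure_def
  by (subst emeasure_distr) (auto simp: emeasure_angle_measure_UNIV cong: measurable_cong_sets)

interpretation torus: finite_measure "torus_measure :: (complex^'n) measure"
  by standard (simp add: emeasure_torus_measure_UNIV)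

definition torus :: "(complex^'n) set" where
  "torus = {\<zeta>. \<forall>j. cmod (\<zeta> $ j) = 1}"

lemma closed_torus: "closed torus"
  unfolding torus_def by (intro closed_Collect_all closed_Collect_eq continuous_intros)

lemma AE_torus: "AE \<zeta> in torus_measure. \<zeta> \<in> torus"
  unfolding torus_measure_def
  using borel_closed[OF closed_torus]
  by (subst AE_distr_iff) (simp_all add: torus_def cong: measurable_cong_sets)

lemma integral_angle_measure:
  fixes f :: "real^'n \<Rightarrow> complex"
  assumes [measurable]: "f \<in> borel_measurable borel"
  shows "integral\<^sup>L angle_measure f
     = (\<integral>\<theta>. indicator angle_cube \<theta> *\<^sub>R f \<theta> \<partial>lborel) / (2 * pi) ^ CARD('n)"
proof -
  have "integral\<^sup>L angle_measure f
     = (\<integral>\<theta>. (indicator angle_cube \<theta> / (2 * pi) ^ CARD('n)) *\<^sub>R f \<theta> \<partial>lborel)"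
    unfolding angle_measure_def uniform_measure_def angle_cube_def[symmetric] emeasure_angle_cube
    by (subst integral_density[symmetric])
       (auto intro!: arg_cong2[where f = "integral\<^sup>L"] density_cong
             simp: divide_ennreal[of 1, simplified] indicator_def)
  also have "\<dots> = (\<integral>\<theta>. (indicator angle_cube \<theta> *\<^sub>R f \<theta>) / (2 * pi) ^ CARD('n) \<partial>lborel)"
    by (intro Bochner_Integration.integral_cong) (auto simp: indicator_def scaleR_conv_of_real)
  finally show ?thesis by simp
qed

text \<open>
  Lebesgue measure on \<open>real^'n\<close> is a product measure indexed by the basis vectors; these are the
  coordinate axes, so the product over the basis is a product over the coordinates.
\<close>

lemma integral_lborel_prod:
  fixes f :: "'n::finite \<Rightarrow> real \<Rightarrow> complex"
  assumes int: "\<And>j. integrable lborel (f j)"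
  shows "(\<integral>\<theta>. (\<Prod>j\<in>UNIV. f j (\<theta> $ j)) \<partial>(lborel :: (real^'n) measure)) = (\<Prod>j\<in>UNIV. \<integral>x. f j x \<partial>lborel)"
proof -
  interpret product_sigma_finite "\<lambda>b::real^'n. lborel :: real measure" by standard
  have [measurable]: "f j \<in> borel_measurable borel" for j
    using borel_measurable_integrable[OF int[of j]] by simp
  \<comment> \<open>The family \<open>f\<close>, indexed by basis vectors instead of coordinates.\<close>
  define g where "g b = f (SOME j. b = axis j 1)" for b :: "real^'n"
  have g: "g (axis j 1) = f j" for j
    by (simp add: g_def axis_eq_axis)
  have inj: "inj (\<lambda>j. axis j (1::real) :: real^'n)"
    by (auto simp: inj_def axis_eq_axis)
  have Basis: "(Basis :: (real^'n) set) = range (\<lambda>j. axis j 1)"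
    by (auto simp: Basis_vec_def)
  have prod_Basis: "(\<Prod>b\<in>(Basis :: (real^'n) set). h b) = (\<Prod>j\<in>UNIV. h (axis j 1))" for h :: "_ \<Rightarrow> complex"
    unfolding Basis by (subst prod.reindex) (auto simp: inj)
  have "(\<integral>\<theta>. (\<Prod>j\<in>UNIV. f j (\<theta> $ j)) \<partial>(lborel :: (real^'n) measure))
    = (\<integral>x. (\<Prod>j\<in>UNIV. f j ((\<Sum>b\<in>Basis. x b *\<^sub>R b) $ j)) \<partial>(\<Pi>\<^sub>M b\<in>(Basis::(real^'n) set). lborel))"
    by (subst lborel_eq, subst integral_distr) auto
  also have "\<dots> = (\<integral>x. (\<Prod>b\<in>Basis. g b (x b)) \<partial>(\<Pi>\<^sub>M b\<in>(Basis::(real^'n) set). lborel))"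
  proof -
    have "(\<Sum>b\<in>Basis. x b *\<^sub>R b) $ j = x (axis j 1)" for x and j :: 'n
    proof -
      have "(\<Sum>b\<in>(Basis :: (real^'n) set). x b *\<^sub>R b) $ j = (\<Sum>b\<in>Basis. x b *\<^sub>R b) \<bullet> axis j 1"
        by (simp add: inner_axis)
      also have "\<dots> = x (axis j 1)"
        by (rule inner_sum_left_Basis) (simp add: Basis)
      finally show ?thesis .
    qed
    then show ?thesis by (simp add: prod_Basis g)
  qed
  also have "\<dots> = (\<Prod>b\<in>Basis. integral\<^sup>L lborel (g b))"
    by (rule product_integral_prod) (auto simp: Basis g int)
  finally show ?thesis by (simp add: prod_Basis g)
qed

lemma integrable_cis_int:
  "set_integrable lborel {0..2*pi} (\<lambda>x. cis (of_int m * x))"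
  unfolding set_integrable_def
  by (intro borel_integrable_compact) (auto intro!: continuous_intros)

lemma integral_cis_int:
  "(\<integral>x. indicator {0..2*pi} x *\<^sub>R cis (of_int m * x) \<partial>lborel) = (if m = 0 then 2 * pi else 0)"
proof (cases "m = 0")
  case True
  then show ?thesis by (simp add: scaleR_conv_of_real)
next
  case False
  have "((\<lambda>x. cis (of_int m * x)) has_integral
      (cis (of_int m * (2 * pi)) / (\<i> * of_int m) - cis (of_int m * 0) / (\<i> * of_int m))) {0..2*pi}"
  proof (rule fundamental_theorem_of_calculus)
    show "((\<lambda>x. cis (of_int m * x) / (\<i> * of_int m)) has_vector_derivative cis (of_int m * x))
        (at x within {0..2*pi})" for x
    proof -
      have i_cancel: "- (\<i> * (w * \<i>)) = w" for w
        by (simp add: complex_eq_iff)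
      have "((\<lambda>z. exp (\<i> * (of_int m * z)) / (\<i> * of_int m)) has_field_derivative
          exp (\<i> * (of_int m * of_real x))) (at (of_real x))"
        using False i_cancel by (auto intro!: derivative_eq_intros)
      then have "((\<lambda>x. exp (\<i> * (of_int m * of_real x)) / (\<i> * of_int m)) has_vector_derivative
          exp (\<i> * (of_int m * of_real x))) (at x within {0..2*pi})"
        by (rule has_vector_derivative_real_field)
      then show ?thesis by (simp add: cis_conv_exp)
    qed
  qed auto
  moreover have "cis (of_int m * (2 * pi)) = 1"
    by (metis cis_multiple_2pi Ints_of_int mult.commute mult.left_commute)
  ultimately have "((\<lambda>x. cis (of_int m * x)) has_integral 0) {0..2*pi}"
    by simp
  then show ?thesis
    using integrable_cis_int[of m] set_borel_integral_eq_integral(2)[of "{0..2*pi}" "\<lambda>x. cis (of_int m * x)"] False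
    by (simp add: set_lebesgue_integral_def integral_unique)
qed

lemma powi_measurable [measurable]:
  "(\<lambda>z::complex. z powi m) \<in> borel_measurable borel"
  unfolding power_int_def by measurable

lemma monomial_measurable [measurable]:
  "monomial \<alpha> \<in> borel_measurable (borel :: (complex^'n) measure)"
proof -
  have [measurable]: "(\<lambda>z::complex^'n. z $ j) \<in> borel_measurable borel" for j
    by (intro borel_measurable_continuous_onI continuous_intros)
  show ?thesis unfolding monomial_def[abs_def] by measurable
qed

text \<open>
  Contains the orthonormality of the monomials, since on the torus $\zeta^\beta\overline{\zeta^\alpha}
  = \zeta^{\beta-\alpha}$.
\<close>

lemma integral_monomial:
  "(\<integral>\<zeta>. monomial \<alpha> \<zeta> \<partial>torus_measure) = (if \<alpha> = 0 then 1 else 0)"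
proof -
  let ?c = "\<lambda>j x. indicator {0..2*pi} x *\<^sub>R cis (of_int (\<alpha> $ j) * x)"
  have "(\<integral>\<zeta>. monomial \<alpha> \<zeta> \<partial>torus_measure)
    = (\<integral>\<theta>. (\<Prod>j\<in>UNIV. cis (of_int (\<alpha> $ j) * \<theta> $ j)) \<partial>angle_measure)"
    unfolding torus_measure_def
    by (subst integral_distr) (auto simp: monomial_def cis_power_int cong: measurable_cong_sets)
  also have "\<dots> = (\<integral>\<theta>. indicator angle_cube \<theta> *\<^sub>R (\<Prod>j\<in>UNIV. cis (of_int (\<alpha> $ j) * \<theta> $ j)) \<partial>lborel) / (2 * pi) ^ CARD('a)"
    by (intro integral_angle_measure borel_measurable_continuous_onI continuous_intros)
  also have "(\<integral>\<theta>. indicator angle_cube \<theta> *\<^sub>R (\<Prod>j\<in>UNIV. cis (of_int (\<alpha> $ j) * \<theta> $ j)) \<partial>lborel)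
     = (\<integral>\<theta>. (\<Prod>j\<in>UNIV. ?c j (\<theta> $ j)) \<partial>lborel)"
    by (intro Bochner_Integration.integral_cong refl)
       (auto simp: angle_cube_def indicator_def mem_box_cart)
  also have "\<dots> = (\<Prod>j\<in>UNIV. \<integral>x. ?c j x \<partial>lborel)"
    by (intro integral_lborel_prod)
       (auto simp: set_integrable_def[symmetric] intro!: integrable_cis_int)
  also have "\<dots> = (\<Prod>j\<in>UNIV. if \<alpha> $ j = 0 then 2 * pi else 0)"
    unfolding integral_cis_int by simp
  also have "\<dots> / (2 * pi) ^ CARD('a) = (if \<alpha> = 0 then 1 else 0)"
    by (auto simp: vec_eq_iff)
  finally show ?thesis by (simp add: of_real_prod if_distrib cong: if_cong)
qed

section \<open>Square-integrable functions and Fourier coefficients\<close>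

lemma cnj_measurable [measurable]: "cnj \<in> borel_measurable borel"
  by (intro borel_measurable_continuous_onI continuous_intros)

lemma norm_monomial_torus: "\<zeta> \<in> torus \<Longrightarrow> cmod (monomial \<alpha> \<zeta>) = 1"
  by (simp add: monomial_def torus_def norm_power_int flip: prod_norm)

lemma monomial_add:
  assumes "\<And>j. z $ j \<noteq> 0"
  shows "monomial (\<alpha> + \<beta>) z = monomial \<alpha> z * monomial \<beta> z"
  using assms by (simp add: monomial_def power_int_add prod.distrib)

lemma torus_nonzero: "\<zeta> \<in> torus \<Longrightarrow> \<zeta> $ j \<noteq> 0"
proof -
  assume "\<zeta> \<in> torus"
  then have "cmod (\<zeta> $ j) = 1" by (simp add: torus_def)
  then show ?thesis by force
qed

lemma cnj_monomial_torus:
  assumes "\<zeta> \<in> torus" shows "cnj (monomial \<alpha> \<zeta>) = monomial (- \<alpha>) \<zeta>"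
proof -
  have "cnj (\<zeta> $ j) = inverse (\<zeta> $ j)" for j
    using assms by (simp add: torus_def inverse_complex_def complex_eq_iff cmod_def)
  moreover have "cnj (w powi m) = cnj w powi m" for w m
    by (simp add: power_int_def)
  ultimately show ?thesis
    by (simp add: monomial_def power_int_minus power_int_inverse)
qed

lemma monomial_mult_cnj_torus:
  assumes "\<zeta> \<in> torus" shows "monomial \<alpha> \<zeta> * cnj (monomial \<beta> \<zeta>) = monomial (\<alpha> - \<beta>) \<zeta>"
  using monomial_add[of \<zeta> \<alpha> "- \<beta>"] torus_nonzero[OF assms] by (simp add: cnj_monomial_torus[OF assms])

lemma continuous_on_monomial:
  assumes "\<And>z j. z \<in> S \<Longrightarrow> z $ j \<noteq> 0"
  shows "continuous_on S (monomial \<alpha>)"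
  unfolding monomial_def[abs_def] using assms
  by (intro continuous_on_prod continuous_on_power_int continuous_intros) auto

abbreviation trigpoly :: "(int^'n) set \<Rightarrow> (int^'n \<Rightarrow> complex) \<Rightarrow> 'n::finite cfun" where
  "trigpoly F c \<equiv> (\<lambda>\<zeta>. \<Sum>\<alpha>\<in>F. c \<alpha> * monomial \<alpha> \<zeta>)"

lemma compact_torus: "compact (torus :: (complex^'n) set)"
proof -
  have "norm \<zeta> \<le> (\<Sum>j\<in>(UNIV::'n set). 1)" if "\<zeta> \<in> torus" for \<zeta> :: "complex^'n"
  proof -
    have "norm \<zeta> \<le> (\<Sum>j\<in>(UNIV::'n set). norm (\<zeta> $ j))"
      unfolding norm_vec_def by (intro L2_set_le_sum) auto
    then show ?thesis using that by (simp add: torus_def)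
  qed
  then show ?thesis
    using closed_torus bounded_iff compact_eq_bounded_closed by blast
qed

lemma torus_L2_iff: "g \<in> torus_L2 \<longleftrightarrow>
    g \<in> borel_measurable borel \<and> integrable torus_measure (\<lambda>\<zeta>. (cmod (g \<zeta>))\<^sup>2)"
  by (simp add: torus_L2_def cong: measurable_cong_sets)

lemma torus_L2_measurable: "g \<in> torus_L2 \<Longrightarrow> g \<in> borel_measurable borel"
  by (simp add: torus_L2_iff)

lemma integrable_torus_bounded:
  fixes f :: "complex^'n \<Rightarrow> 'b::{banach, second_countable_topology}"
  assumes "f \<in> borel_measurable borel" "\<And>\<zeta>. \<zeta> \<in> torus \<Longrightarrow> norm (f \<zeta>) \<le> B"
  shows "integrable torus_measure f"
  by (rule torus.integrable_const_bound[where B = B])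
     (use AE_torus assms in \<open>auto elim!: eventually_mono cong: measurable_cong_sets\<close>)

lemma trigpoly_measurable [measurable]: "trigpoly F c \<in> borel_measurable borel"
  by measurable

lemma bounded_torus_L2:
  assumes "f \<in> borel_measurable borel" "\<And>\<zeta>. \<zeta> \<in> torus \<Longrightarrow> cmod (f \<zeta>) \<le> B"
  shows "f \<in> torus_L2"
  unfolding torus_L2_iff
  using assms by (auto intro!: integrable_torus_bounded[where B = "B\<^sup>2"] power_mono)

lemma norm_trigpoly_le: "\<zeta> \<in> torus \<Longrightarrow> cmod (trigpoly F c \<zeta>) \<le> (\<Sum>\<alpha>\<in>F. cmod (c \<alpha>))"
  by (rule order_trans[OF norm_sum]) (simp add: norm_mult norm_monomial_torus)

lemma trigpoly_L2: "trigpoly F c \<in> torus_L2"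
  by (rule bounded_torus_L2[OF trigpoly_measurable norm_trigpoly_le])

lemma monomial_L2: "monomial \<alpha> \<in> torus_L2"
  by (rule bounded_torus_L2[where B = 1]) (auto simp: norm_monomial_torus)

lemma torus_L2_mult_integrable:
  assumes "f \<in> torus_L2" "g \<in> torus_L2"
  shows "integrable torus_measure (\<lambda>\<zeta>. f \<zeta> * cnj (g \<zeta>))"
proof (rule Bochner_Integration.integrable_bound)
  show "integrable torus_measure (\<lambda>\<zeta>. (cmod (f \<zeta>))\<^sup>2 + (cmod (g \<zeta>))\<^sup>2)"
    using assms by (auto simp: torus_L2_iff)
  show "(\<lambda>\<zeta>. f \<zeta> * cnj (g \<zeta>)) \<in> borel_measurable torus_measure"
    using assms by (auto simp: torus_L2_iff cong: measurable_cong_sets)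
  have "x * y \<le> x\<^sup>2 + y\<^sup>2" if "x \<ge> 0" "y \<ge> 0" for x y :: real
    using sum_squares_bound[of x y] that mult_nonneg_nonneg[OF that] by linarith
  then show "AE \<zeta> in torus_measure. norm (f \<zeta> * cnj (g \<zeta>)) \<le> norm ((cmod (f \<zeta>))\<^sup>2 + (cmod (g \<zeta>))\<^sup>2)"
    by (simp add: norm_mult)
qed

lemma torus_L2_add:
  assumes "f \<in> torus_L2" "g \<in> torus_L2"
  shows "(\<lambda>\<zeta>. f \<zeta> + g \<zeta>) \<in> torus_L2"
  unfolding torus_L2_iff
proof
  show [measurable]: "(\<lambda>\<zeta>. f \<zeta> + g \<zeta>) \<in> borel_measurable borel"
    using assms by (auto simp: torus_L2_iff)
  show "integrable torus_measure (\<lambda>\<zeta>. (cmod (f \<zeta> + g \<zeta>))\<^sup>2)"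
  proof (rule Bochner_Integration.integrable_bound)
    show "integrable torus_measure (\<lambda>\<zeta>. 2 * (cmod (f \<zeta>))\<^sup>2 + 2 * (cmod (g \<zeta>))\<^sup>2)"
      using assms by (auto simp: torus_L2_iff)
    show "(\<lambda>\<zeta>. (cmod (f \<zeta> + g \<zeta>))\<^sup>2) \<in> borel_measurable torus_measure"
      by measurable
    have "(cmod (f \<zeta> + g \<zeta>))\<^sup>2 \<le> 2 * (cmod (f \<zeta>))\<^sup>2 + 2 * (cmod (g \<zeta>))\<^sup>2" for \<zeta>
    proof -
      have "(cmod (f \<zeta> + g \<zeta>))\<^sup>2 \<le> (cmod (f \<zeta>) + cmod (g \<zeta>))\<^sup>2"
        by (intro power_mono norm_triangle_ineq) auto
      also have "\<dots> \<le> 2 * (cmod (f \<zeta>))\<^sup>2 + 2 * (cmod (g \<zeta>))\<^sup>2"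
        using sum_squares_bound[of "cmod (f \<zeta>)" "cmod (g \<zeta>)"] by (simp add: power2_sum)
      finally show ?thesis .
    qed
    then show "AE \<zeta> in torus_measure. norm ((cmod (f \<zeta> + g \<zeta>))\<^sup>2) \<le> norm (2 * (cmod (f \<zeta>))\<^sup>2 + 2 * (cmod (g \<zeta>))\<^sup>2)"
      by simp
  qed
qed

lemma torus_L2_bounded_mult:
  assumes f: "f \<in> torus_L2" and \<phi>: "\<phi> \<in> borel_measurable borel" "AE \<zeta> in torus_measure. cmod (\<phi> \<zeta>) \<le> C"
  shows "(\<lambda>\<zeta>. \<phi> \<zeta> * f \<zeta>) \<in> torus_L2"
  unfolding torus_L2_iff
proof
  show m[measurable]: "(\<lambda>\<zeta>. \<phi> \<zeta> * f \<zeta>) \<in> borel_measurable borel"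
    using assms by (auto simp: torus_L2_iff)
  show "integrable torus_measure (\<lambda>\<zeta>. (cmod (\<phi> \<zeta> * f \<zeta>))\<^sup>2)"
  proof (rule Bochner_Integration.integrable_bound)
    show "integrable torus_measure (\<lambda>\<zeta>. C\<^sup>2 * (cmod (f \<zeta>))\<^sup>2)"
      using f by (auto simp: torus_L2_iff)
    show "(\<lambda>\<zeta>. (cmod (\<phi> \<zeta> * f \<zeta>))\<^sup>2) \<in> borel_measurable torus_measure"
      by measurable
    show "AE \<zeta> in torus_measure. norm ((cmod (\<phi> \<zeta> * f \<zeta>))\<^sup>2) \<le> norm (C\<^sup>2 * (cmod (f \<zeta>))\<^sup>2)"
      using \<phi>(2)
      by eventually_elim (simp add: norm_mult power_mult_distrib mult_right_mono power_mono)
  qed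
qed

lemma torus_L2_cmult: "f \<in> torus_L2 \<Longrightarrow> (\<lambda>\<zeta>. c * f \<zeta>) \<in> torus_L2"
  by (rule torus_L2_bounded_mult[where C = "cmod c"]) auto

lemma torus_L2_diff: "f \<in> torus_L2 \<Longrightarrow> g \<in> torus_L2 \<Longrightarrow> (\<lambda>\<zeta>. f \<zeta> - g \<zeta>) \<in> torus_L2"
  using torus_L2_add[OF _ torus_L2_cmult[of g "-1"], of f] by simp

lemma torus_norm_nonneg: "torus_norm g \<ge> 0"
  by (simp add: torus_norm_def)

lemma torus_norm_square: "(torus_norm g)\<^sup>2 = (\<integral>\<zeta>. (cmod (g \<zeta>))\<^sup>2 \<partial>torus_measure)"
  by (simp add: torus_norm_def)

lemma torus_L2_integrable: "g \<in> torus_L2 \<Longrightarrow> integrable torus_measure g"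
proof -
  assume g: "g \<in> torus_L2"
  have "integrable torus_measure (\<lambda>\<zeta>. g \<zeta> * cnj (monomial 0 \<zeta>))"
    by (intro torus_L2_mult_integrable g monomial_L2)
  then show ?thesis by (simp add: monomial_def)
qed

lemma measure_torus_UNIV: "measure (torus_measure :: (complex^'n) measure) UNIV = 1"
  by (simp add: measure_def emeasure_torus_measure_UNIV)

text \<open>
  The total mass being 1, this is the nonnegativity of the variance of $|g|$.
\<close>

lemma torus_L1_le_L2:
  assumes "g \<in> torus_L2"
  shows "(\<integral>\<zeta>. cmod (g \<zeta>) \<partial>torus_measure) \<le> torus_norm g"
proof -
  let ?m = "\<integral>\<zeta>. cmod (g \<zeta>) \<partial>torus_measure"
  have i: "integrable torus_measure (\<lambda>\<zeta>. cmod (g \<zeta>))" "integrable torus_measure (\<lambda>\<zeta>. (cmod (g \<zeta>))\<^sup>2)"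
    using torus_L2_integrable[OF assms] assms by (auto simp: torus_L2_iff)
  have "0 \<le> (\<integral>\<zeta>. (cmod (g \<zeta>) - ?m)\<^sup>2 \<partial>torus_measure)"
    by simp
  also have "\<dots> = (\<integral>\<zeta>. (cmod (g \<zeta>))\<^sup>2 - 2 * ?m * cmod (g \<zeta>) + ?m\<^sup>2 \<partial>torus_measure)"
    by (simp add: power2_diff algebra_simps)
  also have "\<dots> = (torus_norm g)\<^sup>2 - ?m\<^sup>2"
    using i unfolding torus_norm_square by (simp add: measure_torus_UNIV power2_eq_square)
  finally have "?m\<^sup>2 \<le> (torus_norm g)\<^sup>2" by simp
  then show ?thesis
    by (rule power2_le_imp_le) (rule torus_norm_nonneg)
qed

definition fourier :: "'n::finite cfun \<Rightarrow> int^'n \<Rightarrow> complex" where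
  "fourier g \<alpha> = torus_inner g (monomial \<alpha>)"

lemma fourier_add: "f \<in> torus_L2 \<Longrightarrow> g \<in> torus_L2 \<Longrightarrow>
    fourier (\<lambda>\<zeta>. f \<zeta> + g \<zeta>) \<alpha> = fourier f \<alpha> + fourier g \<alpha>"
  unfolding fourier_def torus_inner_def
  by (simp add: distrib_right torus_L2_mult_integrable monomial_L2)

lemma fourier_cmult: "fourier (\<lambda>\<zeta>. c * f \<zeta>) \<alpha> = c * fourier f \<alpha>"
  unfolding fourier_def torus_inner_def by (simp add: mult.assoc)

lemma fourier_diff: "f \<in> torus_L2 \<Longrightarrow> g \<in> torus_L2 \<Longrightarrow>
    fourier (\<lambda>\<zeta>. f \<zeta> - g \<zeta>) \<alpha> = fourier f \<alpha> - fourier g \<alpha>"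
  unfolding fourier_def torus_inner_def
  by (simp add: left_diff_distrib torus_L2_mult_integrable monomial_L2)

lemma fourier_monomial: "fourier (monomial \<beta>) \<alpha> = (if \<alpha> = \<beta> then 1 else 0)"
proof -
  have "fourier (monomial \<beta>) \<alpha> = (\<integral>\<zeta>. monomial (\<beta> - \<alpha>) \<zeta> \<partial>torus_measure)"
    unfolding fourier_def torus_inner_def
    by (rule integral_cong_AE)
       (use AE_torus in \<open>auto simp: monomial_mult_cnj_torus elim!: eventually_mono cong: measurable_cong_sets\<close>)
  then show ?thesis by (auto simp: integral_monomial)
qed

lemma fourier_trigpoly:
  "finite F \<Longrightarrow> fourier (trigpoly F c) \<alpha> = (if \<alpha> \<in> F then c \<alpha> else 0)"
proof (induction F rule: finite_induct)
  case empty
  then show ?case by (simp add: fourier_def torus_inner_def)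
next
  case (insert \<beta> F)
  then show ?case
    using fourier_add[OF torus_L2_cmult[OF monomial_L2, of "c \<beta>" \<beta>] trigpoly_L2[of c F], of \<alpha>]
    by (auto simp: fourier_cmult fourier_monomial)
qed

lemma fourier_bound:
  assumes "g \<in> torus_L2" shows "cmod (fourier g \<alpha>) \<le> torus_norm g"
proof -
  have "cmod (fourier g \<alpha>) \<le> (\<integral>\<zeta>. cmod (g \<zeta> * cnj (monomial \<alpha> \<zeta>)) \<partial>torus_measure)"
    unfolding fourier_def torus_inner_def by (rule integral_norm_bound)
  also have "\<dots> = (\<integral>\<zeta>. cmod (g \<zeta>) \<partial>torus_measure)"
    by (rule integral_cong_AE)
       (use AE_torus torus_L2_measurable[OF assms] in \<open>auto simp: norm_mult norm_monomial_torus elim!: eventually_mono cong: measurable_cong_sets\<close>)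
  also have "\<dots> \<le> torus_norm g" by (rule torus_L1_le_L2[OF assms])
  finally show ?thesis .
qed

lemma torus_inner_trigpoly:
  assumes "g \<in> torus_L2"
  shows "torus_inner g (trigpoly F c) = (\<Sum>\<alpha>\<in>F. fourier g \<alpha> * cnj (c \<alpha>))"
proof -
  have "torus_inner g (trigpoly F c) =
     (\<integral>\<zeta>. (\<Sum>\<alpha>\<in>F. cnj (c \<alpha>) * (g \<zeta> * cnj (monomial \<alpha> \<zeta>))) \<partial>torus_measure)"
    unfolding torus_inner_def by (simp add: sum_distrib_left mult_ac)
  also have "\<dots> = (\<Sum>\<alpha>\<in>F. fourier g \<alpha> * cnj (c \<alpha>))"
    by (subst Bochner_Integration.integral_sum)
       (auto simp: torus_L2_mult_integrable[OF assms monomial_L2] fourier_def torus_inner_def mult.commute)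
  finally show ?thesis .
qed

lemma torus_norm_square_diff:
  assumes "f \<in> torus_L2" "g \<in> torus_L2"
  shows "(torus_norm (\<lambda>\<zeta>. f \<zeta> - g \<zeta>))\<^sup>2 = (torus_norm f)\<^sup>2 - 2 * Re (torus_inner f g) + (torus_norm g)\<^sup>2"
proof -
  have "(cmod (f \<zeta> - g \<zeta>))\<^sup>2 = (cmod (f \<zeta>))\<^sup>2 - 2 * Re (f \<zeta> * cnj (g \<zeta>)) + (cmod (g \<zeta>))\<^sup>2" for \<zeta>
    by (simp only: cmod_power2) (simp add: power2_eq_square algebra_simps)
  moreover define h where "h \<zeta> = f \<zeta> * cnj (g \<zeta>)" for \<zeta>
  ultimately have eq: "(cmod (f \<zeta> - g \<zeta>))\<^sup>2 = (cmod (f \<zeta>))\<^sup>2 - 2 * Re (h \<zeta>) + (cmod (g \<zeta>))\<^sup>2" for \<zeta>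
    by simp
  have h: "integrable torus_measure h"
    unfolding h_def by (rule torus_L2_mult_integrable[OF assms])
  have f: "integrable torus_measure (\<lambda>\<zeta>. (cmod (f \<zeta>))\<^sup>2)" and g: "integrable torus_measure (\<lambda>\<zeta>. (cmod (g \<zeta>))\<^sup>2)"
    using assms by (auto simp: torus_L2_iff)
  have "(\<integral>\<zeta>. (cmod (f \<zeta> - g \<zeta>))\<^sup>2 \<partial>torus_measure) =
    (\<integral>\<zeta>. (cmod (f \<zeta>))\<^sup>2 \<partial>torus_measure) - 2 * Re (\<integral>\<zeta>. h \<zeta> \<partial>torus_measure)
      + (\<integral>\<zeta>. (cmod (g \<zeta>))\<^sup>2 \<partial>torus_measure)"
    unfolding eq using f g h by simp
  then show ?thesis
    by (simp only: torus_norm_square torus_inner_def h_def)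
qed

lemma torus_norm_trigpoly:
  assumes "finite F" shows "(torus_norm (trigpoly F c))\<^sup>2 = (\<Sum>\<alpha>\<in>F. (cmod (c \<alpha>))\<^sup>2)"
proof -
  have "torus_inner (trigpoly F c) (trigpoly F c)
      = (\<integral>\<zeta>. complex_of_real ((cmod (trigpoly F c \<zeta>))\<^sup>2) \<partial>torus_measure)"
    by (simp only: torus_inner_def complex_norm_square)
  also have "\<dots> = complex_of_real ((torus_norm (trigpoly F c))\<^sup>2)"
    unfolding torus_norm_square by (rule integral_complex_of_real)
  finally have "complex_of_real ((torus_norm (trigpoly F c))\<^sup>2) = torus_inner (trigpoly F c) (trigpoly F c)" ..
  also have "\<dots> = (\<Sum>\<alpha>\<in>F. complex_of_real ((cmod (c \<alpha>))\<^sup>2))"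
    unfolding torus_inner_trigpoly[OF trigpoly_L2] fourier_trigpoly[OF assms]
    by (intro sum.cong refl) (simp only: if_True complex_norm_square)
  also have "\<dots> = complex_of_real (\<Sum>\<alpha>\<in>F. (cmod (c \<alpha>))\<^sup>2)"
    by (rule of_real_sum[symmetric])
  finally show ?thesis
    by (simp only: of_real_eq_iff)
qed

text \<open>
  Completing the square. Bessel's inequality (for $c$ the Fourier coefficients of $g$) and
  Parseval's identity are both read off from it.
\<close>

lemma torus_norm_diff_trigpoly:
  assumes "g \<in> torus_L2" "finite F"
  shows "(torus_norm (\<lambda>\<zeta>. g \<zeta> - trigpoly F c \<zeta>))\<^sup>2
     = (torus_norm g)\<^sup>2 - (\<Sum>\<alpha>\<in>F. (cmod (fourier g \<alpha>))\<^sup>2) + (\<Sum>\<alpha>\<in>F. (cmod (fourier g \<alpha> - c \<alpha>))\<^sup>2)"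
proof -
  have *: "(cmod (z - w))\<^sup>2 = (cmod z)\<^sup>2 - 2 * Re (z * cnj w) + (cmod w)\<^sup>2" for z w
    by (simp only: cmod_power2) (simp add: power2_eq_square algebra_simps)
  show ?thesis
    unfolding torus_norm_square_diff[OF assms(1) trigpoly_L2] torus_inner_trigpoly[OF assms(1)]
      torus_norm_trigpoly[OF assms(2)] *
    by (simp add: sum.distrib sum_subtractf sum_distrib_left)
qed

lemma bessel_inequality:
  assumes "g \<in> torus_L2" "finite F"
  shows "(\<Sum>\<alpha>\<in>F. (cmod (fourier g \<alpha>))\<^sup>2) \<le> (torus_norm g)\<^sup>2"
  using torus_norm_diff_trigpoly[OF assms, of "fourier g"]
    zero_le_power2[of "torus_norm (\<lambda>\<zeta>. g \<zeta> - trigpoly F (fourier g) \<zeta>)"] by simp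

section \<open>Expansions in norm and the Riesz--Fischer theorem\<close>

text \<open>
  Expansions over an arbitrary set of exponents: the boundary values use
  \<^const>\<open>hardy_index\<close>, the symbol of an operator uses all exponents.
\<close>

definition norm_expansion :: "(int^'n) set \<Rightarrow> (int^'n \<Rightarrow> complex) \<Rightarrow> 'n::finite cfun \<Rightarrow> bool" where
  "norm_expansion J c g \<longleftrightarrow>
     ((\<lambda>F. torus_norm (\<lambda>\<zeta>. g \<zeta> - trigpoly F c \<zeta>)) \<longlongrightarrow> 0) (finite_subsets_at_top J)"

lemma torus_expansion_iff: "torus_expansion a g \<longleftrightarrow> norm_expansion hardy_index a g"
  by (simp add: torus_expansion_def norm_expansion_def)

text \<open>
  Fourier coefficients are continuous in the norm, and those of the partial sums are eventually
  constant.
\<close>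

lemma norm_expansion_fourier:
  assumes g: "g \<in> torus_L2" and c: "norm_expansion J c g"
  shows "fourier g \<alpha> = (if \<alpha> \<in> J then c \<alpha> else 0)"
proof -
  let ?d = "if \<alpha> \<in> J then c \<alpha> else 0"
  have ev: "\<forall>\<^sub>F F in finite_subsets_at_top J. finite F \<and> {\<alpha>} \<inter> J \<subseteq> F \<and> F \<subseteq> J"
    unfolding eventually_finite_subsets_at_top by (rule exI[of _ "{\<alpha>} \<inter> J"]) auto
  have "((\<lambda>F. cmod (fourier g \<alpha> - ?d)) \<longlongrightarrow> 0) (finite_subsets_at_top J)"
  proof (rule tendsto_sandwich[OF _ _ tendsto_const])
    show "((\<lambda>F. torus_norm (\<lambda>\<zeta>. g \<zeta> - trigpoly F c \<zeta>)) \<longlongrightarrow> 0) (finite_subsets_at_top J)"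
      using c by (simp add: norm_expansion_def)
    show "\<forall>\<^sub>F F in finite_subsets_at_top J. cmod (fourier g \<alpha> - ?d) \<le> torus_norm (\<lambda>\<zeta>. g \<zeta> - trigpoly F c \<zeta>)"
      using ev
    proof eventually_elim
      case (elim F)
      then have "fourier (\<lambda>\<zeta>. g \<zeta> - trigpoly F c \<zeta>) \<alpha> = fourier g \<alpha> - ?d"
        by (auto simp: fourier_diff[OF g trigpoly_L2] fourier_trigpoly)
      then show ?case
        using fourier_bound[OF torus_L2_diff[OF g trigpoly_L2], of c F \<alpha>] by simp
    qed
  qed auto
  then show ?thesis
    by (simp add: tendsto_const_iff)
qed

lemma norm_expansion_parseval:
  assumes g: "g \<in> torus_L2" and c: "norm_expansion J c g"
  shows "((\<lambda>\<alpha>. (cmod (c \<alpha>))\<^sup>2) has_sum (torus_norm g)\<^sup>2) J"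
  unfolding has_sum_def
proof -
  have "((\<lambda>F. (torus_norm (\<lambda>\<zeta>. g \<zeta> - trigpoly F c \<zeta>))\<^sup>2) \<longlongrightarrow> 0\<^sup>2) (finite_subsets_at_top J)"
    using c unfolding norm_expansion_def by (rule tendsto_power)
  moreover have "\<forall>\<^sub>F F in finite_subsets_at_top J.
      (torus_norm (\<lambda>\<zeta>. g \<zeta> - trigpoly F c \<zeta>))\<^sup>2 = (torus_norm g)\<^sup>2 - (\<Sum>\<alpha>\<in>F. (cmod (c \<alpha>))\<^sup>2)"
  proof (rule eventually_finite_subsets_at_top_weakI)
    fix F assume F: "finite F" "F \<subseteq> J"
    have "fourier g \<alpha> = c \<alpha>" if "\<alpha> \<in> F" for \<alpha>
      using norm_expansion_fourier[OF g c, of \<alpha>] that F by auto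
    then show "(torus_norm (\<lambda>\<zeta>. g \<zeta> - trigpoly F c \<zeta>))\<^sup>2 = (torus_norm g)\<^sup>2 - (\<Sum>\<alpha>\<in>F. (cmod (c \<alpha>))\<^sup>2)"
      using torus_norm_diff_trigpoly[OF g F(1), of c] by simp
  qed
  ultimately have "((\<lambda>F. (torus_norm g)\<^sup>2 - (\<Sum>\<alpha>\<in>F. (cmod (c \<alpha>))\<^sup>2)) \<longlongrightarrow> 0) (finite_subsets_at_top J)"
    by (simp add: filterlim_cong[OF refl refl])
  from tendsto_diff[OF tendsto_const this, of "(torus_norm g)\<^sup>2"]
  show "(sum (\<lambda>\<alpha>. (cmod (c \<alpha>))\<^sup>2) \<longlongrightarrow> (torus_norm g)\<^sup>2) (finite_subsets_at_top J)"
    by simp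
qed

text \<open>
  The tail estimate is over finite sets disjoint from \<open>F\<close>, because differences of two partial sums
  are supported on such sets.
\<close>

lemma square_summable_tail:
  fixes c :: "'i \<Rightarrow> complex"
  assumes c: "(\<lambda>\<alpha>. (cmod (c \<alpha>))\<^sup>2) summable_on J" and e: "e > 0"
  shows "\<exists>F. finite F \<and> F \<subseteq> J \<and> (\<forall>G. finite G \<longrightarrow> G \<subseteq> J - F \<longrightarrow> (\<Sum>\<alpha>\<in>G. (cmod (c \<alpha>))\<^sup>2) \<le> e)"
proof -
  let ?S = "\<Sum>\<^sub>\<infinity>\<alpha>\<in>J. (cmod (c \<alpha>))\<^sup>2"
  have "(sum (\<lambda>\<alpha>. (cmod (c \<alpha>))\<^sup>2) \<longlongrightarrow> ?S) (finite_subsets_at_top J)"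
    using has_sum_infsum[OF c] by (simp add: has_sum_def)
  then have "\<forall>\<^sub>F F in finite_subsets_at_top J. ?S - e < sum (\<lambda>\<alpha>. (cmod (c \<alpha>))\<^sup>2) F"
    using e by (intro order_tendstoD(1)) auto
  then obtain F where F: "finite F" "F \<subseteq> J" "?S - e < sum (\<lambda>\<alpha>. (cmod (c \<alpha>))\<^sup>2) F"
    unfolding eventually_finite_subsets_at_top by blast
  have "(\<Sum>\<alpha>\<in>G. (cmod (c \<alpha>))\<^sup>2) \<le> e" if G: "finite G" "G \<subseteq> J - F" for G
  proof -
    have "sum (\<lambda>\<alpha>. (cmod (c \<alpha>))\<^sup>2) (F \<union> G) \<le> ?S"
      using F G by (intro finite_sum_le_infsum[OF c]) auto
    moreover have "sum (\<lambda>\<alpha>. (cmod (c \<alpha>))\<^sup>2) (F \<union> G) = sum (\<lambda>\<alpha>. (cmod (c \<alpha>))\<^sup>2) F + sum (\<lambda>\<alpha>. (cmod (c \<alpha>))\<^sup>2) G"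
      using F G by (intro sum.union_disjoint) auto
    ultimately show ?thesis using F(3) by simp
  qed
  then show ?thesis using F by blast
qed

lemma torus_norm_diff_trigpolys:
  assumes "finite F" "finite G"
  shows "(torus_norm (\<lambda>\<zeta>. trigpoly F c \<zeta> - trigpoly G c \<zeta>))\<^sup>2 = (\<Sum>\<alpha>\<in>(F - G) \<union> (G - F). (cmod (c \<alpha>))\<^sup>2)"
proof -
  define d where "d \<alpha> = (if \<alpha> \<in> F then c \<alpha> else - c \<alpha>)" for \<alpha>
  have "trigpoly F c \<zeta> - trigpoly G c \<zeta> = trigpoly ((F - G) \<union> (G - F)) d \<zeta>" for \<zeta>
  proof -
    have "trigpoly F c \<zeta> = trigpoly (F - G) c \<zeta> + trigpoly (F \<inter> G) c \<zeta>"
      "trigpoly G c \<zeta> = trigpoly (G - F) c \<zeta> + trigpoly (F \<inter> G) c \<zeta>"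
      using assms by (simp_all add: sum.Int_Diff[of F _ G] sum.Int_Diff[of G _ F] Int_commute add.commute)
    moreover have "trigpoly ((F - G) \<union> (G - F)) d \<zeta> = trigpoly (F - G) d \<zeta> + trigpoly (G - F) d \<zeta>"
      using assms by (intro sum.union_disjoint) auto
    moreover have "trigpoly (F - G) d \<zeta> = trigpoly (F - G) c \<zeta>" "trigpoly (G - F) d \<zeta> = - trigpoly (G - F) c \<zeta>"
      by (auto simp: d_def simp flip: sum_negf intro!: sum.cong)
    ultimately show ?thesis by simp
  qed
  then have "(torus_norm (\<lambda>\<zeta>. trigpoly F c \<zeta> - trigpoly G c \<zeta>))\<^sup>2 = (\<Sum>\<alpha>\<in>(F - G) \<union> (G - F). (cmod (d \<alpha>))\<^sup>2)"
    using assms by (simp add: torus_norm_trigpoly)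
  also have "\<dots> = (\<Sum>\<alpha>\<in>(F - G) \<union> (G - F). (cmod (c \<alpha>))\<^sup>2)"
    by (rule sum.cong) (auto simp: d_def)
  finally show ?thesis .
qed

lemma torus_norm_square_nn:
  assumes "g \<in> torus_L2"
  shows "ennreal ((torus_norm g)\<^sup>2) = (\<integral>\<^sup>+\<zeta>. ennreal ((cmod (g \<zeta>))\<^sup>2) \<partial>torus_measure)"
  using assms by (simp add: torus_norm_square nn_integral_eq_integral torus_L2_iff)

text \<open>
  Consecutive partial sums over increasing finite sets with tails at most $4^{-k}$ differ by at most
  $2^{-k}$ in $L^1$, so they converge almost everywhere; Fatou's lemma then bounds the distance of the limit from every
  partial sum over a large finite set.
\<close>

theorem riesz_fischer:
  fixes c :: "int^'n \<Rightarrow> complex"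
  assumes c: "(\<lambda>\<alpha>. (cmod (c \<alpha>))\<^sup>2) summable_on J"
  shows "\<exists>g\<in>torus_L2. norm_expansion J c g"
proof -
  have "\<forall>k. \<exists>F. finite F \<and> F \<subseteq> J \<and> (\<forall>G. finite G \<longrightarrow> G \<subseteq> J - F \<longrightarrow> (\<Sum>\<alpha>\<in>G. (cmod (c \<alpha>))\<^sup>2) \<le> (1/4)^k)"
    using square_summable_tail[OF c] by simp
  then obtain F where F: "\<And>k. finite (F k)" "\<And>k. F k \<subseteq> J"
    and tail: "\<And>k G. finite G \<Longrightarrow> G \<subseteq> J - F k \<Longrightarrow> (\<Sum>\<alpha>\<in>G. (cmod (c \<alpha>))\<^sup>2) \<le> (1/4)^k"
    by metis
  \<comment> \<open>Increasing sets: the limits along them can be compared with all larger finite sets.\<close>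
  define E where "E k = (\<Union>i\<le>k. F i)" for k :: nat
  have E: "finite (E k)" "E k \<subseteq> J" "F k \<subseteq> E k" for k
    using F by (auto simp: E_def)
  have E_mono: "E k \<subseteq> E l" if "k \<le> l" for k l
    using that by (force simp: E_def)
  have close: "(torus_norm (\<lambda>\<zeta>. trigpoly A c \<zeta> - trigpoly B c \<zeta>))\<^sup>2 \<le> (1/4)^k"
    if "finite A" "finite B" "E k \<subseteq> A" "E k \<subseteq> B" "A \<subseteq> J" "B \<subseteq> J" for A B k
    unfolding torus_norm_diff_trigpolys[OF that(1,2)]
    by (rule tail) (use that E(3)[of k] in auto)
  let ?p = "\<lambda>k. trigpoly (E k) c"
  let ?d = "\<lambda>k \<zeta>. ?p (Suc k) \<zeta> - ?p k \<zeta>"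
  have d_int: "(\<integral>\<^sup>+\<zeta>. ennreal (cmod (?d k \<zeta>)) \<partial>torus_measure) \<le> ennreal ((1/2)^k)" for k
  proof -
    have L2: "?d k \<in> torus_L2" by (intro torus_L2_diff trigpoly_L2)
    have "(\<integral>\<^sup>+\<zeta>. ennreal (cmod (?d k \<zeta>)) \<partial>torus_measure) = ennreal (\<integral>\<zeta>. cmod (?d k \<zeta>) \<partial>torus_measure)"
      by (rule nn_integral_eq_integral) (use torus_L2_integrable[OF L2] in auto)
    also have "\<dots> \<le> ennreal (torus_norm (?d k))"
      by (intro ennreal_leI torus_L1_le_L2 L2)
    also have "torus_norm (?d k) \<le> (1/2)^k"
    proof (rule power2_le_imp_le)
      have "(torus_norm (?d k))\<^sup>2 \<le> (1/4)^k"
        by (rule close) (use E E_mono[of k "Suc k"] in auto)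
      then show "(torus_norm (?d k))\<^sup>2 \<le> ((1/2)^k)\<^sup>2"
        by (simp add: power2_eq_square flip: power_mult_distrib)
    qed simp
    finally show ?thesis by (simp add: ennreal_leI)
  qed
  have "(\<integral>\<^sup>+\<zeta>. (\<Sum>k. ennreal (cmod (?d k \<zeta>))) \<partial>torus_measure)
      = (\<Sum>k. \<integral>\<^sup>+\<zeta>. ennreal (cmod (?d k \<zeta>)) \<partial>torus_measure)"
    by (rule nn_integral_suminf) (simp cong: measurable_cong_sets)
  also have "\<dots> \<le> (\<Sum>k. ennreal ((1/2)^k))"
    by (rule suminf_le[OF d_int]) auto
  also have "\<dots> = ennreal (\<Sum>k. (1/2)^k)"
    by (rule suminf_ennreal2) auto
  also have "\<dots> < \<infinity>" by simp
  finally have "AE \<zeta> in torus_measure. (\<Sum>k. ennreal (cmod (?d k \<zeta>))) \<noteq> \<infinity>"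
    by (intro nn_integral_PInf_AE) (auto cong: measurable_cong_sets)
  then have conv: "AE \<zeta> in torus_measure. convergent (\<lambda>k. ?p k \<zeta>)"
  proof eventually_elim
    case (elim \<zeta>)
    then have "summable (\<lambda>k. cmod (?d k \<zeta>))"
      by (intro summable_suminf_not_top) (auto simp: top_unique)
    then have "summable (\<lambda>k. ?d k \<zeta>)"
      by (rule summable_norm_cancel)
    then have "convergent (\<lambda>n. \<Sum>k<n. ?d k \<zeta>)"
      by (simp add: summable_iff_convergent)
    moreover have "(\<Sum>k<n. ?d k \<zeta>) = ?p n \<zeta> - ?p 0 \<zeta>" for n
      by (rule sum_lessThan_telescope)
    ultimately have "convergent (\<lambda>n. ?p n \<zeta> - ?p 0 \<zeta>)" by simp
    then show ?case
      using convergent_add[OF _ convergent_const[of "?p 0 \<zeta>"]] by fastforce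
  qed
  define g where "g \<zeta> = lim (\<lambda>k. ?p k \<zeta>)" for \<zeta>
  have g_meas [measurable]: "g \<in> borel_measurable borel"
    unfolding g_def by (rule borel_measurable_lim_metric) simp
  \<comment> \<open>Fatou's lemma transfers the Cauchy estimate to the limit.\<close>
  have fatou: "(\<integral>\<^sup>+\<zeta>. ennreal ((cmod (g \<zeta> - trigpoly A c \<zeta>))\<^sup>2) \<partial>torus_measure) \<le> ennreal ((1/4)^m)"
    if A: "finite A" "E m \<subseteq> A" "A \<subseteq> J" for A m
  proof -
    have "(\<integral>\<^sup>+\<zeta>. ennreal ((cmod (g \<zeta> - trigpoly A c \<zeta>))\<^sup>2) \<partial>torus_measure)
      = (\<integral>\<^sup>+\<zeta>. liminf (\<lambda>k. ennreal ((cmod (?p k \<zeta> - trigpoly A c \<zeta>))\<^sup>2)) \<partial>torus_measure)"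
    proof (rule nn_integral_cong_AE, use conv in eventually_elim)
      case (elim \<zeta>)
      then have "(\<lambda>k. ?p k \<zeta>) \<longlonglongrightarrow> g \<zeta>"
        by (simp add: g_def convergent_LIMSEQ_iff)
      then have "(\<lambda>k. ennreal ((cmod (?p k \<zeta> - trigpoly A c \<zeta>))\<^sup>2)) \<longlonglongrightarrow> ennreal ((cmod (g \<zeta> - trigpoly A c \<zeta>))\<^sup>2)"
        by (intro tendsto_ennrealI tendsto_power tendsto_norm tendsto_diff tendsto_const)
      then show ?case by (rule lim_imp_Liminf[OF sequentially_bot, symmetric])
    qed
    also have "\<dots> \<le> liminf (\<lambda>k. \<integral>\<^sup>+\<zeta>. ennreal ((cmod (?p k \<zeta> - trigpoly A c \<zeta>))\<^sup>2) \<partial>torus_measure)"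
      by (rule nn_integral_liminf) (simp cong: measurable_cong_sets)
    also have "\<dots> \<le> ennreal ((1/4)^m)"
    proof (rule Liminf_le)
      show "\<forall>\<^sub>F k in sequentially. (\<integral>\<^sup>+\<zeta>. ennreal ((cmod (?p k \<zeta> - trigpoly A c \<zeta>))\<^sup>2) \<partial>torus_measure) \<le> ennreal ((1/4)^m)"
      proof (rule eventually_sequentiallyI[of m])
        fix k assume "m \<le> k"
        then have "(torus_norm (\<lambda>\<zeta>. ?p k \<zeta> - trigpoly A c \<zeta>))\<^sup>2 \<le> (1/4)^m"
          by (intro close) (use A E E_mono in auto)
        then show "(\<integral>\<^sup>+\<zeta>. ennreal ((cmod (?p k \<zeta> - trigpoly A c \<zeta>))\<^sup>2) \<partial>torus_measure) \<le> ennreal ((1/4)^m)"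
          unfolding torus_norm_square_nn[OF torus_L2_diff[OF trigpoly_L2 trigpoly_L2], symmetric]
          by (rule ennreal_leI)
      qed
    qed simp
    finally show ?thesis .
  qed
  have "(\<lambda>\<zeta>. g \<zeta> - ?p 0 \<zeta>) \<in> torus_L2"
    unfolding torus_L2_iff integrable_iff_bounded
    using order.strict_trans1[OF fatou[of "E 0" 0]] E by (auto cong: measurable_cong_sets)
  from torus_L2_add[OF this trigpoly_L2[of c "E 0"]] have g: "g \<in> torus_L2"
    by simp
  have bound: "torus_norm (\<lambda>\<zeta>. g \<zeta> - trigpoly A c \<zeta>) \<le> (1/2)^m" if A: "finite A" "E m \<subseteq> A" "A \<subseteq> J" for A m
  proof (rule power2_le_imp_le)
    have "ennreal ((torus_norm (\<lambda>\<zeta>. g \<zeta> - trigpoly A c \<zeta>))\<^sup>2) \<le> ennreal ((1/4)^m)"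
      unfolding torus_norm_square_nn[OF torus_L2_diff[OF g trigpoly_L2]] by (rule fatou[OF A])
    then have "(torus_norm (\<lambda>\<zeta>. g \<zeta> - trigpoly A c \<zeta>))\<^sup>2 \<le> (1/4)^m"
      by (subst (asm) ennreal_le_iff) auto
    then show "(torus_norm (\<lambda>\<zeta>. g \<zeta> - trigpoly A c \<zeta>))\<^sup>2 \<le> ((1/2)^m)\<^sup>2"
      by (simp add: power2_eq_square flip: power_mult_distrib)
  qed simp
  have "norm_expansion J c g"
    unfolding norm_expansion_def
  proof (rule tendstoI)
    fix e :: real assume "e > 0"
    then obtain m where m: "(1/2)^m < e"
      using real_arch_pow_inv[of e "1/2"] by auto
    show "\<forall>\<^sub>F A in finite_subsets_at_top J. dist (torus_norm (\<lambda>\<zeta>. g \<zeta> - trigpoly A c \<zeta>)) 0 < e"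
      unfolding eventually_finite_subsets_at_top
    proof (intro exI[of _ "E m"] conjI allI impI)
      fix A assume "finite A \<and> E m \<subseteq> A \<and> A \<subseteq> J"
      then show "dist (torus_norm (\<lambda>\<zeta>. g \<zeta> - trigpoly A c \<zeta>)) 0 < e"
        using bound[of A m] m by (simp add: abs_of_nonneg torus_norm_nonneg)
    qed (use E in auto)
  qed
  with g show ?thesis by blast
qed

text \<open>
  Absolute summability gives uniform convergence on the torus, hence convergence in norm. In this
  way a power series, restricted to a torus of given radii, becomes a Fourier series.
\<close>

lemma norm_expansion_uniform:
  assumes g: "g \<in> borel_measurable borel"
    and c: "(\<lambda>\<alpha>. cmod (c \<alpha>)) summable_on J"
    and eq: "\<And>\<zeta>. \<zeta> \<in> torus \<Longrightarrow> g \<zeta> = (\<Sum>\<^sub>\<infinity>\<alpha>\<in>J. c \<alpha> * monomial \<alpha> \<zeta>)"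
  shows "g \<in> torus_L2" "norm_expansion J c g"
proof -
  let ?S = "\<lambda>J. \<Sum>\<^sub>\<infinity>\<alpha>\<in>J. cmod (c \<alpha>)"
  have sm: "(\<lambda>\<alpha>. c \<alpha> * monomial \<alpha> \<zeta>) summable_on J" if "\<zeta> \<in> torus" for \<zeta>
    by (rule summable_on_norm_bound[OF c]) (simp add: norm_mult norm_monomial_torus[OF that])
  have le: "cmod (g \<zeta> - trigpoly F c \<zeta>) \<le> ?S J - sum (\<lambda>\<alpha>. cmod (c \<alpha>)) F"
    if F: "finite F" "F \<subseteq> J" and \<zeta>: "\<zeta> \<in> torus" for F \<zeta>
  proof -
    have "((\<lambda>\<alpha>. c \<alpha> * monomial \<alpha> \<zeta>) has_sum (g \<zeta> - trigpoly F c \<zeta>)) (J - F)"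
      unfolding eq[OF \<zeta>] by (intro has_sum_Diff has_sum_infsum sm \<zeta> has_sum_finite F)
    moreover have "((\<lambda>\<alpha>. cmod (c \<alpha>)) has_sum (?S J - sum (\<lambda>\<alpha>. cmod (c \<alpha>)) F)) (J - F)"
      by (intro has_sum_Diff has_sum_infsum c has_sum_finite F)
    ultimately show ?thesis
      by (rule norm_infsum_le) (simp add: norm_mult norm_monomial_torus[OF \<zeta>])
  qed
  show L2: "g \<in> torus_L2"
    by (rule bounded_torus_L2[OF g]) (use le[of "{}"] in simp)
  have bd: "torus_norm (\<lambda>\<zeta>. g \<zeta> - trigpoly F c \<zeta>) \<le> ?S J - sum (\<lambda>\<alpha>. cmod (c \<alpha>)) F"
    (is "_ \<le> ?b") if F: "finite F" "F \<subseteq> J" for F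
  proof (rule power2_le_imp_le)
    have "(torus_norm (\<lambda>\<zeta>. g \<zeta> - trigpoly F c \<zeta>))\<^sup>2 \<le> (\<integral>\<zeta>. ?b\<^sup>2 \<partial>(torus_measure :: (complex^'a) measure))"
      unfolding torus_norm_square
    proof (rule integral_mono_AE)
      show "integrable torus_measure (\<lambda>\<zeta>. (cmod (g \<zeta> - trigpoly F c \<zeta>))\<^sup>2)"
        using torus_L2_diff[OF L2 trigpoly_L2] by (simp add: torus_L2_iff)
      show "AE \<zeta> in torus_measure. (cmod (g \<zeta> - trigpoly F c \<zeta>))\<^sup>2 \<le> ?b\<^sup>2"
        using AE_torus by eventually_elim (use le[OF F] in \<open>auto intro: power_mono\<close>)
    qed auto
    then show "(torus_norm (\<lambda>\<zeta>. g \<zeta> - trigpoly F c \<zeta>))\<^sup>2 \<le> ?b\<^sup>2"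
      by (simp add: measure_torus_UNIV)
    show "0 \<le> ?b"
      using finite_sum_le_infsum[OF c F] by simp
  qed
  show "norm_expansion J c g"
    unfolding norm_expansion_def
  proof (rule tendsto_sandwich[OF _ _ tendsto_const])
    show "((\<lambda>F. ?S J - sum (\<lambda>\<alpha>. cmod (c \<alpha>)) F) \<longlongrightarrow> 0) (finite_subsets_at_top J)"
      using tendsto_diff[OF tendsto_const has_sum_infsum[OF c, unfolded has_sum_def], of "?S J"] by simp
  qed (auto intro!: eventually_finite_subsets_at_top_weakI bd simp: torus_norm_nonneg)
qed

section \<open>Density of trigonometric polynomials\<close>

text \<open>
  Only values on the torus count. There the conjugate of a monomial is a monomial, which makes the
  set closed under conjugation.
\<close>

definition trig_functions :: "'n::finite cfun set" where
  "trig_functions = {p. \<exists>F c. finite F \<and> (\<forall>\<zeta>\<in>torus. p \<zeta> = trigpoly F c \<zeta>)}"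

lemma trig_functions_cong:
  "p \<in> trig_functions \<Longrightarrow> (\<And>\<zeta>. \<zeta> \<in> torus \<Longrightarrow> q \<zeta> = p \<zeta>) \<Longrightarrow> q \<in> trig_functions"
  unfolding trig_functions_def by (smt (verit) mem_Collect_eq)

lemma trig_functions_monomial: "(\<lambda>\<zeta>. c * monomial \<alpha> \<zeta>) \<in> trig_functions"
  unfolding trig_functions_def
  by (auto intro!: exI[of _ "{\<alpha>}"] exI[of _ "\<lambda>_. c"])

lemma trig_functions_add:
  assumes "p \<in> trig_functions" "q \<in> trig_functions"
  shows "(\<lambda>\<zeta>. p \<zeta> + q \<zeta>) \<in> trig_functions"
proof -
  obtain F c G d where F: "finite F" "\<And>\<zeta>. \<zeta> \<in> torus \<Longrightarrow> p \<zeta> = trigpoly F c \<zeta>"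
    and G: "finite G" "\<And>\<zeta>. \<zeta> \<in> torus \<Longrightarrow> q \<zeta> = trigpoly G d \<zeta>"
    using assms unfolding trig_functions_def by blast
  define e where "e \<alpha> = (if \<alpha> \<in> F then c \<alpha> else 0) + (if \<alpha> \<in> G then d \<alpha> else 0)" for \<alpha>
  have "trigpoly F c \<zeta> + trigpoly G d \<zeta> = trigpoly (F \<union> G) e \<zeta>" for \<zeta>
  proof -
    have "trigpoly F c \<zeta> = trigpoly (F \<union> G) (\<lambda>\<alpha>. if \<alpha> \<in> F then c \<alpha> else 0) \<zeta>"
      using F(1) G(1) by (intro sum.mono_neutral_cong_left) auto
    moreover have "trigpoly G d \<zeta> = trigpoly (F \<union> G) (\<lambda>\<alpha>. if \<alpha> \<in> G then d \<alpha> else 0) \<zeta>"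
      using F(1) G(1) by (intro sum.mono_neutral_cong_left) auto
    ultimately show ?thesis
      by (simp add: e_def distrib_right sum.distrib)
  qed
  then show ?thesis
    unfolding trig_functions_def using F G
    by (auto intro!: exI[of _ "F \<union> G"] exI[of _ e])
qed

lemma trig_functions_sum:
  assumes "\<And>i. i \<in> A \<Longrightarrow> p i \<in> trig_functions"
  shows "(\<lambda>\<zeta>. \<Sum>i\<in>A. p i \<zeta>) \<in> trig_functions"
  using assms
proof (induction A rule: infinite_finite_induct)
  case (insert i A)
  then show ?case by (simp add: trig_functions_add)
qed (use trig_functions_monomial[of 0] in simp_all)

lemma trig_functions_mult:
  assumes "p \<in> trig_functions" "q \<in> trig_functions"
  shows "(\<lambda>\<zeta>. p \<zeta> * q \<zeta>) \<in> trig_functions"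
proof -
  obtain F c G d where F: "finite F" "\<And>\<zeta>. \<zeta> \<in> torus \<Longrightarrow> p \<zeta> = trigpoly F c \<zeta>"
    and G: "finite G" "\<And>\<zeta>. \<zeta> \<in> torus \<Longrightarrow> q \<zeta> = trigpoly G d \<zeta>"
    using assms unfolding trig_functions_def by blast
  have "(\<lambda>\<zeta>. \<Sum>\<alpha>\<in>F. \<Sum>\<beta>\<in>G. (c \<alpha> * d \<beta>) * monomial (\<alpha> + \<beta>) \<zeta>) \<in> trig_functions"
    by (intro trig_functions_sum trig_functions_monomial)
  then show ?thesis
    by (rule trig_functions_cong)
       (simp add: F(2) G(2) sum_product monomial_add torus_nonzero mult_ac)
qed

lemma trig_functions_cnj:
  assumes "p \<in> trig_functions" shows "(\<lambda>\<zeta>. cnj (p \<zeta>)) \<in> trig_functions"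
proof -
  obtain F c where F: "finite F" "\<And>\<zeta>. \<zeta> \<in> torus \<Longrightarrow> p \<zeta> = trigpoly F c \<zeta>"
    using assms unfolding trig_functions_def by blast
  have "(\<lambda>\<zeta>. \<Sum>\<alpha>\<in>F. cnj (c \<alpha>) * monomial (- \<alpha>) \<zeta>) \<in> trig_functions"
    by (intro trig_functions_sum trig_functions_monomial)
  then show ?thesis
    by (rule trig_functions_cong) (simp add: F(2) cnj_monomial_torus)
qed

lemma trig_functions_const: "(\<lambda>\<zeta>. c) \<in> trig_functions"
  using trig_functions_monomial[of c 0] by (simp add: monomial_def)

lemma monomial_axis: "monomial (axis j 1) z = z $ j"
  by (simp add: monomial_def axis_def if_distrib[of "power_int _"] cong: if_cong)

lemma trig_functions_coord: "(\<lambda>\<zeta>. \<zeta> $ j) \<in> trig_functions"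
  using trig_functions_monomial[of 1 "axis j 1"] by (simp add: monomial_axis)

lemma trig_functions_continuous:
  assumes "p \<in> trig_functions" shows "continuous_on torus p"
proof -
  obtain F c where F: "\<And>\<zeta>. \<zeta> \<in> torus \<Longrightarrow> p \<zeta> = trigpoly F c \<zeta>"
    using assms unfolding trig_functions_def by blast
  have "continuous_on torus (trigpoly F c)"
    by (intro continuous_intros continuous_on_monomial torus_nonzero)
  then show ?thesis using F by (simp cong: continuous_on_cong)
qed

text \<open>
  Stone--Weierstrass: the real trigonometric polynomials contain the real and imaginary parts of
  the coordinates, and these separate points. Real approximants are needed later, where their
  squares replace $|p|^2$.
\<close>

lemma trig_functions_dense_real:
  fixes f :: "complex^'n \<Rightarrow> real"
  assumes f: "continuous_on torus f" and e: "e > 0"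
  shows "\<exists>p\<in>trig_functions. (\<forall>\<zeta>. p \<zeta> \<in> \<real>) \<and> (\<forall>\<zeta>\<in>torus. \<bar>f \<zeta> - Re (p \<zeta>)\<bar> < e)"
proof -
  define R where "R = {g :: complex^'n \<Rightarrow> real. (\<lambda>\<zeta>. complex_of_real (g \<zeta>)) \<in> trig_functions}"
  have Re: "(\<lambda>\<zeta>. Re (p \<zeta>)) \<in> R" if "p \<in> trig_functions" for p :: "'n cfun"
  proof -
    have "(\<lambda>\<zeta>. 1/2 * (p \<zeta> + cnj (p \<zeta>))) \<in> trig_functions"
      by (intro trig_functions_mult trig_functions_add trig_functions_cnj trig_functions_const that)
    moreover have "1/2 * (p \<zeta> + cnj (p \<zeta>)) = complex_of_real (Re (p \<zeta>))" for \<zeta>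
      by (simp add: complex_add_cnj)
    ultimately show ?thesis by (simp add: R_def)
  qed
  interpret function_ring_on R torus
  proof
    show "compact (torus :: (complex^'n) set)" by (rule compact_torus)
    show "continuous_on torus f" if "f \<in> R" for f
      using continuous_on_Re[OF trig_functions_continuous[OF that[unfolded R_def, simplified]]] by simp
    show "(\<lambda>x. f x + g x) \<in> R" "(\<lambda>x. f x * g x) \<in> R" if "f \<in> R" "g \<in> R" for f g
      using that by (auto simp: R_def trig_functions_add trig_functions_mult)
    show "(\<lambda>_. c) \<in> R" for c
      by (simp add: R_def trig_functions_const)
    fix x y :: "complex^'n" assume "x \<noteq> y"
    then obtain j where j: "x $ j \<noteq> y $ j" by (auto simp: vec_eq_iff)
    have 1: "(\<lambda>\<zeta>. Re (\<zeta> $ j)) \<in> R" by (intro Re trig_functions_coord)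
    have "(\<lambda>\<zeta>. Re (- \<i> * \<zeta> $ j)) \<in> R"
      by (intro Re trig_functions_mult trig_functions_const trig_functions_coord)
    then have 2: "(\<lambda>\<zeta>. Im (\<zeta> $ j)) \<in> R" by simp
    show "\<exists>f\<in>R. f x \<noteq> f y"
      using j bexI[OF _ 1] bexI[OF _ 2] by (auto simp: complex_eq_iff)
  qed
  obtain g where "g \<in> R" "\<forall>\<zeta>\<in>torus. \<bar>f \<zeta> - g \<zeta>\<bar> < e"
    using Stone_Weierstrass_basic[OF f e] by blast
  then show ?thesis
    by (intro bexI[of _ "\<lambda>\<zeta>. complex_of_real (g \<zeta>)"]) (auto simp: R_def)
qed

lemma trig_functions_dense:
  fixes f :: "'n::finite cfun"
  assumes f: "continuous_on torus f" and e: "e > 0"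
  shows "\<exists>p\<in>trig_functions. \<forall>\<zeta>\<in>torus. cmod (f \<zeta> - p \<zeta>) < e"
proof -
  have e2: "e/2 > 0" using e by simp
  from trig_functions_dense_real[OF continuous_on_Re[OF f] e2]
  obtain p where p: "p \<in> trig_functions" "(\<forall>\<zeta>. p \<zeta> \<in> \<real>) \<and> (\<forall>\<zeta>\<in>torus. \<bar>Re (f \<zeta>) - Re (p \<zeta>)\<bar> < e/2)"
    by (rule bexE)
  from trig_functions_dense_real[OF continuous_on_Im[OF f] e2]
  obtain q where q: "q \<in> trig_functions" "(\<forall>\<zeta>. q \<zeta> \<in> \<real>) \<and> (\<forall>\<zeta>\<in>torus. \<bar>Im (f \<zeta>) - Re (q \<zeta>)\<bar> < e/2)"
    by (rule bexE)
  have "(\<lambda>\<zeta>. p \<zeta> + \<i> * q \<zeta>) \<in> trig_functions"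
    by (intro trig_functions_add trig_functions_mult trig_functions_const p q)
  moreover have "cmod (f \<zeta> - (p \<zeta> + \<i> * q \<zeta>)) < e" if "\<zeta> \<in> torus" for \<zeta>
  proof -
    have "Im (p \<zeta>) = 0" "Im (q \<zeta>) = 0"
      using p(2) q(2) by (simp_all add: complex_is_Real_iff)
    then have "cmod (f \<zeta> - (p \<zeta> + \<i> * q \<zeta>)) \<le> \<bar>Re (f \<zeta>) - Re (p \<zeta>)\<bar> + \<bar>Im (f \<zeta>) - Re (q \<zeta>)\<bar>"
      using cmod_le[of "f \<zeta> - (p \<zeta> + \<i> * q \<zeta>)"] by simp
    also have "\<dots> < e/2 + e/2"
      using p(2) q(2) that by (intro add_strict_mono) auto
    finally show ?thesis by simp
  qed
  ultimately show ?thesis by (intro bexI) auto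
qed

lemma integral_torus_diff_bound:
  assumes f: "integrable torus_measure f" and g: "integrable torus_measure g"
    and e: "\<And>\<zeta>. \<zeta> \<in> torus \<Longrightarrow> cmod (f \<zeta> - g \<zeta>) \<le> e"
  shows "cmod ((\<integral>\<zeta>. f \<zeta> \<partial>(torus_measure :: (complex^'n) measure)) - (\<integral>\<zeta>. g \<zeta> \<partial>torus_measure)) \<le> e"
proof -
  have "(\<integral>\<zeta>. f \<zeta> \<partial>torus_measure) - (\<integral>\<zeta>. g \<zeta> \<partial>torus_measure) = (\<integral>\<zeta>. f \<zeta> - g \<zeta> \<partial>torus_measure)"
    using f g by simp
  also have "cmod \<dots> \<le> (\<integral>\<zeta>. cmod (f \<zeta> - g \<zeta>) \<partial>torus_measure)"
    by (rule integral_norm_bound)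
  also have "\<dots> \<le> (\<integral>\<zeta>. e \<partial>(torus_measure :: (complex^'n) measure))"
    using f g by (intro integral_mono_AE) (use AE_torus e in \<open>auto elim: eventually_mono\<close>)
  finally show ?thesis by (simp add: measure_torus_UNIV)
qed

definition vec_mult :: "complex^'n \<Rightarrow> complex^'n \<Rightarrow> complex^'n" where
  "vec_mult w z = (\<chi> j. w $ j * z $ j)"

lemma vec_mult_nth [simp]: "vec_mult w z $ j = w $ j * z $ j"
  by (simp add: vec_mult_def)

lemma monomial_vec_mult: "monomial \<alpha> (vec_mult w z) = monomial \<alpha> w * monomial \<alpha> z"
  by (simp add: monomial_def power_int_mult_distrib prod.distrib)

lemma vec_mult_torus: "w \<in> torus \<Longrightarrow> z \<in> torus \<Longrightarrow> vec_mult w z \<in> torus"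
  by (simp add: torus_def norm_mult)

lemma vec_mult_measurable [measurable]: "vec_mult w \<in> borel_measurable borel"
  unfolding vec_mult_def
  by (intro borel_measurable_continuous_onI continuous_intros continuous_on_vec_lambda)

lemma continuous_on_torus_bounded:
  fixes f :: "'n::finite cfun"
  assumes "continuous_on torus f" obtains B where "\<And>\<zeta>. \<zeta> \<in> torus \<Longrightarrow> cmod (f \<zeta>) \<le> B"
proof -
  have "bounded (f ` torus)"
    by (intro compact_imp_bounded compact_continuous_image assms compact_torus)
  then show thesis using that unfolding bounded_iff by blast
qed

text \<open>
  A rotation multiplies each monomial by a constant, and only the constant monomial has a nonzero
  integral; so the claim holds for trigonometric polynomials, and density extends it.
\<close>

lemma torus_rotation_invariant:
  fixes f :: "'n::finite cfun"
  assumes f: "continuous_on torus f" and m[measurable]: "f \<in> borel_measurable borel" and w: "w \<in> torus"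
  shows "(\<integral>\<zeta>. f (vec_mult w \<zeta>) \<partial>torus_measure) = (\<integral>\<zeta>. f \<zeta> \<partial>torus_measure)"
proof -
  let ?I = "\<lambda>h::'n cfun. \<integral>\<zeta>. h \<zeta> \<partial>torus_measure"
  have "cmod (?I (\<lambda>\<zeta>. f (vec_mult w \<zeta>)) - ?I f) \<le> 0 + e" if e: "e > 0" for e
  proof -
    obtain p where p: "p \<in> trig_functions" "\<forall>\<zeta>\<in>torus. cmod (f \<zeta> - p \<zeta>) < e/2"
      using trig_functions_dense[OF f, of "e/2"] e by auto
    then obtain F c where F: "finite F" "\<And>\<zeta>. \<zeta> \<in> torus \<Longrightarrow> p \<zeta> = trigpoly F c \<zeta>"
      unfolding trig_functions_def by blast
    let ?q = "trigpoly F c"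
    have close: "cmod (f \<zeta> - ?q \<zeta>) \<le> e/2" if "\<zeta> \<in> torus" for \<zeta>
      using p(2) F(2) that by (auto intro: less_imp_le)
    obtain B where B: "\<And>\<zeta>. \<zeta> \<in> torus \<Longrightarrow> cmod (f \<zeta>) \<le> B"
      using continuous_on_torus_bounded[OF f] by blast
    have i: "integrable torus_measure f" "integrable torus_measure ?q"
      "integrable torus_measure (\<lambda>\<zeta>. f (vec_mult w \<zeta>))" "integrable torus_measure (\<lambda>\<zeta>. ?q (vec_mult w \<zeta>))"
      by (rule integrable_torus_bounded; measurable; use B norm_trigpoly_le vec_mult_torus[OF w] in blast)+
    have im: "integrable torus_measure (monomial \<alpha>)" for \<alpha> :: "int^'n"
      by (rule torus_L2_integrable[OF monomial_L2])
    have "?I (\<lambda>\<zeta>. ?q (vec_mult w \<zeta>)) = (\<Sum>\<alpha>\<in>F. c \<alpha> * monomial \<alpha> w * ?I (monomial \<alpha>))"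
      by (simp add: monomial_vec_mult im flip: mult.assoc)
    also have "\<dots> = (\<Sum>\<alpha>\<in>F. c \<alpha> * ?I (monomial \<alpha>))"
    proof -
      have "monomial \<alpha> w * ?I (monomial \<alpha>) = ?I (monomial \<alpha>)" for \<alpha> :: "int^'n"
        unfolding integral_monomial by (cases "\<alpha> = 0") (simp_all add: monomial_def)
      then show ?thesis by (simp only: mult.assoc)
    qed
    also have "\<dots> = ?I ?q"
      by (simp add: im)
    finally have "?I (\<lambda>\<zeta>. ?q (vec_mult w \<zeta>)) = ?I ?q" .
    moreover have "cmod (?I (\<lambda>\<zeta>. f (vec_mult w \<zeta>)) - ?I (\<lambda>\<zeta>. ?q (vec_mult w \<zeta>))) \<le> e/2"
      by (rule integral_torus_diff_bound[OF i(3,4)]) (use close vec_mult_torus[OF w] in blast)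
    moreover have "cmod (?I f - ?I ?q) \<le> e/2"
      by (rule integral_torus_diff_bound[OF i(1,2)]) (use close in blast)
    ultimately show ?thesis
      using norm_triangle_ineq4[of "?I (\<lambda>\<zeta>. f (vec_mult w \<zeta>)) - ?I ?q" "?I f - ?I ?q"] by simp
  qed
  then have "cmod (?I (\<lambda>\<zeta>. f (vec_mult w \<zeta>)) - ?I f) \<le> 0"
    by (rule field_le_epsilon)
  then show ?thesis by simp
qed

section \<open>Essential bounds and uniqueness from Fourier coefficients\<close>

text \<open>
  If $v<0$ on a set of positive measure, inner regularity provides a compact subset of positive
  measure, and its indicator is a pointwise limit of continuous functions with values in $[0,1]$;
  dominated convergence contradicts the hypothesis.
\<close>

lemma AE_nonneg_torus:
  fixes v :: "complex^'n \<Rightarrow> real"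
  assumes v: "integrable torus_measure v"
    and nonneg: "\<And>h. continuous_on UNIV h \<Longrightarrow> (\<And>\<zeta>. 0 \<le> h \<zeta> \<and> h \<zeta> \<le> 1) \<Longrightarrow> 0 \<le> (\<integral>\<zeta>. v \<zeta> * h \<zeta> \<partial>torus_measure)"
  shows "AE \<zeta> in torus_measure. v \<zeta> \<ge> 0"
proof (rule ccontr)
  assume neg: "\<not> (AE \<zeta> in torus_measure. v \<zeta> \<ge> 0)"
  have [measurable]: "v \<in> borel_measurable borel"
    using borel_measurable_integrable[OF v] by (simp cong: measurable_cong_sets)
  define A where "A = {\<zeta>. v \<zeta> < 0}"
  have A [measurable]: "A \<in> sets borel" unfolding A_def by measurable
  have "emeasure torus_measure A \<noteq> 0"
    using neg by (subst (asm) AE_iff_measurable[of A]) (auto simp: A_def)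
  moreover have "emeasure torus_measure A = (SUP K\<in>{K. K \<subseteq> A \<and> compact K}. emeasure torus_measure K)"
    by (rule inner_regular) (auto simp: emeasure_torus_measure_UNIV)
  ultimately obtain K where K: "K \<subseteq> A" "compact K" "emeasure torus_measure K \<noteq> 0"
    by (metis (mono_tags, lifting) SUP_bot_conv(2) bot_ennreal mem_Collect_eq)
  have Kne: "K \<noteq> {}" using K(3) by auto
  have Kc: "closed K" and [measurable]: "K \<in> sets borel"
    using K(2) by (auto intro: compact_imp_closed borel_compact)
  define h where "h n \<zeta> = max 0 (1 - real n * infdist \<zeta> K)" for n \<zeta>
  have cont: "continuous_on UNIV (h n)" for n
    unfolding h_def by (intro continuous_intros)
  then have [measurable]: "h n \<in> borel_measurable borel" for n
    by (rule borel_measurable_continuous_onI)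
  have h01: "0 \<le> h n \<zeta> \<and> h n \<zeta> \<le> 1" for n \<zeta>
    by (simp add: h_def infdist_nonneg)
  have lim: "(\<lambda>n. h n \<zeta>) \<longlonglongrightarrow> indicator K \<zeta>" for \<zeta>
  proof (cases "\<zeta> \<in> K")
    case True
    then show ?thesis by (simp add: h_def)
  next
    case False
    then have pos: "infdist \<zeta> K > 0"
      using infdist_pos_not_in_closed[OF Kc Kne] by simp
    obtain N where N: "1 / infdist \<zeta> K < real N" using reals_Archimedean2 by blast
    have "h n \<zeta> = 0" if "n \<ge> N" for n
    proof -
      have "1 / infdist \<zeta> K \<le> real n" using N that by linarith
      then have "1 \<le> real n * infdist \<zeta> K" using pos by (simp add: divide_le_eq)
      then show ?thesis by (simp add: h_def)
    qed
    then have "(\<lambda>n. h n \<zeta>) \<longlonglongrightarrow> 0"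
      by (intro tendsto_eventually eventually_sequentiallyI)
    then show ?thesis using False by simp
  qed
  have "(\<lambda>n. \<integral>\<zeta>. v \<zeta> * h n \<zeta> \<partial>torus_measure) \<longlonglongrightarrow> (\<integral>\<zeta>. v \<zeta> * indicator K \<zeta> \<partial>torus_measure)"
  proof (rule integral_dominated_convergence[where w = "\<lambda>\<zeta>. \<bar>v \<zeta>\<bar>"])
    show "AE \<zeta> in torus_measure. (\<lambda>n. v \<zeta> * h n \<zeta>) \<longlonglongrightarrow> v \<zeta> * indicator K \<zeta>"
      by (intro AE_I2 tendsto_mult tendsto_const lim)
    show "AE \<zeta> in torus_measure. norm (v \<zeta> * h n \<zeta>) \<le> \<bar>v \<zeta>\<bar>" for n
      using h01[of n] by (intro AE_I2) (simp add: abs_mult mult_left_le)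
  qed (use v in \<open>auto cong: measurable_cong_sets\<close>)
  then have "0 \<le> (\<integral>\<zeta>. v \<zeta> * indicator K \<zeta> \<partial>torus_measure)"
    by (rule LIMSEQ_le_const) (use nonneg[OF cont h01] in blast)
  moreover have intK: "integrable torus_measure (\<lambda>\<zeta>. - (v \<zeta> * indicator K \<zeta>))"
    using integrable_real_mult_indicator[OF _ v, of K] by simp
  moreover have nn: "AE \<zeta> in torus_measure. 0 \<le> - (v \<zeta> * indicator K \<zeta>)"
    using K(1) by (intro AE_I2) (auto simp: A_def indicator_def intro: less_imp_le)
  moreover have "0 \<le> (\<integral>\<zeta>. - (v \<zeta> * indicator K \<zeta>) \<partial>torus_measure)"
    by (rule integral_nonneg_AE[OF nn])
  ultimately have "(\<integral>\<zeta>. - (v \<zeta> * indicator K \<zeta>) \<partial>torus_measure) = 0"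
    by simp
  then have "AE \<zeta> in torus_measure. - (v \<zeta> * indicator K \<zeta>) = 0"
    using integral_nonneg_eq_0_iff_AE[OF intK nn] by simp
  then have "AE \<zeta> in torus_measure. \<zeta> \<notin> K"
    by eventually_elim (use K(1) in \<open>auto simp: A_def indicator_def split: if_splits\<close>)
  then have "emeasure torus_measure K = 0"
    by (subst (asm) AE_iff_measurable[of K]) auto
  then show False using K(3) by simp
qed

text \<open>
  The quadratic form of the Laurent matrix $(\hat u(\alpha-\beta))_{\alpha,\beta}$ is integration
  of $u$ against $|p|^2$.
\<close>

lemma integral_trigpoly_square:
  assumes u: "u \<in> torus_L2"
  shows "(\<integral>\<zeta>. u \<zeta> * of_real ((cmod (trigpoly F c \<zeta>))\<^sup>2) \<partial>torus_measure)
    = (\<Sum>\<beta>\<in>F. \<Sum>\<alpha>\<in>F. c \<beta> * cnj (c \<alpha>) * fourier u (\<alpha> - \<beta>))"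
proof -
  have [measurable]: "u \<in> borel_measurable borel" by (rule torus_L2_measurable[OF u])
  have "(\<integral>\<zeta>. u \<zeta> * of_real ((cmod (trigpoly F c \<zeta>))\<^sup>2) \<partial>torus_measure)
    = (\<integral>\<zeta>. (\<Sum>\<beta>\<in>F. \<Sum>\<alpha>\<in>F. c \<beta> * cnj (c \<alpha>) * (u \<zeta> * cnj (monomial (\<alpha> - \<beta>) \<zeta>))) \<partial>torus_measure)"
  proof (rule integral_cong_AE)
    show "AE \<zeta> in torus_measure. u \<zeta> * of_real ((cmod (trigpoly F c \<zeta>))\<^sup>2)
      = (\<Sum>\<beta>\<in>F. \<Sum>\<alpha>\<in>F. c \<beta> * cnj (c \<alpha>) * (u \<zeta> * cnj (monomial (\<alpha> - \<beta>) \<zeta>)))"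
      using AE_torus
    proof eventually_elim
      case (elim \<zeta>)
      have "monomial \<beta> \<zeta> * cnj (monomial \<alpha> \<zeta>) = cnj (monomial (\<alpha> - \<beta>) \<zeta>)" for \<alpha> \<beta>
        using monomial_mult_cnj_torus[OF elim] cnj_monomial_torus[OF elim, of "\<alpha> - \<beta>"] by simp
      moreover have "of_real ((cmod (trigpoly F c \<zeta>))\<^sup>2)
        = (\<Sum>\<beta>\<in>F. \<Sum>\<alpha>\<in>F. (c \<beta> * monomial \<beta> \<zeta>) * cnj (c \<alpha> * monomial \<alpha> \<zeta>))"
        by (simp only: complex_norm_square cnj_sum sum_product)
      then have "u \<zeta> * of_real ((cmod (trigpoly F c \<zeta>))\<^sup>2)
        = (\<Sum>\<beta>\<in>F. \<Sum>\<alpha>\<in>F. c \<beta> * cnj (c \<alpha>) * (u \<zeta> * (monomial \<beta> \<zeta> * cnj (monomial \<alpha> \<zeta>))))"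
        by (simp only: sum_distrib_left complex_cnj_mult) (intro sum.cong refl, simp only: ac_simps)
      ultimately show ?case by simp
    qed
    show "(\<lambda>\<zeta>. u \<zeta> * of_real ((cmod (trigpoly F c \<zeta>))\<^sup>2)) \<in> borel_measurable torus_measure"
      by measurable
    show "(\<lambda>\<zeta>. \<Sum>\<beta>\<in>F. \<Sum>\<alpha>\<in>F. c \<beta> * cnj (c \<alpha>) * (u \<zeta> * cnj (monomial (\<alpha> - \<beta>) \<zeta>))) \<in> borel_measurable torus_measure"
      by measurable
  qed
  also have "\<dots> = (\<Sum>\<beta>\<in>F. \<Sum>\<alpha>\<in>F. c \<beta> * cnj (c \<alpha>) * fourier u (\<alpha> - \<beta>))"
    unfolding fourier_def torus_inner_def
    by (subst Bochner_Integration.integral_sum,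
        simp add: torus_L2_mult_integrable[OF u monomial_L2])+
       (simp add: torus_L2_mult_integrable[OF u monomial_L2])
  finally show ?thesis .
qed

text \<open>
  A continuous $h$ with $0\le h\le1$ is uniformly close to $p^2$ for a real trigonometric polynomial
  $p$ close to $\sqrt h$, so the hypothesis gives $|\int u h|\le C\int h$. Therefore
  $C-\mathrm{Re}(su)\ge0$ almost everywhere for each unimodular $s$, and the choices
  $s=\pm1,\pm i$ bound the real and imaginary parts of $u$ by $C$.
\<close>

theorem AE_bounded_if_quadratic_form_bounded:
  fixes u :: "'n::finite cfun"
  assumes u: "u \<in> torus_L2" and C: "C \<ge> 0"
    and form: "\<And>F c. finite F \<Longrightarrow>
      cmod (\<integral>\<zeta>. u \<zeta> * of_real ((cmod (trigpoly F c \<zeta>))\<^sup>2) \<partial>torus_measure) \<le> C * (\<Sum>\<alpha>\<in>F. (cmod (c \<alpha>))\<^sup>2)"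
  shows "AE \<zeta> in torus_measure. cmod (u \<zeta>) \<le> 2 * C"
proof -
  have um [measurable]: "u \<in> borel_measurable borel" by (rule torus_L2_measurable[OF u])
  have ui: "integrable torus_measure u" by (rule torus_L2_integrable[OF u])
  let ?L = "\<integral>\<zeta>. cmod (u \<zeta>) \<partial>torus_measure"
  have bound: "cmod (\<integral>\<zeta>. u \<zeta> * of_real (h \<zeta>) \<partial>torus_measure) \<le> C * (\<integral>\<zeta>. h \<zeta> \<partial>torus_measure)"
    if h: "continuous_on UNIV h" "\<And>\<zeta>. 0 \<le> h \<zeta> \<and> h \<zeta> \<le> 1" for h :: "complex^'n \<Rightarrow> real"
  proof (rule field_le_epsilon)
    fix e :: real assume e: "e > 0"
    have [measurable]: "h \<in> borel_measurable borel"
      by (rule borel_measurable_continuous_onI[OF h(1)])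
    \<comment> \<open>With \<open>p\<close> within \<open>d\<close> of $\sqrt h$, both sides of the inequality change by at most \<open>3 * d\<close> times \<open>?L\<close> or \<open>C\<close>.\<close>
    define d where "d = min 1 (e / (3 * (C + ?L + 1)))"
    have L: "?L \<ge> 0" by simp
    have "C + ?L + 1 > 0" using C L by linarith
    then have d: "d > 0" "d \<le> 1"
      unfolding d_def using e by (auto intro!: divide_pos_pos)
    have de: "3 * d * (C + ?L) \<le> e"
    proof -
      define K where "K = C + ?L"
      have K: "K \<ge> 0" using C L by (simp add: K_def)
      have "d \<le> e / (3 * (K + 1))" by (simp add: d_def K_def)
      then have "d * (3 * (K + 1)) \<le> e"
        using K by (subst (asm) pos_le_divide_eq) auto
      then show ?thesis
        using d K by (simp add: K_def[symmetric] algebra_simps)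
    qed
    have "continuous_on torus (\<lambda>\<zeta>. sqrt (h \<zeta>))"
      by (intro continuous_intros continuous_on_subset[OF h(1)]) auto
    from trig_functions_dense_real[OF this d(1)]
    obtain p where p: "p \<in> trig_functions"
      "(\<forall>\<zeta>. p \<zeta> \<in> \<real>) \<and> (\<forall>\<zeta>\<in>torus. \<bar>sqrt (h \<zeta>) - Re (p \<zeta>)\<bar> < d)"
      by (rule bexE)
    obtain F c where F: "finite F" "\<And>\<zeta>. \<zeta> \<in> torus \<Longrightarrow> p \<zeta> = trigpoly F c \<zeta>"
      using p(1) unfolding trig_functions_def by blast
    let ?q = "\<lambda>\<zeta>. (cmod (trigpoly F c \<zeta>))\<^sup>2"
    have close: "\<bar>h \<zeta> - ?q \<zeta>\<bar> \<le> 3 * d" if \<zeta>: "\<zeta> \<in> torus" for \<zeta>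
    proof -
      define s t where "s = sqrt (h \<zeta>)" and "t = Re (p \<zeta>)"
      have st: "\<bar>s - t\<bar> \<le> d" using p(2) \<zeta> by (auto simp: s_def t_def intro: less_imp_le)
      have s: "0 \<le> s" "s \<le> 1" using h(2)[of \<zeta>] by (auto simp: s_def)
      have "?q \<zeta> = t\<^sup>2"
      proof -
        have "Im (p \<zeta>) = 0" using p(2) by (simp add: complex_is_Real_iff)
        then have "(cmod (p \<zeta>))\<^sup>2 = t\<^sup>2" by (simp add: t_def cmod_power2)
        then show ?thesis by (simp only: F(2)[OF \<zeta>])
      qed
      moreover have "h \<zeta> = s\<^sup>2" using h(2)[of \<zeta>] by (simp add: s_def)
      ultimately have "\<bar>h \<zeta> - ?q \<zeta>\<bar> = \<bar>s - t\<bar> * \<bar>s + t\<bar>"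
        by (simp add: power2_eq_square square_diff_square_factored abs_mult mult.commute)
      also have "\<dots> \<le> d * 3"
        using st s d by (intro mult_mono) auto
      finally show ?thesis by simp
    qed
    have int: "integrable torus_measure h" "integrable torus_measure ?q"
      using h(2) trigpoly_L2[of c F] by (auto simp: torus_L2_iff intro!: integrable_torus_bounded[where B = 1])
    have intu: "integrable torus_measure (\<lambda>\<zeta>. u \<zeta> * of_real (h \<zeta>))"
      by (rule Bochner_Integration.integrable_bound[OF ui])
         (use h(2) in \<open>auto simp: norm_mult mult_left_le cong: measurable_cong_sets\<close>)
    have qb: "?q \<zeta> \<le> (\<Sum>\<alpha>\<in>F. cmod (c \<alpha>))\<^sup>2" if "\<zeta> \<in> torus" for \<zeta>
      using norm_trigpoly_le[OF that, of c F] by (intro power_mono) auto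
    have intq: "integrable torus_measure (\<lambda>\<zeta>. u \<zeta> * of_real (?q \<zeta>))"
    proof (rule Bochner_Integration.integrable_bound)
      show "integrable torus_measure (\<lambda>\<zeta>. (\<Sum>\<alpha>\<in>F. cmod (c \<alpha>))\<^sup>2 *\<^sub>R u \<zeta>)"
        using ui by simp
      show "AE \<zeta> in torus_measure. norm (u \<zeta> * of_real (?q \<zeta>)) \<le> norm ((\<Sum>\<alpha>\<in>F. cmod (c \<alpha>))\<^sup>2 *\<^sub>R u \<zeta>)"
        using AE_torus
      proof eventually_elim
        case (elim \<zeta>)
        have "norm (u \<zeta> * of_real (?q \<zeta>)) = ?q \<zeta> * cmod (u \<zeta>)"
          by (simp only: norm_mult norm_of_real abs_power2 mult.commute)
        also have "\<dots> \<le> (\<Sum>\<alpha>\<in>F. cmod (c \<alpha>))\<^sup>2 * cmod (u \<zeta>)"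
          by (intro mult_right_mono qb elim) simp
        also have "\<dots> = norm ((\<Sum>\<alpha>\<in>F. cmod (c \<alpha>))\<^sup>2 *\<^sub>R u \<zeta>)"
          by (simp only: norm_scaleR abs_power2)
        finally show ?case .
      qed
    qed (simp cong: measurable_cong_sets)
    have "cmod ((\<integral>\<zeta>. u \<zeta> * of_real (h \<zeta>) \<partial>torus_measure) - (\<integral>\<zeta>. u \<zeta> * of_real (?q \<zeta>) \<partial>torus_measure))
       = cmod (\<integral>\<zeta>. u \<zeta> * of_real (h \<zeta>) - u \<zeta> * of_real (?q \<zeta>) \<partial>torus_measure)"
      by (subst Bochner_Integration.integral_diff[OF intu intq]) simp
    also have "\<dots> \<le> (\<integral>\<zeta>. cmod (u \<zeta> * of_real (h \<zeta>) - u \<zeta> * of_real (?q \<zeta>)) \<partial>torus_measure)"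
      by (rule integral_norm_bound)
    also have "\<dots> \<le> (\<integral>\<zeta>. 3 * d * cmod (u \<zeta>) \<partial>torus_measure)"
    proof (rule integral_mono_AE)
      show "AE \<zeta> in torus_measure. cmod (u \<zeta> * of_real (h \<zeta>) - u \<zeta> * of_real (?q \<zeta>)) \<le> 3 * d * cmod (u \<zeta>)"
        using AE_torus
      proof eventually_elim
        case (elim \<zeta>)
        have "cmod (u \<zeta> * of_real (h \<zeta>) - u \<zeta> * of_real (?q \<zeta>)) = cmod (u \<zeta>) * \<bar>h \<zeta> - ?q \<zeta>\<bar>"
          by (simp only: right_diff_distrib[symmetric] of_real_diff[symmetric] norm_mult norm_of_real)
        then show ?case
          using mult_left_mono[OF close[OF elim] norm_ge_zero[of "u \<zeta>"]] by (simp add: mult.commute)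
      qed
    qed (use intu intq ui in auto)
    also have "\<dots> = 3 * d * ?L" by simp
    finally have 1: "cmod ((\<integral>\<zeta>. u \<zeta> * of_real (h \<zeta>) \<partial>torus_measure) - (\<integral>\<zeta>. u \<zeta> * of_real (?q \<zeta>) \<partial>torus_measure)) \<le> 3 * d * ?L" .
    have "(\<integral>\<zeta>. ?q \<zeta> \<partial>torus_measure) \<le> (\<integral>\<zeta>. h \<zeta> + 3 * d \<partial>torus_measure)"
    proof (rule integral_mono_AE)
      show "AE \<zeta> in torus_measure. ?q \<zeta> \<le> h \<zeta> + 3 * d"
        using AE_torus
      proof eventually_elim
        case (elim \<zeta>)
        show ?case using close[OF elim] by linarith
      qed
      show "integrable torus_measure (\<lambda>\<zeta>. h \<zeta> + 3 * d)"
        by (intro Bochner_Integration.integrable_add int) simp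
    qed (rule int)
    then have "(\<Sum>\<alpha>\<in>F. (cmod (c \<alpha>))\<^sup>2) \<le> (\<integral>\<zeta>. h \<zeta> \<partial>torus_measure) + 3 * d"
    proof -
      assume le: "(\<integral>\<zeta>. ?q \<zeta> \<partial>torus_measure) \<le> (\<integral>\<zeta>. h \<zeta> + 3 * d \<partial>torus_measure)"
      have "(\<integral>\<zeta>. h \<zeta> + 3 * d \<partial>torus_measure) = (\<integral>\<zeta>. h \<zeta> \<partial>torus_measure) + (\<integral>\<zeta>. 3 * d \<partial>(torus_measure :: (complex^'n) measure))"
        by (rule Bochner_Integration.integral_add[OF int(1)]) simp
      then show ?thesis
        using le unfolding torus_norm_trigpoly[OF F(1), symmetric] torus_norm_square
        by (simp add: measure_torus_UNIV)
    qed
    then have 2: "cmod (\<integral>\<zeta>. u \<zeta> * of_real (?q \<zeta>) \<partial>torus_measure) \<le> C * ((\<integral>\<zeta>. h \<zeta> \<partial>torus_measure) + 3 * d)"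
      by (rule order_trans[OF form[OF F(1)] mult_left_mono[OF _ C]])
    have "cmod (\<integral>\<zeta>. u \<zeta> * of_real (h \<zeta>) \<partial>torus_measure) \<le> 3 * d * ?L + C * ((\<integral>\<zeta>. h \<zeta> \<partial>torus_measure) + 3 * d)"
      using 1 2 norm_triangle_sub[of "\<integral>\<zeta>. u \<zeta> * of_real (h \<zeta>) \<partial>torus_measure" "\<integral>\<zeta>. u \<zeta> * of_real (?q \<zeta>) \<partial>torus_measure"]
      by linarith
    also have "\<dots> = C * (\<integral>\<zeta>. h \<zeta> \<partial>torus_measure) + 3 * d * (C + ?L)"
      by (simp add: algebra_simps)
    finally show "cmod (\<integral>\<zeta>. u \<zeta> * of_real (h \<zeta>) \<partial>torus_measure) \<le> C * (\<integral>\<zeta>. h \<zeta> \<partial>torus_measure) + e"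
      using de by linarith
  qed
  have half: "AE \<zeta> in torus_measure. 0 \<le> C - Re (s * u \<zeta>)" if s: "cmod s = 1" for s
  proof (rule AE_nonneg_torus)
    have si: "integrable torus_measure (\<lambda>\<zeta>. Re (s * u \<zeta>))"
      using ui by (intro integrable_Re) simp
    then show "integrable torus_measure (\<lambda>\<zeta>. C - Re (s * u \<zeta>))"
      by simp
    fix h :: "complex^'n \<Rightarrow> real" assume h: "continuous_on UNIV h" "\<And>\<zeta>. 0 \<le> h \<zeta> \<and> h \<zeta> \<le> 1"
    have [measurable]: "h \<in> borel_measurable borel"
      by (rule borel_measurable_continuous_onI[OF h(1)])
    have int: "integrable torus_measure h"
      using h(2) by (intro integrable_torus_bounded[where B = 1]) auto
    have intu: "integrable torus_measure (\<lambda>\<zeta>. s * (u \<zeta> * of_real (h \<zeta>)))"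
      by (rule Bochner_Integration.integrable_bound[OF ui])
         (use h(2) s in \<open>auto simp: norm_mult mult_left_le cong: measurable_cong_sets\<close>)
    have "(\<integral>\<zeta>. (C - Re (s * u \<zeta>)) * h \<zeta> \<partial>torus_measure)
      = (\<integral>\<zeta>. C * h \<zeta> - Re (s * (u \<zeta> * of_real (h \<zeta>))) \<partial>torus_measure)"
      by (intro Bochner_Integration.integral_cong refl) (simp add: algebra_simps)
    also have "\<dots> = (\<integral>\<zeta>. C * h \<zeta> \<partial>torus_measure) - (\<integral>\<zeta>. Re (s * (u \<zeta> * of_real (h \<zeta>))) \<partial>torus_measure)"
      by (rule Bochner_Integration.integral_diff[OF integrable_mult_right[OF int, of C] integrable_Re[OF intu]])
    also have "\<dots> = C * (\<integral>\<zeta>. h \<zeta> \<partial>torus_measure) - Re (s * (\<integral>\<zeta>. u \<zeta> * of_real (h \<zeta>) \<partial>torus_measure))"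
      unfolding integral_Re[OF intu] by (simp only: integral_mult_right_zero)
    finally have eq: "(\<integral>\<zeta>. (C - Re (s * u \<zeta>)) * h \<zeta> \<partial>torus_measure)
      = C * (\<integral>\<zeta>. h \<zeta> \<partial>torus_measure) - Re (s * (\<integral>\<zeta>. u \<zeta> * of_real (h \<zeta>) \<partial>torus_measure))" .
    have "Re (s * (\<integral>\<zeta>. u \<zeta> * of_real (h \<zeta>) \<partial>torus_measure))
        \<le> cmod (s * (\<integral>\<zeta>. u \<zeta> * of_real (h \<zeta>) \<partial>torus_measure))"
      by (rule complex_Re_le_cmod)
    also have "\<dots> = cmod (\<integral>\<zeta>. u \<zeta> * of_real (h \<zeta>) \<partial>torus_measure)"
      unfolding norm_mult s by (rule mult_1)
    also have "\<dots> \<le> C * (\<integral>\<zeta>. h \<zeta> \<partial>torus_measure)" by (rule bound[OF h])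
    finally show "0 \<le> (\<integral>\<zeta>. (C - Re (s * u \<zeta>)) * h \<zeta> \<partial>torus_measure)"
      unfolding eq by (simp only: diff_ge_0_iff_ge)
  qed
  have "AE \<zeta> in torus_measure. Re (u \<zeta>) \<le> C" "AE \<zeta> in torus_measure. 0 \<le> C + Re (u \<zeta>)"
    "AE \<zeta> in torus_measure. 0 \<le> C + Im (u \<zeta>)" "AE \<zeta> in torus_measure. Im (u \<zeta>) \<le> C"
    using half[of 1] half[of "-1"] half[of \<i>] half[of "-\<i>"] by simp_all
  then show ?thesis
  proof eventually_elim
    case (elim \<zeta>)
    then show ?case using cmod_le[of "u \<zeta>"] by linarith
  qed
qed

corollary AE_eq_0_if_fourier_eq_0:
  assumes "u \<in> torus_L2" "\<And>\<alpha>. fourier u \<alpha> = 0"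
  shows "AE \<zeta> in torus_measure. u \<zeta> = 0"
proof -
  have "AE \<zeta> in torus_measure. cmod (u \<zeta>) \<le> 2 * 0"
  proof (rule AE_bounded_if_quadratic_form_bounded[OF assms(1)])
    show "cmod (\<integral>\<zeta>. u \<zeta> * of_real ((cmod (trigpoly F c \<zeta>))\<^sup>2) \<partial>torus_measure)
        \<le> 0 * (\<Sum>\<alpha>\<in>F. (cmod (c \<alpha>))\<^sup>2)" for F and c :: "int^'a \<Rightarrow> complex"
      unfolding integral_trigpoly_square[OF assms(1)] assms(2) by simp
  qed simp
  then show ?thesis by eventually_elim simp
qed

text \<open>
  The torus is the image of a cube of angles. Open subsets of the cube that are not empty have positive
  measure, which settles the interior; the faces follow by continuity.
\<close>

lemma continuous_torus_AE_zero:
  fixes f :: "'n::finite cfun"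
  assumes f: "continuous_on torus f" and [measurable]: "f \<in> borel_measurable borel"
    and ae: "AE \<zeta> in torus_measure. f \<zeta> = 0" and \<zeta>: "\<zeta> \<in> torus"
  shows "f \<zeta> = 0"
proof -
  define g :: "real^'n \<Rightarrow> complex" where "g \<theta> = f (\<chi> j. cis (\<theta> $ j))" for \<theta>
  let ?a = "0 :: real^'n" and ?b = "(\<chi> j. 2 * pi) :: real^'n"
  have g: "continuous_on UNIV g"
    unfolding g_def
  proof (rule continuous_on_compose2[OF f])
    show "continuous_on UNIV (\<lambda>\<theta>::real^'n. (\<chi> j. cis (\<theta> $ j)))"
      by (intro continuous_on_vec_lambda continuous_intros)
    show "(\<lambda>\<theta>::real^'n. (\<chi> j. cis (\<theta> $ j))) ` UNIV \<subseteq> torus"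
      unfolding torus_def by (rule image_subsetI) simp
  qed
  have "AE \<theta> in angle_measure. g \<theta> = 0"
  proof -
    have "(\<lambda>\<theta>. (\<chi> j. cis (\<theta> $ j))) \<in> measurable (angle_measure :: (real^'n) measure) borel"
      by measurable
    moreover have "{z \<in> space borel. f z = 0} \<in> sets borel" by measurable
    ultimately show ?thesis
      using ae unfolding torus_measure_def g_def by (simp only: AE_distr_iff)
  qed
  then have ae': "AE \<theta> in lborel. \<theta> \<in> cbox ?a ?b \<longrightarrow> g \<theta> = 0"
  proof -
    have "emeasure lborel (cbox ?a ?b) \<noteq> 0" "emeasure lborel (cbox ?a ?b) < \<infinity>"
      unfolding emeasure_angle_cube[unfolded angle_cube_def] by simp_all
    from AE_uniform_measure[OF this] show ?thesis
      using \<open>AE \<theta> in angle_measure. g \<theta> = 0\<close> unfolding angle_measure_def by simp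
  qed
  define S where "S = {\<theta> \<in> box ?a ?b. g \<theta> \<noteq> 0}"
  have "open S"
  proof -
    have "S = box ?a ?b \<inter> g -` (- {0})"
      unfolding S_def by (rule set_eqI) simp
    moreover have "open (g -` (- {0}))"
      using g by (intro open_vimage) auto
    ultimately show ?thesis by (simp only: open_Int[OF open_box])
  qed
  moreover have "negligible S"
  proof -
    have "AE \<theta> in lborel. \<theta> \<notin> S"
      using ae' by eventually_elim (auto simp: S_def intro: box_subset_cbox[THEN subsetD])
    then have "S \<in> null_sets lborel"
      using \<open>open S\<close> by (subst (asm) AE_iff_null_sets[symmetric]) auto
    then show ?thesis
      by (simp add: negligible_iff_null_sets null_sets_completionI)
  qed
  ultimately have "S = {}"
    using open_not_negligible[of S] by auto
  have z: "g \<theta> = 0" if "\<theta> \<in> box ?a ?b" for \<theta>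
  proof (rule ccontr)
    assume "g \<theta> \<noteq> 0"
    then have "\<theta> \<in> S" using that by (simp add: S_def)
    then show False using \<open>S = {}\<close> by simp
  qed
  have ne: "box ?a ?b \<noteq> {}"
  proof -
    have "(\<chi> j. pi) \<in> box ?a ?b"
      unfolding mem_box_cart by simp
    then show ?thesis by blast
  qed
  define \<theta> where "\<theta> = (\<chi> j. Arg2pi (\<zeta> $ j))"
  have "\<theta> \<in> cbox ?a ?b"
    unfolding mem_box_cart \<theta>_def
    by (simp add: Arg2pi_ge_0 less_imp_le[OF Arg2pi_lt_2pi])
  then have \<theta>: "\<theta> \<in> closure (box ?a ?b)"
    unfolding closure_box[OF ne] .
  have "g \<theta> = 0"
  proof (rule continuous_constant_on_closure[OF _ _ \<theta>])
    show "continuous_on (closure (box ?a ?b)) g"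
      by (rule continuous_on_subset[OF g subset_UNIV])
  qed (rule z)
  moreover have "(\<chi> j. cis (\<theta> $ j)) = \<zeta>"
  proof (subst vec_eq_iff, intro allI)
    fix j
    have c: "cmod (\<zeta> $ j) = 1" using \<zeta> by (simp add: torus_def)
    have "is_Arg (\<zeta> $ j) (Arg2pi (\<zeta> $ j))" using Arg2pi by blast
    then have "cis (Arg2pi (\<zeta> $ j)) = \<zeta> $ j"
      unfolding is_Arg_def c of_real_1 mult_1 cis_conv_exp by (rule sym)
    then show "(\<chi> j. cis (\<theta> $ j)) $ j = \<zeta> $ j"
      by (simp only: \<theta>_def vec_lambda_beta)
  qed
  ultimately show ?thesis by (simp add: g_def)
qed

section \<open>Radial coordinates and monomials on the Hartogs triangle\<close>

lemma hartogs_iff: "z \<in> hartogs \<longleftrightarrow> (\<forall>i j. i < j \<longrightarrow> cmod (z $ i) < cmod (z $ j)) \<and> (\<forall>j. cmod (z $ j) < 1)"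
  by (simp add: hartogs_def)

lemma open_hartogs: "open (hartogs :: (complex^'n::{finite,linorder}) set)"
proof -
  have "(hartogs :: (complex, 'n) vec set) = (\<Inter>i. \<Inter>j\<in>{j. i < j}. {z. cmod (z $ i) < cmod (z $ j)}) \<inter> (\<Inter>j. {z. cmod (z $ j) < 1})"
    by (auto simp: hartogs_iff)
  moreover have "open \<dots>"
    by (intro open_Int open_INT finite open_Collect_less continuous_intros ballI)
  ultimately show ?thesis by simp
qed

lemma prod_powi_sum:
  fixes x :: "'a::field"
  assumes "x \<noteq> 0" shows "(\<Prod>k\<in>A. x powi e k) = x powi (\<Sum>k\<in>A. e k)"
  using assms by (induction A rule: infinite_finite_induct) (auto simp: power_int_add)

lemma prod_powi_distrib: "(\<Prod>j\<in>A. f j) powi m = (\<Prod>j\<in>A. (f j :: 'a::field) powi m)"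
  by (induction A rule: infinite_finite_induct) (auto simp: power_int_mult_distrib)

text \<open>
  Abel summation in multiplicative form. In radial coordinates $r$, where $|z_k|=\prod_{j\ge k}r_j$,
  the modulus of $z^\alpha$ depends on $\alpha$ through its partial sums, the quantities that
  define \<^const>\<open>hardy_index\<close>.
\<close>

lemma prod_suffix_powi:
  fixes r :: "'n::{finite,linorder} \<Rightarrow> real" and \<alpha> :: "(int, 'n) vec"
  assumes "\<And>j. r j \<noteq> 0"
  shows "(\<Prod>k\<in>UNIV. (\<Prod>j\<in>{k..}. r j) powi (\<alpha> $ k)) = (\<Prod>j\<in>UNIV. r j powi (\<Sum>k\<in>{..j}. \<alpha> $ k))"
proof -
  have "(\<Prod>k\<in>UNIV. (\<Prod>j\<in>{k..}. r j) powi (\<alpha> $ k)) = (\<Prod>k\<in>UNIV. \<Prod>j\<in>{j\<in>UNIV. k \<le> j}. r j powi (\<alpha> $ k))"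
    by (simp add: prod_powi_distrib atLeast_def)
  also have "\<dots> = (\<Prod>j\<in>UNIV. \<Prod>k\<in>{k\<in>UNIV. k \<le> j}. r j powi (\<alpha> $ k))"
    by (rule prod.swap_restrict) auto
  also have "\<dots> = (\<Prod>j\<in>UNIV. r j powi (\<Sum>k\<in>{..j}. \<alpha> $ k))"
    by (intro prod.cong refl) (simp add: prod_powi_sum assms atMost_def)
  finally show ?thesis .
qed

text \<open>
  The modulus $|z_{j+1}|$, with 1 in place of $|z_{n+1}|$. On the Hartogs triangle it is a minimum,
  which avoids speaking of the successor of an index.
\<close>

definition next_modulus :: "complex^'n::{finite,linorder} \<Rightarrow> 'n \<Rightarrow> real" where
  "next_modulus z j = Min (insert 1 ((\<lambda>i. cmod (z $ i)) ` {j<..}))"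

text \<open>
  The radial coordinate $r_j=|z_j|/|z_{j+1}|$ of $z$.
\<close>

definition modulus_ratio :: "complex^'n::{finite,linorder} \<Rightarrow> 'n \<Rightarrow> real" where
  "modulus_ratio z j = cmod (z $ j) / next_modulus z j"

lemma next_modulus_cases:
  "next_modulus z j = 1 \<or> (\<exists>i>j. next_modulus z j = cmod (z $ i))"
proof -
  have "next_modulus z j \<in> insert 1 ((\<lambda>i. cmod (z $ i)) ` {j<..})"
    unfolding next_modulus_def by (rule Min_in) auto
  then show ?thesis by auto
qed

lemma hartogs_pos: "z \<in> hartogs \<Longrightarrow> i < j \<Longrightarrow> cmod (z $ j) > 0"
  unfolding hartogs_iff by (meson norm_ge_zero order_le_less_trans)

lemma next_modulus_pos: "z \<in> hartogs \<Longrightarrow> next_modulus z j > 0"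
  using next_modulus_cases[of z j] hartogs_pos by fastforce

text \<open>
  A telescoping product, by induction from the largest index downwards.
\<close>

lemma modulus_eq_prod_ratio:
  assumes z: "z \<in> hartogs"
  shows "cmod (z $ k) = (\<Prod>j\<in>{k..}. modulus_ratio z j)"
proof (induction "card {k<..}" arbitrary: k rule: less_induct)
  case less
  have ins: "{k..} = insert k {k<..}" by auto
  have ratio: "modulus_ratio z k * next_modulus z k = cmod (z $ k)"
    using next_modulus_pos[OF z, of k] by (simp add: modulus_ratio_def)
  show ?case
  proof (cases "{k<..} = {}")
    case True
    then show ?thesis using ratio by (simp add: ins next_modulus_def)
  next
    case False
    define m where "m = Min {k<..}"
    have m: "m \<in> {k<..}" "\<And>i. i \<in> {k<..} \<Longrightarrow> m \<le> i"
      using False by (auto simp: m_def)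
    then have km: "{k<..} = {m..}" by (auto intro: less_le_trans)
    have "card {m<..} < card {k<..}"
      using m(1) by (intro psubset_card_mono) auto
    then have IH: "cmod (z $ m) = (\<Prod>j\<in>{m..}. modulus_ratio z j)" by (rule less)
    have "next_modulus z k = cmod (z $ m)"
      unfolding next_modulus_def
    proof (rule Min_eqI)
      fix y assume "y \<in> insert 1 ((\<lambda>i. cmod (z $ i)) ` {k<..})"
      then consider "y = 1" | i where "i \<ge> m" "y = cmod (z $ i)" using m by auto
      then show "cmod (z $ m) \<le> y"
        by cases (use z in \<open>auto simp: hartogs_iff le_less intro: less_imp_le\<close>)
    qed (use m in auto)
    moreover have "(\<Prod>j\<in>{k..}. modulus_ratio z j) = modulus_ratio z k * (\<Prod>j\<in>{k<..}. modulus_ratio z j)"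
      unfolding ins by (rule prod.insert) auto
    ultimately show ?thesis
      using ratio IH km by simp
  qed
qed

lemma modulus_ratio_nonneg: "z \<in> hartogs \<Longrightarrow> modulus_ratio z j \<ge> 0"
  using next_modulus_pos[of z j] by (simp add: modulus_ratio_def)

lemma modulus_ratio_ge: "z \<in> hartogs \<Longrightarrow> modulus_ratio z j \<ge> cmod (z $ j)"
proof -
  assume z: "z \<in> hartogs"
  have "next_modulus z j \<le> 1" by (simp add: next_modulus_def)
  then show ?thesis
    using next_modulus_pos[OF z, of j] by (simp add: modulus_ratio_def le_divide_eq mult_left_le)
qed

lemma modulus_ratio_le:
  assumes "z \<in> hartogs" "\<And>i. j < i \<Longrightarrow> cmod (z $ j) \<le> R * cmod (z $ i)" "cmod (z $ j) \<le> R"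
  shows "modulus_ratio z j \<le> R"
  using next_modulus_cases[of z j] next_modulus_pos[OF assms(1), of j] assms(2,3)
  by (auto simp: modulus_ratio_def divide_le_eq)

text \<open>
  The number $b_j$ that has to be nonnegative for \<open>\<alpha>\<close> to belong to \<^const>\<open>hardy_index\<close>. These
  numbers determine \<open>\<alpha>\<close> and serve as exponents in the radial coordinates.
\<close>

definition shifted_partial_sum :: "int^'n::{finite,linorder} \<Rightarrow> 'n \<Rightarrow> int" where
  "shifted_partial_sum \<alpha> k = (\<Sum>j\<in>{..k}. \<alpha> $ j) + int (index_pos k) - 1"

lemma hardy_index_iff: "\<alpha> \<in> hardy_index \<longleftrightarrow> (\<forall>k. shifted_partial_sum \<alpha> k \<ge> 0)"
  by (simp add: hardy_index_def shifted_partial_sum_def)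

lemma inj_shifted_partial_sum: "inj (shifted_partial_sum :: int^'n::{finite,linorder} \<Rightarrow> _)"
proof (rule injI)
  fix \<alpha> \<beta> :: "(int, 'n) vec" assume eq: "shifted_partial_sum \<alpha> = shifted_partial_sum \<beta>"
  have S: "(\<Sum>j\<in>{..k}. \<alpha> $ j) = (\<Sum>j\<in>{..k}. \<beta> $ j)" for k
    using fun_cong[OF eq, of k] by (simp add: shifted_partial_sum_def)
  have "\<alpha> $ k = \<beta> $ k" for k
  proof (induction "card {..<k}" arbitrary: k rule: less_induct)
    case less
    have "\<alpha> $ j = \<beta> $ j" if "j < k" for j
      using that by (intro less psubset_card_mono) (auto intro: less_trans)
    then have "(\<Sum>j\<in>{..<k}. \<alpha> $ j) = (\<Sum>j\<in>{..<k}. \<beta> $ j)" by (intro sum.cong) auto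
    moreover have "{..k} = insert k {..<k}" by auto
    ultimately show ?case using S[of k] by simp
  qed
  then show "\<alpha> = \<beta>" by (simp add: vec_eq_iff)
qed

lemma index_pos_pos: "index_pos (k :: 'n::{finite,linorder}) \<ge> 1"
  unfolding index_pos_def by (simp add: Suc_le_eq card_gt_0_iff)

lemma index_pos_1: "index_pos (k :: 'n::{finite,linorder}) = 1 \<longleftrightarrow> (\<forall>j. k \<le> j)"
proof
  assume "index_pos k = 1"
  then obtain x where "{..k} = {x}" by (auto simp: index_pos_def card_1_singleton_iff)
  then have "{..k} = {k}" by (metis atMost_iff order_refl singletonD)
  then show "\<forall>j. k \<le> j" by (metis atMost_iff linear singletonD)
next
  assume "\<forall>j. k \<le> j"
  then have "{..k} = {k}" by (auto intro: antisym)
  then show "index_pos k = 1" by (simp add: index_pos_def)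
qed

text \<open>
  In radial coordinates $|z^\alpha|=\prod_j r_j^{b_j-(j-1)}$, where $r_j\le R$, and $r_j\ge\delta$
  unless $j$ is the smallest index. The smallest coordinate may vanish, but its factor is
  $r_1^{b_1}$, without a negative contribution to the exponent.
\<close>

lemma norm_monomial_le:
  fixes z :: "complex^'n::{finite,linorder}"
  assumes z: "z \<in> hartogs" and \<alpha>: "\<alpha> \<in> hardy_index"
    and \<delta>: "0 < \<delta>" "\<delta> \<le> 1" "\<And>i j. i < j \<Longrightarrow> \<delta> \<le> cmod (z $ j)"
    and R: "0 \<le> R" "\<And>i j. i < j \<Longrightarrow> cmod (z $ i) \<le> R * cmod (z $ j)" "\<And>j. cmod (z $ j) \<le> R"
  shows "cmod (monomial \<alpha> z) \<le> (\<Prod>j\<in>(UNIV::'n set). 1 / \<delta> ^ (index_pos j - 1)) * (\<Prod>j\<in>UNIV. R ^ nat (shifted_partial_sum \<alpha> j))"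
proof -
  define b where "b = shifted_partial_sum \<alpha>"
  have b: "b j \<ge> 0" for j using \<alpha> by (simp add: hardy_index_iff b_def)
  let ?r = "modulus_ratio z"
  have r: "0 \<le> ?r j" "?r j \<le> R" for j
    using modulus_ratio_nonneg[OF z] modulus_ratio_le[OF z] R by auto
  have r\<delta>: "\<delta> \<le> ?r j" if "i < j" for i j
    using \<delta>(3)[OF that] modulus_ratio_ge[OF z, of j] by linarith
  have S: "(\<Sum>k\<in>{..j}. \<alpha> $ k) = b j - int (index_pos j - 1)" for j
    using index_pos_pos[of j] by (simp add: b_def shifted_partial_sum_def)
  have "cmod (monomial \<alpha> z) = (\<Prod>j\<in>UNIV. ?r j powi (\<Sum>k\<in>{..j}. \<alpha> $ k))"
  proof (cases "\<exists>j. ?r j = 0")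
    case False
    have "cmod (monomial \<alpha> z) = (\<Prod>k\<in>UNIV. (\<Prod>j\<in>{k..}. ?r j) powi (\<alpha> $ k))"
      by (simp add: monomial_def norm_power_int modulus_eq_prod_ratio[OF z] flip: prod_norm)
    then show ?thesis using False prod_suffix_powi[of ?r \<alpha>] by simp
  next
    case True
    then obtain m where m: "?r m = 0" by blast
    have min: "m \<le> j" for j
      using r\<delta>[of j m] \<delta>(1) m by (cases "j < m") auto
    have zm: "cmod (z $ m) = 0"
      using m next_modulus_pos[OF z, of m] by (simp add: modulus_ratio_def)
    have am: "{..m} = {m}" using min by (auto intro: antisym)
    have nz: "?r j \<noteq> 0" "cmod (z $ j) \<noteq> 0" if "j \<noteq> m" for j
      using min[of j] that r\<delta>[of m j] \<delta>(1) hartogs_pos[OF z, of m j] by (auto simp: less_le)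
    show ?thesis
    proof (cases "\<alpha> $ m = 0")
      case False
      have "(\<Prod>j\<in>UNIV. ?r j powi (\<Sum>k\<in>{..j}. \<alpha> $ k)) = 0"
        by (rule prod_zero) (use m am False in auto)
      moreover have "monomial \<alpha> z = 0"
        unfolding monomial_def by (rule prod_zero) (use zm False in auto)
      ultimately show ?thesis by simp
    next
      case 0: True
      \<comment> \<open>The vanishing ratio occurs with exponent 0 only and may be replaced by 1.\<close>
      define r' where "r' j = (if j = m then 1 else ?r j)" for j
      have r'nz: "r' j \<noteq> 0" for j using nz by (simp add: r'_def)
      have "cmod (monomial \<alpha> z) = (\<Prod>k\<in>UNIV. (\<Prod>j\<in>{k..}. r' j) powi (\<alpha> $ k))"
        unfolding monomial_def prod_norm[symmetric] norm_power_int
      proof (intro prod.cong refl)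
        fix k :: 'n
        show "cmod (z $ k) powi \<alpha> $ k = (\<Prod>j\<in>{k..}. r' j) powi \<alpha> $ k"
        proof (cases "k = m")
          case False
          then have "m \<notin> {k..}" using min[of k] by auto
          then have "(\<Prod>j\<in>{k..}. r' j) = (\<Prod>j\<in>{k..}. ?r j)"
            by (intro prod.cong) (auto simp: r'_def)
          then show ?thesis by (simp add: modulus_eq_prod_ratio[OF z])
        qed (simp add: 0)
      qed
      also have "\<dots> = (\<Prod>j\<in>UNIV. r' j powi (\<Sum>k\<in>{..j}. \<alpha> $ k))"
        by (rule prod_suffix_powi[OF r'nz])
      also have "\<dots> = (\<Prod>j\<in>UNIV. ?r j powi (\<Sum>k\<in>{..j}. \<alpha> $ k))"
        by (intro prod.cong refl) (auto simp: r'_def am 0)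
      finally show ?thesis .
    qed
  qed
  also have "\<dots> \<le> (\<Prod>j\<in>UNIV. 1 / \<delta> ^ (index_pos j - 1) * R ^ nat (b j))"
  proof (intro prod_mono conjI)
    fix j :: 'n
    show "0 \<le> ?r j powi (\<Sum>k\<in>{..j}. \<alpha> $ k)" using r by (intro zero_le_power_int)
    show "?r j powi (\<Sum>k\<in>{..j}. \<alpha> $ k) \<le> 1 / \<delta> ^ (index_pos j - 1) * R ^ nat (b j)"
    proof (cases "index_pos j = 1")
      case True
      then show ?thesis
        using S[of j] b[of j] r[of j] by (simp add: power_int_def power_mono)
    next
      case False
      then obtain i where "i < j" using index_pos_1[of j] by (auto simp: not_le)
      then have \<delta>r: "\<delta> \<le> ?r j" by (rule r\<delta>)
      have "?r j powi (\<Sum>k\<in>{..j}. \<alpha> $ k) = ?r j ^ nat (b j) / ?r j ^ (index_pos j - 1)"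
      proof -
        have "?r j \<noteq> 0" using \<delta>r \<delta>(1) by simp
        then have "?r j powi (\<Sum>k\<in>{..j}. \<alpha> $ k) = ?r j powi b j / ?r j powi int (index_pos j - 1)"
          unfolding S by (intro power_int_diff) simp
        also have "?r j powi b j = ?r j ^ nat (b j)"
          using b[of j] by (simp add: power_int_def)
        finally show ?thesis by (simp only: power_int_of_nat)
      qed
      also have "\<dots> \<le> R ^ nat (b j) / \<delta> ^ (index_pos j - 1)"
        using r[of j] \<delta>r \<delta>(1) R(1) by (intro frac_le power_mono) auto
      finally show ?thesis by simp
    qed
  qed
  finally show ?thesis unfolding prod.distrib b_def .
qed

text \<open>
  Since \<open>\<alpha>\<close> is determined by the exponents $b_j$, the sum is dominated by a product of $n$
  geometric series.
\<close>

lemma summable_prod_power_shifted_partial_sum: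
  fixes R :: real
  assumes R: "0 \<le> R" "R < 1"
  shows "(\<lambda>\<alpha>::int^'n::{finite,linorder}. \<Prod>j\<in>UNIV. R ^ nat (shifted_partial_sum \<alpha> j)) summable_on hardy_index"
proof (rule nonneg_bdd_above_summable_on)
  show "0 \<le> (\<Prod>j\<in>UNIV. R ^ nat (shifted_partial_sum \<alpha> j))" for \<alpha> :: "(int, 'n) vec"
    using R by (intro prod_nonneg) auto
  show "bdd_above (sum (\<lambda>\<alpha>::(int, 'n) vec. \<Prod>j\<in>UNIV. R ^ nat (shifted_partial_sum \<alpha> j)) ` {F. F \<subseteq> hardy_index \<and> finite F})"
  proof (rule bdd_aboveI2)
    fix F :: "(int, 'n) vec set" assume F: "F \<in> {F. F \<subseteq> hardy_index \<and> finite F}"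
    define b where "b \<alpha> j = nat (shifted_partial_sum \<alpha> j)" for \<alpha> :: "(int, 'n) vec" and j
    have inj: "inj_on b F"
    proof (rule inj_onI)
      fix x y assume "x \<in> F" "y \<in> F" "b x = b y"
      then have "shifted_partial_sum x j = shifted_partial_sum y j" for j
      proof -
        have "x \<in> hardy_index" "y \<in> hardy_index"
          using F \<open>x \<in> F\<close> \<open>y \<in> F\<close> by auto
        then show ?thesis
          using fun_cong[OF \<open>b x = b y\<close>, of j] by (simp add: b_def hardy_index_iff eq_nat_nat_iff)
      qed
      then show "x = y" by (intro injD[OF inj_shifted_partial_sum] ext)
    qed
    define N where "N = Max (insert 0 ((\<lambda>(\<alpha>, j). b \<alpha> j) ` (F \<times> UNIV)))"
    have N: "b \<alpha> j \<le> N" if "\<alpha> \<in> F" for \<alpha> j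
      unfolding N_def using F that by (intro Max_ge) auto
    have "sum (\<lambda>\<alpha>. \<Prod>j\<in>UNIV. R ^ b \<alpha> j) F = (\<Sum>g\<in>b ` F. \<Prod>j\<in>UNIV. R ^ g j)"
      by (simp add: sum.reindex[OF inj])
    also have "\<dots> \<le> (\<Sum>g\<in>PiE (UNIV::'n set) (\<lambda>_. {..N}). \<Prod>j\<in>UNIV. R ^ g j)"
    proof (rule sum_mono2)
      show "finite (PiE (UNIV::'n set) (\<lambda>_. {..N}))" by (rule finite_PiE) auto
      show "b ` F \<subseteq> PiE UNIV (\<lambda>_. {..N})" using N by (auto simp: PiE_UNIV_domain)
    qed (use R in \<open>auto intro: prod_nonneg\<close>)
    also have "\<dots> = (\<Prod>j\<in>(UNIV::'n set). \<Sum>i\<in>{..N}. R ^ i)"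
      by (rule prod_sum_PiE[symmetric]) auto
    also have "\<dots> \<le> (\<Prod>j\<in>(UNIV::'n set). 1 / (1 - R))"
    proof (intro prod_mono conjI sum_nonneg)
      have "(\<Sum>i\<in>{..N}. R ^ i) \<le> (\<Sum>i. R ^ i)"
        using R by (intro sum_le_suminf) auto
      then show "(\<Sum>i\<in>{..N}. R ^ i) \<le> 1 / (1 - R)"
        using R by (simp add: suminf_geometric)
    qed (use R in auto)
    finally show "sum (\<lambda>\<alpha>. \<Prod>j\<in>UNIV. R ^ nat (shifted_partial_sum \<alpha> j)) F \<le> (\<Prod>j\<in>(UNIV::'n set). 1 / (1 - R))"
      by (simp add: b_def)
  qed
qed

section \<open>Power series in the Hardy space\<close>

definition unit_radii :: "(real^'n) set" where
  "unit_radii = {r. \<forall>j. 0 < r $ j \<and> r $ j < 1}"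

text \<open>
  The point with radial coordinates \<open>r\<close> and positive coordinates. Its products with the points of
  the torus form the torus over which the Hardy norm integrates.
\<close>

definition suffix_point :: "(real, 'n::{finite,linorder}) vec \<Rightarrow> (complex, 'n) vec" where
  "suffix_point r = (\<chi> k. of_real (\<Prod>j\<in>{k..}. r $ j))"

definition radial_weight :: "real^'n::{finite,linorder} \<Rightarrow> real" where
  "radial_weight r = (\<Prod>j\<in>UNIV. (r $ j) ^ (2 * index_pos j - 1))"

lemma radial_weight_pos: "r \<in> unit_radii \<Longrightarrow> radial_weight r > 0"
  unfolding radial_weight_def unit_radii_def by (intro prod_pos) auto

lemma hardy_norm_sq_torus:
  fixes f :: "'n::{finite,linorder} cfun"
  assumes [measurable]: "f \<in> borel_measurable borel"
  shows "hardy_norm_sq f = (SUP r\<in>unit_radii. ennreal (radial_weight r) *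
     (\<integral>\<^sup>+\<zeta>. ennreal ((cmod (f (vec_mult (suffix_point r) \<zeta>)))\<^sup>2) \<partial>torus_measure))"
proof -
  have "(\<integral>\<^sup>+\<theta>. ennreal ((cmod (f (\<chi> k. of_real (\<Prod>j\<in>{k..}. r $ j) * cis (\<theta> $ k))))\<^sup>2
                    * (\<Prod>j\<in>UNIV. (r $ j) ^ (2 * index_pos j - 1))) \<partial>angle_measure)
      = ennreal (radial_weight r) * (\<integral>\<^sup>+\<zeta>. ennreal ((cmod (f (vec_mult (suffix_point r) \<zeta>)))\<^sup>2) \<partial>torus_measure)"
    if r: "r \<in> unit_radii" for r :: "(real, 'n) vec"
  proof -
    have eq: "(\<chi> k. of_real (\<Prod>j\<in>{k..}. r $ j) * cis (\<theta> $ k)) = vec_mult (suffix_point r) (\<chi> j. cis (\<theta> $ j))" for \<theta>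
      by (simp add: vec_eq_iff suffix_point_def)
    have "(\<integral>\<^sup>+\<zeta>. ennreal ((cmod (f (vec_mult (suffix_point r) \<zeta>)))\<^sup>2) \<partial>torus_measure)
       = (\<integral>\<^sup>+\<theta>. ennreal ((cmod (f (vec_mult (suffix_point r) (\<chi> j. cis (\<theta> $ j)))))\<^sup>2) \<partial>angle_measure)"
      unfolding torus_measure_def by (rule nn_integral_distr; measurable)
    moreover have "(\<integral>\<^sup>+\<theta>. ennreal ((cmod (f (vec_mult (suffix_point r) (\<chi> j. cis (\<theta> $ j)))))\<^sup>2 * radial_weight r) \<partial>angle_measure)
       = ennreal (radial_weight r) * (\<integral>\<^sup>+\<theta>. ennreal ((cmod (f (vec_mult (suffix_point r) (\<chi> j. cis (\<theta> $ j)))))\<^sup>2) \<partial>angle_measure)"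
      using radial_weight_pos[OF r]
      by (subst nn_integral_cmult[symmetric]) (simp_all add: ennreal_mult' mult.commute)
    ultimately show ?thesis
      unfolding eq radial_weight_def[symmetric] by simp
  qed
  then show ?thesis
    unfolding hardy_norm_sq_def unit_radii_def[symmetric] by (intro SUP_cong refl)
qed

lemma suffix_point_nth: "suffix_point r $ k = of_real (\<Prod>j\<in>{k..}. r $ j)"
  by (simp add: suffix_point_def)

lemma suffix_prod_less:
  fixes r :: "(real, 'n::{finite,linorder}) vec"
  assumes r: "r \<in> unit_radii" and ij: "i < j"
  shows "(\<Prod>k\<in>{i..}. r $ k) < (\<Prod>k\<in>{j..}. r $ k)"
proof -
  have "(\<Prod>k\<in>{i..}. r $ k) = (\<Prod>k\<in>{i..<j}. r $ k) * (\<Prod>k\<in>{j..}. r $ k)"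
    using ij by (subst prod.union_disjoint[symmetric]) (auto intro!: prod.cong)
  moreover have "(\<Prod>k\<in>{j..}. r $ k) > 0"
    using r by (intro prod_pos) (auto simp: unit_radii_def)
  moreover have "(\<Prod>k\<in>{i..<j}. r $ k) < 1"
  proof -
    have "(\<Prod>k\<in>{i..<j}. r $ k) = r $ i * (\<Prod>k\<in>{i..<j} - {i}. r $ k)"
      using ij by (intro prod.remove) auto
    also have "\<dots> \<le> r $ i * 1"
      using r by (intro mult_left_mono prod_le_1) (auto simp: unit_radii_def less_imp_le)
    also have "\<dots> < 1" using r by (simp add: unit_radii_def)
    finally show ?thesis .
  qed
  ultimately show ?thesis by simp
qed

lemma suffix_prod_bounds:
  fixes r :: "(real, 'n::{finite,linorder}) vec"
  assumes r: "r \<in> unit_radii"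
  shows "0 < (\<Prod>k\<in>{i..}. r $ k)" "(\<Prod>k\<in>{i..}. r $ k) < 1"
proof -
  show "0 < (\<Prod>k\<in>{i..}. r $ k)"
    using r by (intro prod_pos) (auto simp: unit_radii_def)
  have "(\<Prod>k\<in>{i..}. r $ k) = r $ i * (\<Prod>k\<in>{i..} - {i}. r $ k)"
    by (intro prod.remove) auto
  also have "\<dots> \<le> r $ i * 1"
    using r by (intro mult_left_mono prod_le_1) (auto simp: unit_radii_def less_imp_le)
  also have "\<dots> < 1" using r by (simp add: unit_radii_def)
  finally show "(\<Prod>k\<in>{i..}. r $ k) < 1" .
qed

lemma suffix_point_torus_hartogs:
  assumes r: "r \<in> unit_radii" and \<zeta>: "\<zeta> \<in> torus"
  shows "vec_mult (suffix_point r) \<zeta> \<in> hartogs"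
proof -
  have c: "cmod (\<zeta> $ k) = 1" for k using \<zeta> by (simp add: torus_def)
  have "cmod (vec_mult (suffix_point r) \<zeta> $ k) = (\<Prod>j\<in>{k..}. r $ j)" for k
    using suffix_prod_bounds(1)[OF r, of k]
    by (simp only: vec_mult_nth norm_mult c suffix_point_nth norm_of_real mult_1_right abs_of_pos)
  then show ?thesis
    unfolding hartogs_iff using suffix_prod_less[OF r] suffix_prod_bounds[OF r] by simp
qed

lemma suffix_point_nonzero: "r \<in> unit_radii \<Longrightarrow> suffix_point r $ k \<noteq> 0"
  unfolding suffix_point_nth of_real_eq_0_iff using suffix_prod_bounds(1)[of r k] by linarith

lemma monomial_suffix_point:
  assumes r: "r \<in> unit_radii"
  shows "monomial \<alpha> (suffix_point r) = of_real (\<Prod>j\<in>UNIV. (r $ j) powi (\<Sum>k\<in>{..j}. \<alpha> $ k))"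
proof -
  have nz: "r $ j \<noteq> 0" for j using r by (auto simp: unit_radii_def less_le)
  have "monomial \<alpha> (suffix_point r) = of_real (\<Prod>k\<in>UNIV. (\<Prod>j\<in>{k..}. r $ j) powi (\<alpha> $ k))"
    unfolding monomial_def suffix_point_nth of_real_prod of_real_power_int ..
  then show ?thesis
    using prod_suffix_powi[of "\<lambda>j. r $ j" \<alpha>] nz by simp
qed

text \<open>
  The weight in the Hardy norm turns the exponents $2(b_j-(j-1))$ of $|z^\alpha|^2$ into $2b_j+1$,
  which is positive exactly when $b_j\ge0$. This is why \<^const>\<open>hardy_index\<close> is the right set of
  exponents.
\<close>

lemma weighted_monomial_suffix_point:
  assumes r: "r \<in> unit_radii"
  shows "radial_weight r * (cmod (monomial \<alpha> (suffix_point r)))\<^sup>2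
     = (\<Prod>j\<in>UNIV. (r $ j) powi (2 * shifted_partial_sum \<alpha> j + 1))"
proof -
  have pos: "r $ j > 0" for j using r by (auto simp: unit_radii_def)
  let ?S = "\<lambda>j. \<Sum>k\<in>{..j}. \<alpha> $ k"
  have "(cmod (monomial \<alpha> (suffix_point r)))\<^sup>2 = (\<Prod>j\<in>UNIV. ((r $ j) powi ?S j)\<^sup>2)"
    unfolding monomial_suffix_point[OF r] norm_of_real power2_abs by (rule prod_power_distrib)
  then have "radial_weight r * (cmod (monomial \<alpha> (suffix_point r)))\<^sup>2
     = (\<Prod>j\<in>UNIV. (r $ j) ^ (2 * index_pos j - 1) * ((r $ j) powi ?S j)\<^sup>2)"
    by (simp add: radial_weight_def prod.distrib)
  also have "\<dots> = (\<Prod>j\<in>UNIV. (r $ j) powi (2 * shifted_partial_sum \<alpha> j + 1))"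
  proof (intro prod.cong refl)
    fix j
    have "(r $ j) ^ (2 * index_pos j - 1) = (r $ j) powi (2 * int (index_pos j) - 1)"
      using index_pos_pos[of j] by (subst power_int_of_nat[symmetric]) (simp add: of_nat_diff)
    moreover have "((r $ j) powi ?S j)\<^sup>2 = (r $ j) powi (2 * ?S j)"
      using power_int_mult[of "r $ j" "?S j" 2] by (simp add: mult.commute)
    moreover have "(r $ j) powi (2 * int (index_pos j) - 1) * (r $ j) powi (2 * ?S j)
       = (r $ j) powi ((2 * int (index_pos j) - 1) + 2 * ?S j)"
      using pos[of j] by (intro power_int_add[symmetric]) simp
    moreover have "(2 * int (index_pos j) - 1) + 2 * ?S j = 2 * shifted_partial_sum \<alpha> j + 1"
      by (simp add: shifted_partial_sum_def)
    ultimately show "(r $ j) ^ (2 * index_pos j - 1) * ((r $ j) powi ?S j)\<^sup>2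
       = (r $ j) powi (2 * shifted_partial_sum \<alpha> j + 1)" by simp
  qed
  finally show ?thesis .
qed

text \<open>
  Finitely many strict inequalities leave room for a common factor below 1.
\<close>

lemma exists_contraction:
  fixes A :: "(real \<times> real) set"
  assumes "finite A" "\<And>a b. (a, b) \<in> A \<Longrightarrow> 0 \<le> a \<and> a < b"
  shows "\<exists>R. 0 < R \<and> R < 1 \<and> (\<forall>(a, b)\<in>A. a < R * b)"
  using assms
proof (induction A rule: finite_induct)
  case empty
  then show ?case by (intro exI[of _ "1/2"]) auto
next
  case (insert p A)
  obtain a b where p: "p = (a, b)" by (cases p)
  have ab: "0 \<le> a" "a < b" using insert.prems p by auto
  obtain R where R: "0 < R" "R < 1" "\<forall>(a, b)\<in>A. a < R * b" using insert by auto
  define R' where "R' = max R ((a / b + 1) / 2)"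
  have q: "a / b < 1" using ab by simp
  moreover have "x < (x + 1) / 2" if "x < 1" for x :: real using that by simp
  ultimately have "a / b < (a / b + 1) / 2" by blast
  then have "a / b < R'" unfolding R'_def by (rule less_max_iff_disj[THEN iffD2, OF disjI2])
  then have "a < R' * b" using ab by (simp add: divide_less_eq)
  moreover have "c < R' * d" if "(c, d) \<in> A" for c d
  proof -
    have "c < R * d" "0 \<le> c" "c < d" using R(3) that insert.prems by auto
    moreover have "R * d \<le> R' * d" using \<open>0 \<le> c\<close> \<open>c < d\<close> by (intro mult_right_mono) (auto simp: R'_def)
    ultimately show ?thesis by linarith
  qed
  ultimately show ?case
    using R q p by (intro exI[of _ R']) (auto simp: R'_def)
qed

text \<open>
  Near $z$ the radial coordinates stay below some $R<1$, and all coordinates but the smallest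
  stay away from 0, so the monomials have a common square-summable bound $q$; then
  $|a_\alpha|q_\alpha\le|a_\alpha|^2+q_\alpha^2$.
\<close>

lemma hartogs_local_majorant:
  fixes z :: "(complex, 'n::{finite,linorder}) vec"
  assumes a: "a \<in> hardy_l2" and z: "z \<in> hartogs"
  obtains \<rho> M where "\<rho> > 0" "ball z \<rho> \<subseteq> hartogs" "M summable_on hardy_index"
    "\<And>\<alpha> w. \<alpha> \<in> hardy_index \<Longrightarrow> w \<in> ball z \<rho> \<Longrightarrow> cmod (a \<alpha> * monomial \<alpha> w) \<le> M \<alpha>"
proof -
  let ?A = "(\<lambda>(i, j). (cmod (z $ i), cmod (z $ j))) ` {(i, j). i < j} \<union> (\<lambda>j. (cmod (z $ j), 1)) ` UNIV"
  have "\<exists>R. 0 < R \<and> R < 1 \<and> (\<forall>(a, b)\<in>?A. a < R * b)"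
    by (rule exists_contraction) (use z in \<open>auto simp: hartogs_iff\<close>)
  then obtain R where R: "0 < R" "R < 1" and RA: "\<forall>(a, b)\<in>?A. a < R * b" by blast
  have Rz: "cmod (z $ i) < R * cmod (z $ j)" if "i < j" for i j using RA that by auto
  have Rz1: "cmod (z $ j) < R" for j
  proof -
    have "(cmod (z $ j), 1) \<in> ?A" by (intro UnI2 imageI) simp
    from bspec[OF RA this] show ?thesis by simp
  qed
  define \<delta> where "\<delta> = Min (insert 1 ((\<lambda>j. cmod (z $ j) / 2) ` {j. \<exists>i. i < j}))"
  have \<delta>pos: "\<delta> > 0" unfolding \<delta>_def using hartogs_pos[OF z] by (subst Min_gr_iff) auto
  have \<delta>1: "\<delta> \<le> 1" by (simp add: \<delta>_def)
  have \<delta>z: "\<delta> < cmod (z $ j)" if "i < j" for i j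
  proof -
    have "\<delta> \<le> cmod (z $ j) / 2" unfolding \<delta>_def using that by (intro Min_le) auto
    then show ?thesis using hartogs_pos[OF z that] by linarith
  qed
  \<comment> \<open>The inequalities needed for the uniform bound hold on an open set.\<close>
  define U where "U = (hartogs :: (complex, 'n) vec set) \<inter>
     (\<Inter>i. \<Inter>j\<in>{j. i < j}. {w. cmod (w $ i) < R * cmod (w $ j)} \<inter> {w. \<delta> < cmod (w $ j)}) \<inter> (\<Inter>j. {w. cmod (w $ j) < R})"
  have "open U"
    unfolding U_def
    by (intro open_Int open_INT open_hartogs finite open_Collect_less continuous_intros ballI)
  moreover have "z \<in> U" using z Rz Rz1 \<delta>z by (auto simp: U_def)
  ultimately obtain \<rho> where \<rho>: "\<rho> > 0" "ball z \<rho> \<subseteq> U" using open_contains_ball by blast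
  define K where "K = (\<Prod>j\<in>(UNIV::'n set). 1 / \<delta> ^ (index_pos j - 1))"
  define q where "q \<alpha> = K * (\<Prod>j\<in>UNIV. R ^ nat (shifted_partial_sum \<alpha> j))" for \<alpha> :: "(int, 'n) vec"
  have K: "K \<ge> 0" unfolding K_def using \<delta>pos by (intro prod_nonneg) auto
  have q: "q \<alpha> \<ge> 0" for \<alpha> unfolding q_def using K R by (intro mult_nonneg_nonneg prod_nonneg) auto
  have q_sum: "(\<lambda>\<alpha>. (q \<alpha>)\<^sup>2) summable_on hardy_index"
  proof -
    have "(q \<alpha>)\<^sup>2 = K\<^sup>2 * (\<Prod>j\<in>UNIV. (R\<^sup>2) ^ nat (shifted_partial_sum \<alpha> j))" for \<alpha>
      by (simp add: q_def power_mult_distrib prod_power_distrib power_mult[symmetric] mult.commute)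
    moreover have "R\<^sup>2 < 1" using R by (simp add: power_less_one_iff)
    ultimately show ?thesis
      using summable_prod_power_shifted_partial_sum[of "R\<^sup>2"]
      by (simp only:) (intro summable_on_cmult_right, simp)
  qed
  show thesis
  proof (rule that[of \<rho> "\<lambda>\<alpha>. (cmod (a \<alpha>))\<^sup>2 + (q \<alpha>)\<^sup>2"])
    show "\<rho> > 0" by fact
    show "ball z \<rho> \<subseteq> hartogs" using \<rho>(2) by (auto simp: U_def)
    show "(\<lambda>\<alpha>. (cmod (a \<alpha>))\<^sup>2 + (q \<alpha>)\<^sup>2) summable_on hardy_index"
      using a q_sum by (intro summable_on_add) (auto simp: hardy_l2_def)
    fix \<alpha> :: "(int, 'n) vec" and w assume \<alpha>: "\<alpha> \<in> hardy_index" and "w \<in> ball z \<rho>"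
    then have w: "w \<in> U" using \<rho>(2) by auto
    have "cmod (monomial \<alpha> w) \<le> q \<alpha>"
      unfolding q_def K_def
      by (rule norm_monomial_le) (use w \<alpha> \<delta>pos \<delta>1 R in \<open>auto simp: U_def intro: less_imp_le\<close>)
    then have "cmod (a \<alpha> * monomial \<alpha> w) \<le> cmod (a \<alpha>) * q \<alpha>"
      by (simp add: norm_mult mult_left_mono)
    also have "\<dots> \<le> (cmod (a \<alpha>))\<^sup>2 + (q \<alpha>)\<^sup>2"
      using sum_squares_bound[of "cmod (a \<alpha>)" "q \<alpha>"] mult_nonneg_nonneg[OF norm_ge_zero[of "a \<alpha>"] q[of \<alpha>]] by linarith
    finally show "cmod (a \<alpha> * monomial \<alpha> w) \<le> (cmod (a \<alpha>))\<^sup>2 + (q \<alpha>)\<^sup>2" .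
  qed
qed

definition hardy_series :: "((int, 'n) vec \<Rightarrow> complex) \<Rightarrow> 'n::{finite,linorder} cfun" where
  "hardy_series a z = (if z \<in> hartogs then \<Sum>\<^sub>\<infinity>\<alpha>\<in>hardy_index. a \<alpha> * monomial \<alpha> z else 0)"

lemma hardy_series_abs_summable:
  assumes "a \<in> hardy_l2" "z \<in> hartogs"
  shows "(\<lambda>\<alpha>. cmod (a \<alpha> * monomial \<alpha> z)) summable_on hardy_index"
proof -
  obtain \<rho> M where M: "\<rho> > 0" "M summable_on hardy_index"
    "\<And>\<alpha> w. \<alpha> \<in> hardy_index \<Longrightarrow> w \<in> ball z \<rho> \<Longrightarrow> cmod (a \<alpha> * monomial \<alpha> w) \<le> M \<alpha>"
    using hartogs_local_majorant[OF assms] by metis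
  show ?thesis
    by (rule Infinite_Sum.abs_summable_on_comparison_test'[OF M(2)]) (rule M(3), use M(1) in auto)
qed

lemma hardy_series_has_sum:
  assumes "a \<in> hardy_l2" "z \<in> hartogs"
  shows "((\<lambda>\<alpha>. a \<alpha> * monomial \<alpha> z) has_sum hardy_series a z) hardy_index"
  using has_sum_infsum[OF abs_summable_summable[OF hardy_series_abs_summable[OF assms]]] assms(2)
  by (simp add: hardy_series_def)

text \<open>
  Only the smallest coordinate may vanish on the Hartogs triangle, so this makes all monomials in
  question holomorphic there.
\<close>

lemma hardy_index_minimal_nonneg:
  assumes "\<alpha> \<in> hardy_index" "\<And>j. k \<le> j"
  shows "\<alpha> $ k \<ge> 0"
proof -
  have "{..k} = {k}" using assms(2) by (auto intro: antisym)
  moreover have "index_pos k = 1" using assms(2) index_pos_1 by blast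
  moreover have "shifted_partial_sum \<alpha> k \<ge> 0" using assms(1) by (simp add: hardy_index_iff)
  ultimately show ?thesis by (simp add: shifted_partial_sum_def)
qed

lemma complex_differentiable_monomial_hartogs:
  assumes "\<alpha> \<in> hardy_index" "z \<in> hartogs"
  shows "complex_differentiable_at (monomial \<alpha>) z"
proof (rule complex_differentiable_at_monomial)
  fix j
  show "z $ j \<noteq> 0 \<or> 0 \<le> \<alpha> $ j"
  proof (cases "\<forall>i. j \<le> i")
    case True
    then show ?thesis using hardy_index_minimal_nonneg[OF assms(1), of j] by simp
  next
    case False
    then obtain i where "i < j" by (auto simp: not_le)
    then show ?thesis using hartogs_pos[OF assms(2), of i j] by auto
  qed
qed

lemma hardy_series_holomorphic:
  assumes a: "a \<in> hardy_l2"
  shows "holomorphic_several (hardy_series a) hartogs"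
  unfolding holomorphic_several_iff
proof
  fix z :: "(complex, 'a) vec" assume z: "z \<in> hartogs"
  obtain \<rho> M where M: "\<rho> > 0" "ball z \<rho> \<subseteq> hartogs" "M summable_on hardy_index"
    "\<And>\<alpha> w. \<alpha> \<in> hardy_index \<Longrightarrow> w \<in> ball z \<rho> \<Longrightarrow> cmod (a \<alpha> * monomial \<alpha> w) \<le> M \<alpha>"
    using hartogs_local_majorant[OF a z] by metis
  have "complex_differentiable_at (\<lambda>z. \<Sum>\<^sub>\<infinity>\<alpha>\<in>hardy_index. a \<alpha> * monomial \<alpha> z) z"
    by (rule complex_differentiable_at_infsum[OF M(1) _ M(4) M(3)])
       (use M(2) in \<open>auto intro!: complex_differentiable_at_mult complex_differentiable_at_const complex_differentiable_monomial_hartogs\<close>)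
  then show "complex_differentiable_at (hardy_series a) z"
    by (rule complex_differentiable_at_transform[OF _ open_hartogs z]) (simp add: hardy_series_def)
qed

lemma holomorphic_hartogs_measurable:
  assumes f: "holomorphic_several f hartogs" and 0: "\<And>z. z \<notin> hartogs \<Longrightarrow> f z = 0"
  shows "f \<in> borel_measurable borel"
proof -
  have "continuous_on hartogs f"
    using f unfolding holomorphic_several_iff
    by (auto intro!: continuous_at_imp_continuous_on complex_differentiable_at_imp_continuous)
  then have "(\<lambda>z. indicator hartogs z *\<^sub>R f z) \<in> borel_measurable borel"
    by (intro borel_measurable_continuous_on_indicator) (simp add: open_hartogs)
  moreover have "(\<lambda>z. indicator hartogs z *\<^sub>R f z) = f"
    using 0 by (auto simp: indicator_def)
  ultimately show ?thesis by simp
qed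

lemma hardy_series_measurable [measurable]: "a \<in> hardy_l2 \<Longrightarrow> hardy_series a \<in> borel_measurable borel"
  by (rule holomorphic_hartogs_measurable[OF hardy_series_holomorphic]) (auto simp: hardy_series_def)

lemma hardy_series_torus:
  assumes a: "a \<in> hardy_l2" and r: "r \<in> unit_radii"
  defines "g \<equiv> (\<lambda>\<zeta>. hardy_series a (vec_mult (suffix_point r) \<zeta>))"
  shows "g \<in> torus_L2" "norm_expansion hardy_index (\<lambda>\<alpha>. a \<alpha> * monomial \<alpha> (suffix_point r)) g"
proof -
  have sp: "suffix_point r \<in> hartogs"
  proof -
    have "(\<chi> j. 1) \<in> torus" by (simp add: torus_def)
    moreover have "vec_mult (suffix_point r) (\<chi> j. 1) = suffix_point r" by (simp add: vec_eq_iff)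
    ultimately show ?thesis using suffix_point_torus_hartogs[OF r] by metis
  qed
  have m: "g \<in> borel_measurable borel"
    unfolding g_def using hardy_series_measurable[OF a] by measurable
  have s: "(\<lambda>\<alpha>. cmod (a \<alpha> * monomial \<alpha> (suffix_point r))) summable_on hardy_index"
    by (rule hardy_series_abs_summable[OF a sp])
  have eq: "g \<zeta> = (\<Sum>\<^sub>\<infinity>\<alpha>\<in>hardy_index. a \<alpha> * monomial \<alpha> (suffix_point r) * monomial \<alpha> \<zeta>)" if "\<zeta> \<in> torus" for \<zeta>
    using suffix_point_torus_hartogs[OF r that]
    by (simp add: g_def hardy_series_def monomial_vec_mult mult.assoc)
  show "g \<in> torus_L2" "norm_expansion hardy_index (\<lambda>\<alpha>. a \<alpha> * monomial \<alpha> (suffix_point r)) g"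
    using norm_expansion_uniform[OF m s eq] by auto
qed

text \<open>
  The contribution of a coefficient of modulus 1 at \<open>\<alpha>\<close> to the weighted integral over the torus of
  radial coordinates \<open>r\<close>.
\<close>

definition radial_factor :: "(int, 'n) vec \<Rightarrow> (real, 'n::{finite,linorder}) vec \<Rightarrow> real" where
  "radial_factor \<alpha> r = (\<Prod>j\<in>UNIV. (r $ j) powi (2 * shifted_partial_sum \<alpha> j + 1))"

lemma radial_factor_bounds:
  assumes "r \<in> unit_radii" "\<alpha> \<in> hardy_index"
  shows "0 \<le> radial_factor \<alpha> r" "radial_factor \<alpha> r \<le> 1"
proof -
  have r: "0 < r $ j" "r $ j < 1" for j using assms(1) by (auto simp: unit_radii_def)
  have b: "shifted_partial_sum \<alpha> j \<ge> 0" for j using assms(2) by (simp add: hardy_index_iff)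
  have "0 \<le> (r $ j) powi (2 * shifted_partial_sum \<alpha> j + 1)" for j
    using r[of j] by (intro zero_le_power_int) simp
  moreover have "(r $ j) powi (2 * shifted_partial_sum \<alpha> j + 1) \<le> 1" for j
    using r[of j] b[of j] by (simp add: power_int_def power_le_one)
  ultimately show "0 \<le> radial_factor \<alpha> r" "radial_factor \<alpha> r \<le> 1"
    unfolding radial_factor_def by (auto intro: prod_nonneg prod_le_1)
qed

lemma radial_factor_tendsto:
  fixes \<alpha> :: "(int, 'n::{finite,linorder}) vec"
  shows "((\<lambda>t. radial_factor \<alpha> (\<chi> j. t)) \<longlongrightarrow> 1) (at_left 1)"
proof -
  have "((\<lambda>t::real. \<Prod>j\<in>(UNIV::'n set). t powi (2 * shifted_partial_sum \<alpha> j + 1)) \<longlongrightarrow>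
      (\<Prod>j\<in>(UNIV::'n set). 1 powi (2 * shifted_partial_sum \<alpha> j + 1))) (at_left 1)"
    by (intro tendsto_intros) auto
  then show ?thesis by (simp add: radial_factor_def)
qed

lemma constant_radii: "eventually (\<lambda>t. (\<chi> j. t) \<in> unit_radii) (at_left (1::real))"
  unfolding unit_radii_def
  using eventually_at_left_real[of 0 1] by (auto elim!: eventually_mono)

text \<open>
  All radial coordinates tend to 1 at the same time.
\<close>

lemma finite_sum_le_of_radial:
  fixes a :: "(int, 'n::{finite,linorder}) vec \<Rightarrow> complex"
  assumes le: "\<And>r. r \<in> unit_radii \<Longrightarrow> (\<Sum>\<alpha>\<in>F. (cmod (a \<alpha>))\<^sup>2 * radial_factor \<alpha> r) \<le> N"
  shows "(\<Sum>\<alpha>\<in>F. (cmod (a \<alpha>))\<^sup>2) \<le> N"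
proof (rule tendsto_upperbound)
  have "((\<lambda>t. \<Sum>\<alpha>\<in>F. (cmod (a \<alpha>))\<^sup>2 * radial_factor \<alpha> (\<chi> j. t)) \<longlongrightarrow> (\<Sum>\<alpha>\<in>F. (cmod (a \<alpha>))\<^sup>2 * 1)) (at_left 1)"
    by (intro tendsto_intros radial_factor_tendsto)
  then show "((\<lambda>t. \<Sum>\<alpha>\<in>F. (cmod (a \<alpha>))\<^sup>2 * radial_factor \<alpha> (\<chi> j. t)) \<longlongrightarrow> (\<Sum>\<alpha>\<in>F. (cmod (a \<alpha>))\<^sup>2)) (at_left 1)"
    by simp
  show "\<forall>\<^sub>F t in at_left 1. (\<Sum>\<alpha>\<in>F. (cmod (a \<alpha>))\<^sup>2 * radial_factor \<alpha> (\<chi> j. t)) \<le> N"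
    using constant_radii by eventually_elim (rule le)
qed simp

text \<open>
  Parseval on each torus turns the weighted integral into a sum of $|a_\alpha|^2$ times factors in
  $[0,1]$; these factors tend to 1 as the radial coordinates do.
\<close>

lemma hardy_norm_sq_series:
  fixes a :: "(int, 'n::{finite,linorder}) vec \<Rightarrow> complex"
  assumes a: "a \<in> hardy_l2"
  shows "hardy_norm_sq (hardy_series a) = ennreal (\<Sum>\<^sub>\<infinity>\<alpha>\<in>hardy_index. (cmod (a \<alpha>))\<^sup>2)"
proof -
  let ?S = "\<Sum>\<^sub>\<infinity>\<alpha>\<in>hardy_index. (cmod (a \<alpha>))\<^sup>2"
  have as: "(\<lambda>\<alpha>. (cmod (a \<alpha>))\<^sup>2) summable_on hardy_index" using a by (simp add: hardy_l2_def)
  define G where "G r = ennreal (radial_weight r) *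
     (\<integral>\<^sup>+\<zeta>. ennreal ((cmod (hardy_series a (vec_mult (suffix_point r) \<zeta>)))\<^sup>2) \<partial>torus_measure)" for r
  have val: "((\<lambda>\<alpha>. (cmod (a \<alpha>))\<^sup>2 * radial_factor \<alpha> r) has_sum S) hardy_index \<longrightarrow> G r = ennreal S"
    and summ: "(\<lambda>\<alpha>. (cmod (a \<alpha>))\<^sup>2 * radial_factor \<alpha> r) summable_on hardy_index"
    if r: "r \<in> unit_radii" for r S
  proof -
    let ?g = "\<lambda>\<zeta>. hardy_series a (vec_mult (suffix_point r) \<zeta>)"
    have "((\<lambda>\<alpha>. (cmod (a \<alpha> * monomial \<alpha> (suffix_point r)))\<^sup>2) has_sum (torus_norm ?g)\<^sup>2) hardy_index"
      by (rule norm_expansion_parseval[OF hardy_series_torus[OF a r]])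
    then have "((\<lambda>\<alpha>. radial_weight r * (cmod (a \<alpha> * monomial \<alpha> (suffix_point r)))\<^sup>2) has_sum radial_weight r * (torus_norm ?g)\<^sup>2) hardy_index"
      by (rule has_sum_cmult_right)
    moreover have "radial_weight r * (cmod (a \<alpha> * monomial \<alpha> (suffix_point r)))\<^sup>2 = (cmod (a \<alpha>))\<^sup>2 * radial_factor \<alpha> r" for \<alpha>
      using weighted_monomial_suffix_point[OF r, of \<alpha>]
      by (simp add: norm_mult power_mult_distrib radial_factor_def)
    ultimately have hs: "((\<lambda>\<alpha>. (cmod (a \<alpha>))\<^sup>2 * radial_factor \<alpha> r) has_sum radial_weight r * (torus_norm ?g)\<^sup>2) hardy_index"
      by simp
    then show "(\<lambda>\<alpha>. (cmod (a \<alpha>))\<^sup>2 * radial_factor \<alpha> r) summable_on hardy_index"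
      by (rule has_sum_imp_summable)
    have "G r = ennreal (radial_weight r * (torus_norm ?g)\<^sup>2)"
      unfolding G_def torus_norm_square_nn[OF hardy_series_torus(1)[OF a r], symmetric]
      using radial_weight_pos[OF r] by (simp add: ennreal_mult')
    then show "((\<lambda>\<alpha>. (cmod (a \<alpha>))\<^sup>2 * radial_factor \<alpha> r) has_sum S) hardy_index \<longrightarrow> G r = ennreal S"
      using has_sum_unique[OF hs] by auto
  qed
  have norm: "hardy_norm_sq (hardy_series a) = (SUP r\<in>unit_radii. G r)"
    unfolding G_def by (rule hardy_norm_sq_torus[OF hardy_series_measurable[OF a]])
  have G: "G r = ennreal (\<Sum>\<^sub>\<infinity>\<alpha>\<in>hardy_index. (cmod (a \<alpha>))\<^sup>2 * radial_factor \<alpha> r)" if r: "r \<in> unit_radii" for r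
    using val[OF r] has_sum_infsum[OF summ[OF r]] by blast
  have S0: "?S \<ge> 0" by (rule infsum_nonneg) simp
  have upper: "G r \<le> ennreal ?S" if r: "r \<in> unit_radii" for r
    unfolding G[OF r]
  proof (intro ennreal_leI infsum_mono summ[OF r] as)
    show "(cmod (a \<alpha>))\<^sup>2 * radial_factor \<alpha> r \<le> (cmod (a \<alpha>))\<^sup>2" if "\<alpha> \<in> hardy_index" for \<alpha>
      using radial_factor_bounds[OF r that] by (simp add: mult_left_le)
  qed
  have fin: "hardy_norm_sq (hardy_series a) \<le> ennreal ?S"
    unfolding norm by (rule SUP_least) (rule upper)
  define N where "N = enn2real (hardy_norm_sq (hardy_series a))"
  have N: "hardy_norm_sq (hardy_series a) = ennreal N"
    unfolding N_def using fin by (metis ennreal_enn2real ennreal_less_top leD top.not_eq_extremum)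
  have "?S \<le> N"
  proof (rule infsum_le_finite_sums[OF as])
    fix F :: "(int, 'n) vec set" assume F: "finite F" "F \<subseteq> hardy_index"
    show "(\<Sum>\<alpha>\<in>F. (cmod (a \<alpha>))\<^sup>2) \<le> N"
    proof (rule finite_sum_le_of_radial)
      fix r :: "(real, 'n) vec" assume r: "r \<in> unit_radii"
      have "(\<Sum>\<alpha>\<in>F. (cmod (a \<alpha>))\<^sup>2 * radial_factor \<alpha> r) \<le> (\<Sum>\<^sub>\<infinity>\<alpha>\<in>hardy_index. (cmod (a \<alpha>))\<^sup>2 * radial_factor \<alpha> r)"
        using radial_factor_bounds[OF r] by (intro finite_sum_le_infsum[OF summ[OF r] F]) auto
      also have "ennreal \<dots> \<le> ennreal N"
        unfolding G[OF r, symmetric] N[symmetric] norm by (rule SUP_upper[OF r])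
      then have "(\<Sum>\<^sub>\<infinity>\<alpha>\<in>hardy_index. (cmod (a \<alpha>))\<^sup>2 * radial_factor \<alpha> r) \<le> N"
        by (subst (asm) ennreal_le_iff) (auto simp: N_def)
      finally show "(\<Sum>\<alpha>\<in>F. (cmod (a \<alpha>))\<^sup>2 * radial_factor \<alpha> r) \<le> N" .
    qed
  qed
  then have "ennreal ?S \<le> hardy_norm_sq (hardy_series a)"
    unfolding N by (rule ennreal_leI)
  with fin show ?thesis by (rule antisym)
qed

lemma hardy_series_in_hardy_space: "a \<in> hardy_l2 \<Longrightarrow> hardy_series a \<in> hardy_space"
  by (simp add: hardy_space_def hardy_series_holomorphic hardy_norm_sq_series)
     (simp add: hardy_series_def)

section \<open>Laurent coefficients\<close>

text \<open>
  The logarithms of the moduli of the points of the Hartogs triangle without zero coordinates.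
  They form a convex set, so any two tori of such points are joined by a segment.
\<close>

definition log_cone :: "(real, 'n::{finite,linorder}) vec set" where
  "log_cone = {u. (\<forall>i j. i < j \<longrightarrow> u $ i < u $ j) \<and> (\<forall>j. u $ j < 0)}"

definition exp_point :: "(real, 'n::{finite,linorder}) vec \<Rightarrow> (complex, 'n) vec" where
  "exp_point u = (\<chi> k. of_real (exp (u $ k)))"

text \<open>
  The Laurent coefficient of $z^\alpha$, computed from the torus of logarithmic radii \<open>u\<close>.
\<close>

definition laurent_coeff :: "'n::{finite,linorder} cfun \<Rightarrow> (int, 'n) vec \<Rightarrow> (real, 'n) vec \<Rightarrow> complex" where
  "laurent_coeff f \<alpha> u =
     (\<integral>\<zeta>. f (vec_mult (exp_point u) \<zeta>) * monomial (- \<alpha>) (vec_mult (exp_point u) \<zeta>) \<partial>torus_measure)"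

lemma convex_log_cone: "convex log_cone"
proof (rule convexI)
  fix u v :: "(real, 'n::{finite,linorder}) vec" and a b :: real
  assume u: "u \<in> log_cone" and v: "v \<in> log_cone" and ab: "0 \<le> a" "0 \<le> b" "a + b = 1"
  have conv: "a * x + b * y < a * x' + b * y'" if "x < x'" "y < y'" for x y x' y' :: real
  proof (cases "a = 0")
    case True
    then show ?thesis using ab that by simp
  next
    case False
    then have "a * x < a * x'" "b * y \<le> b * y'" using ab that by (auto intro: mult_left_mono)
    then show ?thesis by linarith
  qed
  show "a *\<^sub>R u + b *\<^sub>R v \<in> log_cone"
    unfolding log_cone_def using u v conv conv[of _ 0 _ 0] by (simp add: log_cone_def)
qed

text \<open>
  Join \<open>u\<close> to \<open>v\<close> by a segment and let its parameter be complex. Shifting the parameter by $ie$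
  only rotates the torus, which does not affect the integral; and for a holomorphic function the
  combination (increment by $e$) $+\,i\,$(increment by $ie$) is of second order in $e$, uniformly on the
  torus. So the increment of the integral for a real shift is of second order, and its derivative
  along the segment vanishes. This takes the place of Cauchy's theorem in each variable.
\<close>

lemma laurent_coeff_constant:
  fixes f :: "'n::{finite,linorder} cfun"
  assumes hol: "holomorphic_several f hartogs" and [measurable]: "f \<in> borel_measurable borel"
    and u: "u \<in> log_cone" and v: "v \<in> log_cone"
  shows "laurent_coeff f \<alpha> u = laurent_coeff f \<alpha> v"
proof -
  define G where "G z = f z * monomial (- \<alpha>) z" for z
  have [measurable]: "G \<in> borel_measurable borel" unfolding G_def by measurable
  define P :: "complex \<Rightarrow> (complex, 'n) vec"
    where "P w = (\<chi> k. exp (of_real (u $ k) + w * of_real (v $ k - u $ k)))" for w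
  define \<gamma> where "\<gamma> t = (1 - t) *\<^sub>R u + t *\<^sub>R v" for t :: real
  define S where "S = {w. \<gamma> (Re w) \<in> log_cone}"
  have \<gamma>nth: "\<gamma> t $ k = u $ k + t * (v $ k - u $ k)" for t k
    by (simp add: \<gamma>_def algebra_simps)
  have Pnorm: "cmod (P w $ k) = exp (\<gamma> (Re w) $ k)" for w k
    by (simp add: P_def \<gamma>nth)
  have Pnz: "P w $ k \<noteq> 0" for w k by (simp add: P_def)
  have Preal: "P (of_real t) = exp_point (\<gamma> t)" for t
    by (simp add: P_def exp_point_def vec_eq_iff \<gamma>nth exp_of_real[symmetric])
  have c1: "cmod (\<zeta> $ k) = 1" if "\<zeta> \<in> torus" for \<zeta> :: "(complex, 'n) vec" and k
    using that by (simp add: torus_def)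
  have in_hartogs: "vec_mult (P w) \<zeta> \<in> hartogs" if "w \<in> S" "\<zeta> \<in> torus" for w \<zeta>
    using that(1) unfolding hartogs_iff vec_mult_nth norm_mult c1[OF that(2)] Pnorm mult_1_right
    by (auto simp: S_def log_cone_def)
  have "open S"
  proof -
    have "S = (\<Inter>i. \<Inter>j\<in>{j. i < j}. {w. \<gamma> (Re w) $ i < \<gamma> (Re w) $ j}) \<inter> (\<Inter>j. {w. \<gamma> (Re w) $ j < 0})"
      by (auto simp: S_def log_cone_def)
    then show ?thesis
      unfolding \<gamma>nth
      by (simp only:) (intro open_Int open_INT finite open_Collect_less continuous_intros ballI)
  qed
  have Gdiff: "complex_differentiable_at G z" if "z \<in> hartogs" "\<And>k. z $ k \<noteq> 0" for z
    unfolding G_def[abs_def] using hol that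
    by (intro complex_differentiable_at_mult complex_differentiable_at_monomial)
       (auto simp: holomorphic_several_iff)
  have nz: "vec_mult (P w) \<zeta> $ k \<noteq> 0" if "\<zeta> \<in> torus" for w \<zeta> k
    using Pnz torus_nonzero[OF that] by simp
  have curve: "(\<lambda>w. G (vec_mult (P w) \<zeta>)) field_differentiable (at w)" if w: "w \<in> S" and \<zeta>: "\<zeta> \<in> torus" for w \<zeta>
  proof -
    obtain D where D: "(G has_derivative D) (at (vec_mult (P w) \<zeta>))" "\<forall>c v. D (c *s v) = c * D v"
      using Gdiff[OF in_hartogs[OF w \<zeta>] nz[OF \<zeta>]] unfolding complex_differentiable_at_def by blast
    have "((\<lambda>w. vec_mult (P w) \<zeta> $ k) has_field_derivative
        (\<chi> k. of_real (v $ k - u $ k) * exp (of_real (u $ k) + w * of_real (v $ k - u $ k)) * \<zeta> $ k) $ k) (at w)" for k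
      unfolding vec_mult_nth P_def vec_lambda_beta
      by (auto intro!: derivative_eq_intros)
    from complex_differentiable_compose_curve[OF D this] show ?thesis
      unfolding field_differentiable_def by (rule exI)
  qed
  have contP: "continuous_on UNIV (\<lambda>p. vec_mult (P (fst p)) (snd p))"
    unfolding vec_mult_def P_def
    by (intro continuous_on_vec_lambda continuous_intros)
  define K where "K t = (\<integral>\<zeta>. G (vec_mult (P (of_real t)) \<zeta>) \<partial>torus_measure)" for t :: real
  have "(K has_derivative (\<lambda>h. 0)) (at t within {0..1})" if t: "t \<in> {0..1}" for t
  proof -
    have "complex_of_real t \<in> S"
      using convexD[OF convex_log_cone u v, of "1 - t" t] t by (simp add: S_def \<gamma>_def)
    then obtain R where R: "R > 0" "cball (of_real t) R \<subseteq> S"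
      using \<open>open S\<close> open_contains_cball by blast
    have "compact ((\<lambda>p. vec_mult (P (fst p)) (snd p)) ` (cball (of_real t) R \<times> torus))"
      by (intro compact_continuous_image compact_Times compact_torus compact_cball continuous_on_subset[OF contP]) auto
    moreover have contG: "continuous_on ((\<lambda>p. vec_mult (P (fst p)) (snd p)) ` (cball (of_real t) R \<times> torus)) G"
    proof (intro continuous_at_imp_continuous_on ballI)
      fix z assume "z \<in> (\<lambda>p. vec_mult (P (fst p)) (snd p)) ` (cball (of_real t) R \<times> torus)"
      then obtain w \<zeta> where w: "z = vec_mult (P w) \<zeta>" "w \<in> S" "\<zeta> \<in> torus" using R(2) by auto
      show "isCont G z"
        unfolding w(1)
        by (rule complex_differentiable_at_imp_continuous[OF Gdiff[OF in_hartogs[OF w(2,3)] nz[OF w(3)]]])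
    qed
    ultimately have "bounded (G ` (\<lambda>p. vec_mult (P (fst p)) (snd p)) ` (cball (of_real t) R \<times> torus))"
      by (rule compact_imp_bounded[OF compact_continuous_image, rotated])
    then obtain M where M': "\<forall>x\<in>G ` (\<lambda>p. vec_mult (P (fst p)) (snd p)) ` (cball (of_real t) R \<times> torus). cmod x \<le> M"
      unfolding bounded_iff by blast
    have M: "cmod (G (vec_mult (P w) \<zeta>)) \<le> M" if "w \<in> cball (of_real t) R" "\<zeta> \<in> torus" for w \<zeta>
    proof -
      have "(w, \<zeta>) \<in> cball (of_real t) R \<times> torus" using that by simp
      from M'[rule_format, OF imageI[OF imageI[OF this]]] show ?thesis by simp
    qed
    have int: "integrable torus_measure (\<lambda>\<zeta>. G (vec_mult (P w) \<zeta>))" if "w \<in> cball (of_real t) R" for w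
      by (rule integrable_torus_bounded[of _ M]) (measurable, rule M[OF that])
    have est: "cmod (K (t + e) - K t) \<le> 16 * M / R\<^sup>2 * e\<^sup>2" if e: "\<bar>e\<bar> \<le> R / 4" for e
    proof -
      let ?F = "\<lambda>w \<zeta>. G (vec_mult (P w) \<zeta>)"
      let ?t = "complex_of_real t" and ?e = "complex_of_real e"
      have in1: "?t + ?e \<in> cball ?t R" "?t + \<i> * ?e \<in> cball ?t R" "?t \<in> cball ?t R"
        using e R(1) by (auto simp: dist_norm norm_mult)
      \<comment> \<open>An imaginary shift of the parameter is a rotation of the torus.\<close>
      have rot: "(\<integral>\<zeta>. ?F (?t + \<i> * ?e) \<zeta> \<partial>torus_measure) = K t"
      proof -
        define c where "c = (\<chi> k. cis (e * (v $ k - u $ k)))"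
        have c: "c \<in> torus" by (simp add: c_def torus_def)
        have "P (?t + \<i> * ?e) = vec_mult c (P ?t)"
          by (simp add: vec_eq_iff P_def c_def cis_conv_exp exp_add[symmetric] algebra_simps)
        then have "vec_mult (P (?t + \<i> * ?e)) \<zeta> = vec_mult (P ?t) (vec_mult c \<zeta>)" for \<zeta>
          by (simp add: vec_eq_iff ac_simps)
        moreover have "(\<integral>\<zeta>. ?F ?t (vec_mult c \<zeta>) \<partial>torus_measure) = (\<integral>\<zeta>. ?F ?t \<zeta> \<partial>torus_measure)"
        proof (rule torus_rotation_invariant[OF _ _ c])
          show "continuous_on torus (?F ?t)"
          proof (rule continuous_on_compose2[of "(\<lambda>p. vec_mult (P (fst p)) (snd p)) ` (cball (of_real t) R \<times> torus)" G])
            show "continuous_on torus (vec_mult (P ?t))"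
              unfolding vec_mult_def by (intro continuous_on_vec_lambda continuous_intros)
            show "vec_mult (P ?t) ` torus \<subseteq> (\<lambda>p. vec_mult (P (fst p)) (snd p)) ` (cball (of_real t) R \<times> torus)"
            proof (rule image_subsetI)
              fix \<zeta> :: "(complex, 'n) vec" assume "\<zeta> \<in> torus"
              then have "(?t, \<zeta>) \<in> cball (of_real t) R \<times> torus" using R(1) by simp
              from imageI[OF this, of "\<lambda>p. vec_mult (P (fst p)) (snd p)"]
              show "vec_mult (P ?t) \<zeta> \<in> (\<lambda>p. vec_mult (P (fst p)) (snd p)) ` (cball (of_real t) R \<times> torus)"
                by simp
            qed
          qed (rule contG)
          show "?F ?t \<in> borel_measurable borel" by measurable
        qed
        ultimately show ?thesis by (simp add: K_def)
      qed
      have "cmod (K (t + e) - K t) = cmod (\<integral>\<zeta>. (?F (?t + ?e) \<zeta> - ?F ?t \<zeta>) + \<i> * (?F (?t + \<i> * ?e) \<zeta> - ?F ?t \<zeta>) \<partial>torus_measure)"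
      proof -
        have "(\<integral>\<zeta>. (?F (?t + ?e) \<zeta> - ?F ?t \<zeta>) + \<i> * (?F (?t + \<i> * ?e) \<zeta> - ?F ?t \<zeta>) \<partial>torus_measure)
          = (\<integral>\<zeta>. ?F (?t + ?e) \<zeta> \<partial>torus_measure) - (\<integral>\<zeta>. ?F ?t \<zeta> \<partial>torus_measure)
             + \<i> * ((\<integral>\<zeta>. ?F (?t + \<i> * ?e) \<zeta> \<partial>torus_measure) - (\<integral>\<zeta>. ?F ?t \<zeta> \<partial>torus_measure))"
          using int[OF in1(1)] int[OF in1(2)] int[OF in1(3)] by simp
        then show ?thesis unfolding rot by (simp add: K_def)
      qed
      also have "\<dots> \<le> (\<integral>\<zeta>. cmod ((?F (?t + ?e) \<zeta> - ?F ?t \<zeta>) + \<i> * (?F (?t + \<i> * ?e) \<zeta> - ?F ?t \<zeta>)) \<partial>torus_measure)"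
        by (rule integral_norm_bound)
      also have "\<dots> \<le> (\<integral>\<zeta>. 16 * M / R\<^sup>2 * e\<^sup>2 \<partial>(torus_measure :: (complex, 'n) vec measure))"
      proof (rule integral_mono_AE)
        show "integrable torus_measure (\<lambda>\<zeta>. cmod ((?F (?t + ?e) \<zeta> - ?F ?t \<zeta>) + \<i> * (?F (?t + \<i> * ?e) \<zeta> - ?F ?t \<zeta>)))"
          by (intro integrable_norm Bochner_Integration.integrable_add Bochner_Integration.integrable_diff
                integrable_mult_right int in1)
        show "integrable torus_measure (\<lambda>\<zeta>. 16 * M / R\<^sup>2 * e\<^sup>2)" by simp
        show "AE \<zeta> in torus_measure. cmod ((?F (?t + ?e) \<zeta> - ?F ?t \<zeta>) + \<i> * (?F (?t + \<i> * ?e) \<zeta> - ?F ?t \<zeta>)) \<le> 16 * M / R\<^sup>2 * e\<^sup>2"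
          using AE_torus
        proof eventually_elim
          case (elim \<zeta>)
          have cancel: "(x - z) + \<i> * (y - z) = (x - z - d * e) + \<i> * (y - z - d * (\<i> * e))" for x y z d e
          proof -
            have "\<i> * (d * (\<i> * e)) = (\<i> * \<i>) * (d * e)" by (simp only: ac_simps)
            then have "\<i> * (d * (\<i> * e)) = - (d * e)" by (simp only: i_squared mult_minus_left mult_1)
            then show ?thesis unfolding right_diff_distrib by simp
          qed
          let ?g = "\<lambda>w. ?F w \<zeta>"
          have bs: "ball ?t R \<subseteq> S" by (rule order_trans[OF ball_subset_cball R(2)])
          have hol: "?g holomorphic_on ball ?t R"
            unfolding holomorphic_on_def
          proof
            fix w assume "w \<in> ball ?t R"
            then have "w \<in> S" by (rule subsetD[OF bs])
            from curve[OF this elim] show "?g field_differentiable at w within ball ?t R"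
              by (rule field_differentiable_at_within)
          qed
          have bd: "cmod (?g w) \<le> M" if "w \<in> ball ?t R" for w
            by (rule M[OF subsetD[OF ball_subset_cball that] elim])
          have 1: "cmod (?g (?t + ?e) - ?g ?t - deriv ?g ?t * ?e) \<le> 8 * M / R\<^sup>2 * e\<^sup>2"
          proof -
            have "cmod ?e \<le> R / 4" using e by (simp only: norm_of_real)
            from second_order_remainder(1)[OF hol bd R(1) this] show ?thesis
              by (simp only: norm_of_real power2_abs)
          qed
          have 2: "cmod (?g (?t + \<i> * ?e) - ?g ?t - deriv ?g ?t * (\<i> * ?e)) \<le> 8 * M / R\<^sup>2 * e\<^sup>2"
          proof -
            have ne: "cmod (\<i> * ?e) = \<bar>e\<bar>" by (simp add: norm_mult)
            have "cmod (\<i> * ?e) \<le> R / 4" unfolding ne by (rule e)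
            from second_order_remainder(1)[OF hol bd R(1) this] show ?thesis
              by (simp only: ne power2_abs)
          qed
          \<comment> \<open>The first-order terms cancel, because the derivative is complex linear.\<close>
          have "(?g (?t + ?e) - ?g ?t) + \<i> * (?g (?t + \<i> * ?e) - ?g ?t)
             = (?g (?t + ?e) - ?g ?t - deriv ?g ?t * ?e) + \<i> * (?g (?t + \<i> * ?e) - ?g ?t - deriv ?g ?t * (\<i> * ?e))"
            by (rule cancel)
          also have "cmod \<dots> \<le> 8 * M / R\<^sup>2 * e\<^sup>2 + 8 * M / R\<^sup>2 * e\<^sup>2"
            by (intro norm_triangle_mono 1) (simp only: norm_mult norm_ii mult_1 2)
          finally show ?case by (simp only: mult_2[symmetric])
        qed
      qed
      finally show ?thesis by (simp add: measure_torus_UNIV)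
    qed
    show ?thesis
    proof (rule has_derivativeI_sandwich[where e = "R / 4" and H = "\<lambda>y. 16 * M / R\<^sup>2 * \<bar>y - t\<bar>"])
      show "((\<lambda>y. 16 * M / R\<^sup>2 * \<bar>y - t\<bar>) \<longlongrightarrow> 0) (at t within {0..1})"
        by (intro tendsto_eq_intros | simp)+
      fix y assume y: "y \<noteq> t" "dist y t < R / 4"
      have "cmod (K (t + (y - t)) - K t) \<le> 16 * M / R\<^sup>2 * (y - t)\<^sup>2"
        by (rule est) (use y in \<open>simp add: dist_real_def\<close>)
      also have "\<dots> = 16 * M / R\<^sup>2 * \<bar>y - t\<bar> * \<bar>y - t\<bar>"
        by (simp add: power2_eq_square)
      finally show "norm (K y - K t - 0) / norm (y - t) \<le> 16 * M / R\<^sup>2 * \<bar>y - t\<bar>"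
        using y by (simp add: divide_le_eq)
    qed (use R in auto)
  qed
  then obtain c where "\<forall>t\<in>{0..1}. K t = c"
    using has_derivative_zero_constant[of "{0..1::real}" K] by auto
  then have "K 0 = K 1" by simp
  moreover have "K 0 = laurent_coeff f \<alpha> u" "K 1 = laurent_coeff f \<alpha> v"
    using Preal[of 0] Preal[of 1] by (simp_all add: K_def laurent_coeff_def G_def \<gamma>_def)
  ultimately show ?thesis by simp
qed

section \<open>Functions of the Hardy space as power series\<close>

lemma log_cone_of_radii:
  assumes r: "r \<in> unit_radii"
  defines "u \<equiv> (\<chi> k. ln (\<Prod>j\<in>{k..}. r $ j))"
  shows "u \<in> log_cone" "exp_point u = suffix_point r"
proof -
  show "u \<in> log_cone"
    unfolding log_cone_def u_def
    using suffix_prod_less[OF r] suffix_prod_bounds[OF r] by simp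
  show "exp_point u = suffix_point r"
    using suffix_prod_bounds(1)[OF r] by (simp add: exp_point_def suffix_point_def u_def del: of_real_prod)
qed

lemma hardy_space_measurable: "f \<in> hardy_space \<Longrightarrow> f \<in> borel_measurable borel"
  by (rule holomorphic_hartogs_measurable) (auto simp: hardy_space_def)

lemma holomorphic_torus_continuous:
  assumes hol: "holomorphic_several f hartogs" and r: "r \<in> unit_radii"
  shows "continuous_on torus (\<lambda>\<zeta>. f (vec_mult (suffix_point r) \<zeta>))"
proof (rule continuous_on_compose2[of hartogs f torus "vec_mult (suffix_point r)"])
  show "continuous_on hartogs f"
    using hol unfolding holomorphic_several_iff
    by (auto intro!: continuous_at_imp_continuous_on complex_differentiable_at_imp_continuous)
  show "continuous_on torus (vec_mult (suffix_point r))"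
    unfolding vec_mult_def by (intro continuous_on_vec_lambda continuous_intros)
  show "vec_mult (suffix_point r) ` torus \<subseteq> hartogs"
    using suffix_point_torus_hartogs[OF r] by auto
qed

text \<open>
  Laurent and Fourier coefficients differ by the constant by which $z^\alpha$ and $\zeta^\alpha$
  differ on a torus.
\<close>

lemma fourier_torus_radii:
  assumes r: "r \<in> unit_radii" and [measurable]: "f \<in> borel_measurable borel"
  shows "fourier (\<lambda>\<zeta>. f (vec_mult (suffix_point r) \<zeta>)) \<alpha>
     = laurent_coeff f \<alpha> (\<chi> k. ln (\<Prod>j\<in>{k..}. r $ j)) * monomial \<alpha> (suffix_point r)"
proof -
  let ?m = "monomial \<alpha> (suffix_point r)" and ?n = "monomial (- \<alpha>) (suffix_point r)"
  have nz: "suffix_point r $ k \<noteq> 0" for k by (rule suffix_point_nonzero[OF r])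
  have mn: "?n * ?m = 1"
    using monomial_add[of "suffix_point r" "- \<alpha>" \<alpha>] nz by (simp add: monomial_def)
  have "fourier (\<lambda>\<zeta>. f (vec_mult (suffix_point r) \<zeta>)) \<alpha>
     = (\<integral>\<zeta>. f (vec_mult (suffix_point r) \<zeta>) * monomial (- \<alpha>) (vec_mult (suffix_point r) \<zeta>) * ?m \<partial>torus_measure)"
    unfolding fourier_def torus_inner_def
  proof (rule integral_cong_AE)
    show "AE \<zeta> in torus_measure. f (vec_mult (suffix_point r) \<zeta>) * cnj (monomial \<alpha> \<zeta>)
       = f (vec_mult (suffix_point r) \<zeta>) * monomial (- \<alpha>) (vec_mult (suffix_point r) \<zeta>) * ?m"
      using AE_torus
    proof eventually_elim
      case (elim \<zeta>)
      have "monomial (- \<alpha>) (vec_mult (suffix_point r) \<zeta>) * ?m = (?n * ?m) * monomial (- \<alpha>) \<zeta>"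
        unfolding monomial_vec_mult by (simp only: ac_simps)
      then show ?case
        unfolding cnj_monomial_torus[OF elim] mn by (simp only: mult.assoc mult_1)
    qed
  qed measurable
  also have "\<dots> = laurent_coeff f \<alpha> (\<chi> k. ln (\<Prod>j\<in>{k..}. r $ j)) * ?m"
    unfolding laurent_coeff_def log_cone_of_radii(2)[OF r] by (rule integral_mult_left_zero)
  finally show ?thesis .
qed

lemma modulus_ratio_less_1: "z \<in> hartogs \<Longrightarrow> modulus_ratio z j < 1"
  using next_modulus_cases[of z j] next_modulus_pos[of z j]
  by (auto simp: modulus_ratio_def divide_less_eq hartogs_iff)

text \<open>
  The radial coordinates are the ratios of consecutive moduli.
\<close>

lemma hartogs_polar:
  fixes z :: "(complex, 'n::{finite,linorder}) vec"
  assumes z: "z \<in> hartogs" and nz: "\<And>j. z $ j \<noteq> 0"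
  obtains r \<zeta> where "r \<in> unit_radii" "\<zeta> \<in> torus" "z = vec_mult (suffix_point r) \<zeta>"
proof (rule that)
  show "(\<chi> j. modulus_ratio z j) \<in> unit_radii"
    unfolding unit_radii_def
  proof (intro CollectI allI)
    fix j
    have "0 < cmod (z $ j)" using nz by simp
    also have "\<dots> \<le> modulus_ratio z j" by (rule modulus_ratio_ge[OF z])
    finally show "0 < (\<chi> j. modulus_ratio z j) $ j \<and> (\<chi> j. modulus_ratio z j) $ j < 1"
      using modulus_ratio_less_1[OF z, of j] by simp
  qed
  show "(\<chi> j. sgn (z $ j)) \<in> torus"
    using nz by (simp add: torus_def norm_sgn)
  show "z = vec_mult (suffix_point (\<chi> j. modulus_ratio z j)) (\<chi> j. sgn (z $ j))"
    by (simp add: vec_eq_iff suffix_point_nth modulus_eq_prod_ratio[OF z, symmetric] sgn_div_norm scaleR_conv_of_real nz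
        del: of_real_prod)
qed

text \<open>
  A point of the Hartogs triangle has at most one zero coordinate, and the triangle being open, this
  coordinate can be replaced by small positive numbers.
\<close>

lemma hartogs_zero_by_continuity:
  fixes D :: "'n::{finite,linorder} cfun"
  assumes D: "\<And>z. z \<in> hartogs \<Longrightarrow> isCont D z"
    and 0: "\<And>z. z \<in> hartogs \<Longrightarrow> (\<And>j. z $ j \<noteq> 0) \<Longrightarrow> D z = 0"
    and z: "z \<in> hartogs"
  shows "D z = 0"
proof (cases "\<exists>m. z $ m = 0")
  case False
  then show ?thesis using 0 z by blast
next
  case True
  then obtain m where m: "z $ m = 0" by blast
  have other: "z $ j \<noteq> 0" if "j \<noteq> m" for j
  proof (cases "j < m")
    case True
    then have "cmod (z $ j) < cmod (z $ m)" using z by (simp add: hartogs_iff)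
    then show ?thesis using m norm_ge_zero[of "z $ j"] by simp
  next
    case False
    then have "m < j" using that by simp
    then show ?thesis using hartogs_pos[OF z] by fastforce
  qed
  define \<phi> where "\<phi> t = (\<chi> j. if j = m then complex_of_real t else z $ j)" for t :: real
  have \<phi>0: "\<phi> 0 = z" using m by (simp add: \<phi>_def vec_eq_iff)
  have cont: "continuous_on UNIV \<phi>"
    unfolding \<phi>_def
  proof (rule continuous_on_vec_lambda)
    show "continuous_on UNIV (\<lambda>t. if j = m then complex_of_real t else z $ j)" for j
      by (cases "j = m") (auto intro!: continuous_intros)
  qed
  have lim: "(\<phi> \<longlongrightarrow> z) (at_right 0)"
    using cont \<phi>0 by (metis UNIV_I continuous_on_def tendsto_within_subset subset_UNIV)
  have "((\<lambda>t. D (\<phi> t)) \<longlongrightarrow> D z) (at_right 0)"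
    by (rule isCont_tendsto_compose[OF D[OF z] lim])
  moreover have "((\<lambda>t. D (\<phi> t)) \<longlongrightarrow> 0) (at_right 0)"
  proof (rule tendsto_eventually)
    have "\<forall>\<^sub>F t in at_right 0. \<phi> t \<in> hartogs"
      by (rule topological_tendstoD[OF lim open_hartogs z])
    moreover have "\<forall>\<^sub>F t in at_right (0::real). 0 < t"
      by (rule eventually_at_right_less)
    ultimately show "\<forall>\<^sub>F t in at_right 0. D (\<phi> t) = 0"
    proof eventually_elim
      case (elim t)
      have "\<phi> t $ j \<noteq> 0" for j using elim(2) other by (simp add: \<phi>_def)
      then show ?case using 0 elim(1) by blast
    qed
  qed
  ultimately show ?thesis
    by (rule tendsto_unique[OF trivial_limit_at_right_real])
qed

text \<open>
  Bessel's inequality on each torus bounds the sum of $|a_\alpha|^2\prod_j r_j^{2b_j+1}$ by the Hardy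
  norm. If some $b_k<0$, letting $r_k\to0$ forces $a_\alpha=0$; letting all $r_j\to1$ shows square
  summability. The difference between $f$ and its series has vanishing Fourier coefficients on every
  torus, hence vanishes on all tori and, by continuity, everywhere.
\<close>

theorem hardy_space_series:
  fixes f :: "'n::{finite,linorder} cfun"
  assumes f: "f \<in> hardy_space"
  shows "\<exists>a\<in>hardy_l2. f = hardy_series a \<and> (\<forall>\<alpha>. \<alpha> \<notin> hardy_index \<longrightarrow> a \<alpha> = 0)"
proof -
  have hol: "holomorphic_several f hartogs" and out: "\<And>z. z \<notin> hartogs \<Longrightarrow> f z = 0"
    and fin: "hardy_norm_sq f < \<infinity>" using f by (auto simp: hardy_space_def)
  have fm [measurable]: "f \<in> borel_measurable borel" by (rule hardy_space_measurable[OF f])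
  define lr where "lr r = (\<chi> k. ln (\<Prod>j\<in>{k..}. r $ j))" for r :: "(real, 'n) vec"
  have lr: "lr r \<in> log_cone" if "r \<in> unit_radii" for r
    unfolding lr_def by (rule log_cone_of_radii(1)[OF that])
  define a where "a \<alpha> = laurent_coeff f \<alpha> (lr (\<chi> j. 1/2))" for \<alpha>
  have half: "(\<chi> j. 1/2) \<in> (unit_radii :: (real, 'n) vec set)" by (simp add: unit_radii_def)
  let ?g = "\<lambda>r \<zeta>. f (vec_mult (suffix_point r) \<zeta>)"
  have fa: "fourier (?g r) \<alpha> = a \<alpha> * monomial \<alpha> (suffix_point r)" if r: "r \<in> unit_radii" for r \<alpha>
  proof -
    have "laurent_coeff f \<alpha> (lr r) = a \<alpha>"
      unfolding a_def by (rule laurent_coeff_constant[OF hol fm lr[OF r] lr[OF half]])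
    then show ?thesis using fourier_torus_radii[OF r fm, of \<alpha>] by (simp only: lr_def)
  qed
  have gc: "continuous_on torus (?g r)" if r: "r \<in> unit_radii" for r
    by (rule holomorphic_torus_continuous[OF hol r])
  have gm: "?g r \<in> borel_measurable borel" for r by measurable
  have gL2: "?g r \<in> torus_L2" if r: "r \<in> unit_radii" for r
  proof -
    obtain B where "\<And>\<zeta>. \<zeta> \<in> torus \<Longrightarrow> cmod (?g r \<zeta>) \<le> B"
      using continuous_on_torus_bounded[OF gc[OF r]] by blast
    then show ?thesis by (rule bounded_torus_L2[OF gm])
  qed
  define N where "N = enn2real (hardy_norm_sq f)"
  have N: "hardy_norm_sq f = ennreal N" "N \<ge> 0"
    using fin by (simp_all add: N_def)
  have bessel: "(\<Sum>\<alpha>\<in>F. (cmod (a \<alpha>))\<^sup>2 * radial_factor \<alpha> r) \<le> N" if r: "r \<in> unit_radii" and F: "finite F" for r F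
  proof -
    have "(\<Sum>\<alpha>\<in>F. (cmod (a \<alpha>))\<^sup>2 * radial_factor \<alpha> r) = radial_weight r * (\<Sum>\<alpha>\<in>F. (cmod (fourier (?g r) \<alpha>))\<^sup>2)"
      unfolding sum_distrib_left
    proof (rule sum.cong)
      show "(cmod (a \<alpha>))\<^sup>2 * radial_factor \<alpha> r = radial_weight r * (cmod (fourier (?g r) \<alpha>))\<^sup>2" for \<alpha>
        unfolding fa[OF r] radial_factor_def weighted_monomial_suffix_point[OF r, symmetric] norm_mult power_mult_distrib
        by (simp only: ac_simps)
    qed simp
    also have "\<dots> \<le> radial_weight r * (torus_norm (?g r))\<^sup>2"
      using radial_weight_pos[OF r] by (intro mult_left_mono bessel_inequality gL2 r F) simp
    also have "\<dots> \<le> N"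
    proof -
      have "ennreal (radial_weight r * (torus_norm (?g r))\<^sup>2)
         = ennreal (radial_weight r) * (\<integral>\<^sup>+\<zeta>. ennreal ((cmod (?g r \<zeta>))\<^sup>2) \<partial>torus_measure)"
        unfolding torus_norm_square_nn[OF gL2[OF r], symmetric]
        using radial_weight_pos[OF r] by (simp add: ennreal_mult')
      also have "\<dots> \<le> hardy_norm_sq f"
        unfolding hardy_norm_sq_torus[OF fm] by (rule SUP_upper[OF r])
      finally show ?thesis unfolding N(1) using N(2) by (simp add: ennreal_le_iff)
    qed
    finally show ?thesis .
  qed
  have off: "a \<alpha> = 0" if \<alpha>: "\<alpha> \<notin> hardy_index" for \<alpha>
  proof -
    obtain k where k: "shifted_partial_sum \<alpha> k < 0"
      using \<alpha> by (auto simp: hardy_index_iff not_le)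
    define e where "e j = 2 * shifted_partial_sum \<alpha> j + 1" for j
    define C where "C = (\<Prod>j\<in>UNIV - {k}. (1/2::real) powi e j)"
    have C: "C > 0" unfolding C_def by (intro prod_pos) simp
    \<comment> \<open>Radial coordinate \<open>t\<close> at \<open>k\<close>, where the exponent is at most $-1$, and 1/2 elsewhere.\<close>
    have le: "(cmod (a \<alpha>))\<^sup>2 * C \<le> N * t" if t: "0 < t" "t < 1" for t
    proof -
      define r where "r = (\<chi> j. if j = k then t else 1/2)"
      have r: "r \<in> unit_radii" using t by (simp add: unit_radii_def r_def)
      have "radial_factor \<alpha> r = (r $ k) powi e k * (\<Prod>j\<in>UNIV - {k}. (r $ j) powi e j)"
        unfolding radial_factor_def e_def by (rule prod.remove) auto
      also have "(\<Prod>j\<in>UNIV - {k}. (r $ j) powi e j) = C"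
        unfolding C_def by (rule prod.cong) (auto simp: r_def)
      finally have rf: "radial_factor \<alpha> r = t powi e k * C" by (simp add: r_def)
      have ek: "e k \<le> -1" using k by (simp add: e_def)
      have "1 / t \<le> t powi e k"
      proof -
        have "inverse t ^ 1 \<le> inverse t ^ nat (- e k)"
          using t ek by (intro power_increasing) (auto simp: one_le_inverse_iff)
        then show ?thesis using ek by (simp add: power_int_def inverse_eq_divide)
      qed
      then have "(1 / t) * C \<le> radial_factor \<alpha> r"
        unfolding rf using C by (intro mult_right_mono) auto
      then have "(cmod (a \<alpha>))\<^sup>2 * ((1 / t) * C) \<le> (cmod (a \<alpha>))\<^sup>2 * radial_factor \<alpha> r"
        by (rule mult_left_mono) simp
      also have "\<dots> \<le> N" using bessel[OF r, of "{\<alpha>}"] by simp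
      finally show ?thesis using t by (simp add: field_simps)
    qed
    have "(cmod (a \<alpha>))\<^sup>2 * C \<le> 0"
    proof (rule tendsto_lowerbound)
      show "((\<lambda>t. N * t) \<longlongrightarrow> 0) (at_right 0)"
        by (intro tendsto_eq_intros | simp)+
      show "\<forall>\<^sub>F t in at_right 0. (cmod (a \<alpha>))\<^sup>2 * C \<le> N * t"
        using eventually_at_right_real[of 0 1] by (auto elim!: eventually_mono intro: le)
    qed simp
    then show ?thesis using C by (simp add: mult_le_0_iff)
  qed
  have a: "a \<in> hardy_l2"
    unfolding hardy_l2_def
  proof (rule CollectI, rule nonneg_bdd_above_summable_on)
    show "bdd_above (sum (\<lambda>\<alpha>. (cmod (a \<alpha>))\<^sup>2) ` {F. F \<subseteq> hardy_index \<and> finite F})"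
    proof (rule bdd_aboveI2)
      fix F :: "(int, 'n) vec set" assume "F \<in> {F. F \<subseteq> hardy_index \<and> finite F}"
      then show "(\<Sum>\<alpha>\<in>F. (cmod (a \<alpha>))\<^sup>2) \<le> N"
        by (intro finite_sum_le_of_radial bessel) auto
    qed
  qed simp
  have hs_hol: "holomorphic_several (hardy_series a) hartogs" by (rule hardy_series_holomorphic[OF a])
  have on_tori: "f (vec_mult (suffix_point r) \<zeta>) - hardy_series a (vec_mult (suffix_point r) \<zeta>) = 0"
    if r: "r \<in> unit_radii" and \<zeta>: "\<zeta> \<in> torus" for r \<zeta>
  proof -
    let ?h = "\<lambda>\<zeta>. hardy_series a (vec_mult (suffix_point r) \<zeta>)"
    have hL2: "?h \<in> torus_L2" by (rule hardy_series_torus(1)[OF a r])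
    have "fourier (\<lambda>\<zeta>. ?g r \<zeta> - ?h \<zeta>) \<alpha> = 0" for \<alpha>
      unfolding fourier_diff[OF gL2[OF r] hL2] fa[OF r] norm_expansion_fourier[OF hardy_series_torus[OF a r]]
      using off by simp
    then have ae: "AE \<zeta> in torus_measure. ?g r \<zeta> - ?h \<zeta> = 0"
      by (intro AE_eq_0_if_fourier_eq_0 torus_L2_diff gL2[OF r] hL2)
    show ?thesis
    proof (rule continuous_torus_AE_zero[OF _ _ ae \<zeta>])
      show "continuous_on torus (\<lambda>\<zeta>. ?g r \<zeta> - ?h \<zeta>)"
        by (intro continuous_on_diff gc[OF r] holomorphic_torus_continuous[OF hs_hol r])
      show "(\<lambda>\<zeta>. ?g r \<zeta> - ?h \<zeta>) \<in> borel_measurable borel"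
        by (rule torus_L2_measurable[OF torus_L2_diff[OF gL2[OF r] hL2]])
    qed
  qed
  have "f z - hardy_series a z = 0" if "z \<in> hartogs" for z
  proof (rule hartogs_zero_by_continuity[OF _ _ that])
    show "isCont (\<lambda>z. f z - hardy_series a z) w" if "w \<in> hartogs" for w
      using hol hs_hol that unfolding holomorphic_several_iff
      by (intro continuous_diff complex_differentiable_at_imp_continuous) auto
    show "f w - hardy_series a w = 0" if w: "w \<in> hartogs" "\<And>j. w $ j \<noteq> 0" for w
      using hartogs_polar[OF w] on_tori by metis
  qed
  then have "f = hardy_series a"
    using out by (auto simp: fun_eq_iff hardy_series_def)
  then show ?thesis using a off by blast
qed

section \<open>The Hardy space and its boundary values in coefficients\<close>

lemma hardy_l2_bound:
  assumes "a \<in> hardy_l2" "\<And>\<alpha>. \<alpha> \<in> hardy_index \<Longrightarrow> cmod (b \<alpha>) \<le> C * cmod (a \<alpha>)"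
  shows "b \<in> hardy_l2"
  unfolding hardy_l2_def
proof (rule CollectI, rule summable_on_norm_bound)
  show "(\<lambda>\<alpha>. C\<^sup>2 * (cmod (a \<alpha>))\<^sup>2) summable_on hardy_index"
    using assms(1) by (intro summable_on_cmult_right) (simp add: hardy_l2_def)
  show "norm ((cmod (b \<alpha>))\<^sup>2) \<le> C\<^sup>2 * (cmod (a \<alpha>))\<^sup>2" if "\<alpha> \<in> hardy_index" for \<alpha>
  proof -
    have "(cmod (b \<alpha>))\<^sup>2 \<le> (C * cmod (a \<alpha>))\<^sup>2" by (intro power_mono assms(2) that) simp
    then show ?thesis by (simp add: power_mult_distrib)
  qed
qed

lemma hardy_l2_cmult: "a \<in> hardy_l2 \<Longrightarrow> (\<lambda>\<alpha>. c * a \<alpha>) \<in> hardy_l2"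
  by (erule hardy_l2_bound[where C = "cmod c"]) (simp only: norm_mult order_refl)

lemma hardy_l2_add:
  assumes a: "a \<in> hardy_l2" and b: "b \<in> hardy_l2" shows "(\<lambda>\<alpha>. a \<alpha> + b \<alpha>) \<in> hardy_l2"
  unfolding hardy_l2_def
proof (rule CollectI, rule summable_on_norm_bound)
  show "(\<lambda>\<alpha>. 2 * (cmod (a \<alpha>))\<^sup>2 + 2 * (cmod (b \<alpha>))\<^sup>2) summable_on hardy_index"
    using a b by (intro summable_on_add summable_on_cmult_right) (auto simp: hardy_l2_def)
  show "norm ((cmod (a \<alpha> + b \<alpha>))\<^sup>2) \<le> 2 * (cmod (a \<alpha>))\<^sup>2 + 2 * (cmod (b \<alpha>))\<^sup>2" for \<alpha>
  proof -
    have "(cmod (a \<alpha> + b \<alpha>))\<^sup>2 \<le> (cmod (a \<alpha>) + cmod (b \<alpha>))\<^sup>2"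
      by (intro power_mono norm_triangle_ineq) simp
    also have "\<dots> \<le> 2 * (cmod (a \<alpha>))\<^sup>2 + 2 * (cmod (b \<alpha>))\<^sup>2"
      using sum_squares_bound[of "cmod (a \<alpha>)" "cmod (b \<alpha>)"] by (simp add: power2_sum)
    finally show ?thesis by simp
  qed
qed

lemma hardy_l2_diff: "a \<in> hardy_l2 \<Longrightarrow> b \<in> hardy_l2 \<Longrightarrow> (\<lambda>\<alpha>. a \<alpha> - b \<alpha>) \<in> hardy_l2"
  using hardy_l2_add[OF _ hardy_l2_cmult[of b "-1"], of a] by simp

lemma hardy_l2_finite:
  assumes "finite F" "\<And>\<alpha>. \<alpha> \<notin> F \<Longrightarrow> a \<alpha> = 0" shows "a \<in> hardy_l2"
proof -
  have "(\<lambda>\<alpha>. (cmod (a \<alpha>))\<^sup>2) summable_on hardy_index \<inter> F"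
    using assms(1) by (intro summable_on_finite) simp
  then have "(\<lambda>\<alpha>. (cmod (a \<alpha>))\<^sup>2) summable_on hardy_index"
    by (rule summable_on_cong_neutral[THEN iffD1, rotated -1]) (use assms(2) in auto)
  then show ?thesis by (simp add: hardy_l2_def)
qed

lemma hardy_series_cmult: "a \<in> hardy_l2 \<Longrightarrow> hardy_series (\<lambda>\<alpha>. c * a \<alpha>) = (\<lambda>z. c * hardy_series a z)"
  by (rule ext) (simp add: hardy_series_def mult.assoc infsum_cmult_right')

lemma hardy_series_add:
  assumes a: "a \<in> hardy_l2" and b: "b \<in> hardy_l2"
  shows "hardy_series (\<lambda>\<alpha>. a \<alpha> + b \<alpha>) = (\<lambda>z. hardy_series a z + hardy_series b z)"
proof
  fix z
  show "hardy_series (\<lambda>\<alpha>. a \<alpha> + b \<alpha>) z = hardy_series a z + hardy_series b z"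
  proof (cases "z \<in> hartogs")
    case True
    have "((\<lambda>\<alpha>. (a \<alpha> + b \<alpha>) * monomial \<alpha> z) has_sum hardy_series a z + hardy_series b z) hardy_index"
      using has_sum_add[OF hardy_series_has_sum[OF a True] hardy_series_has_sum[OF b True]]
      by (simp add: distrib_right)
    then show ?thesis
      by (rule has_sum_unique[OF hardy_series_has_sum[OF hardy_l2_add[OF a b] True]])
  qed (simp add: hardy_series_def)
qed

lemma hardy_series_diff:
  assumes a: "a \<in> hardy_l2" and b: "b \<in> hardy_l2"
  shows "hardy_series (\<lambda>\<alpha>. a \<alpha> - b \<alpha>) = (\<lambda>z. hardy_series a z - hardy_series b z)"
  using hardy_series_add[OF a hardy_l2_cmult[OF b, of "-1"]] hardy_series_cmult[OF b, of "-1"]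
  by simp

lemma hardy_series_cong:
  "(\<And>\<alpha>. \<alpha> \<in> hardy_index \<Longrightarrow> a \<alpha> = b \<alpha>) \<Longrightarrow> hardy_series a = hardy_series b"
  by (rule ext) (simp add: hardy_series_def cong: infsum_cong)

lemma hardy_series_inject:
  assumes a: "a \<in> hardy_l2" and b: "b \<in> hardy_l2" and eq: "hardy_series a = hardy_series b"
    and \<alpha>: "\<alpha> \<in> hardy_index"
  shows "a \<alpha> = b \<alpha>"
proof -
  let ?c = "\<lambda>\<alpha>. a \<alpha> - b \<alpha>"
  have c: "?c \<in> hardy_l2" by (rule hardy_l2_diff[OF a b])
  have z: "(\<lambda>_. 0) \<in> hardy_l2" by (simp add: hardy_l2_def)
  have "hardy_series ?c = hardy_series (\<lambda>_. 0)"
    unfolding hardy_series_diff[OF a b] eq by (simp add: hardy_series_def fun_eq_iff)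
  then have "ennreal (\<Sum>\<^sub>\<infinity>\<alpha>\<in>hardy_index. (cmod (?c \<alpha>))\<^sup>2) = 0"
    using hardy_norm_sq_series[OF c] hardy_norm_sq_series[OF z] by (metis ennreal_0 infsum_0 norm_zero power_zero_numeral)
  then have le: "(\<Sum>\<^sub>\<infinity>\<alpha>\<in>hardy_index. (cmod (?c \<alpha>))\<^sup>2) \<le> 0"
    by (simp add: ennreal_eq_0_iff)
  have "(cmod (?c \<alpha>))\<^sup>2 = 0"
    by (rule nonneg_infsum_le_0D[OF le]) (use c \<alpha> in \<open>auto simp: hardy_l2_def\<close>)
  then show ?thesis by simp
qed

text \<open>
  The coefficients are normalized to be zero outside \<^const>\<open>hardy_index\<close>, where the values of a sequence in
  \<^const>\<open>hardy_l2\<close> are arbitrary.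
\<close>

definition hardy_coeff :: "'n::{finite,linorder} cfun \<Rightarrow> (int, 'n) vec \<Rightarrow> complex" where
  "hardy_coeff f = (SOME a. a \<in> hardy_l2 \<and> f = hardy_series a \<and> (\<forall>\<alpha>. \<alpha> \<notin> hardy_index \<longrightarrow> a \<alpha> = 0))"

lemma hardy_coeff:
  assumes "f \<in> hardy_space"
  shows "hardy_coeff f \<in> hardy_l2" "hardy_series (hardy_coeff f) = f"
    "\<And>\<alpha>. \<alpha> \<notin> hardy_index \<Longrightarrow> hardy_coeff f \<alpha> = 0"
proof -
  have "\<exists>a. a \<in> hardy_l2 \<and> f = hardy_series a \<and> (\<forall>\<alpha>. \<alpha> \<notin> hardy_index \<longrightarrow> a \<alpha> = 0)"
    using hardy_space_series[OF assms] by blast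
  from someI_ex[OF this, folded hardy_coeff_def]
  show "hardy_coeff f \<in> hardy_l2" "hardy_series (hardy_coeff f) = f"
    "\<And>\<alpha>. \<alpha> \<notin> hardy_index \<Longrightarrow> hardy_coeff f \<alpha> = 0" by auto
qed

lemma hardy_coeff_series:
  assumes "a \<in> hardy_l2"
  shows "hardy_coeff (hardy_series a) \<alpha> = (if \<alpha> \<in> hardy_index then a \<alpha> else 0)"
proof -
  note H = hardy_series_in_hardy_space[OF assms]
  show ?thesis
    using hardy_series_inject[OF hardy_coeff(1)[OF H] assms hardy_coeff(2)[OF H]] hardy_coeff(3)[OF H] by simp
qed

lemma hardy_space_eqI:
  assumes "f \<in> hardy_space" "g \<in> hardy_space" "\<And>\<alpha>. \<alpha> \<in> hardy_index \<Longrightarrow> hardy_coeff f \<alpha> = hardy_coeff g \<alpha>"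
  shows "f = g"
  using hardy_series_cong[of "hardy_coeff f" "hardy_coeff g"] assms(3)
  by (simp add: hardy_coeff(2)[OF assms(1)] hardy_coeff(2)[OF assms(2)])

lemma hardy_space_add:
  assumes "f \<in> hardy_space" "g \<in> hardy_space"
  shows "(\<lambda>z. f z + g z) \<in> hardy_space" "hardy_coeff (\<lambda>z. f z + g z) \<alpha> = hardy_coeff f \<alpha> + hardy_coeff g \<alpha>"
proof -
  note f = hardy_coeff[OF assms(1)] and g = hardy_coeff[OF assms(2)]
  have eq: "(\<lambda>z. f z + g z) = hardy_series (\<lambda>\<alpha>. hardy_coeff f \<alpha> + hardy_coeff g \<alpha>)"
    unfolding hardy_series_add[OF f(1) g(1)] f(2) g(2) ..
  show "(\<lambda>z. f z + g z) \<in> hardy_space"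
    unfolding eq by (intro hardy_series_in_hardy_space hardy_l2_add f g)
  show "hardy_coeff (\<lambda>z. f z + g z) \<alpha> = hardy_coeff f \<alpha> + hardy_coeff g \<alpha>"
    unfolding eq hardy_coeff_series[OF hardy_l2_add[OF f(1) g(1)]] using f(3) g(3) by simp
qed

lemma hardy_space_cmult:
  assumes "f \<in> hardy_space"
  shows "(\<lambda>z. c * f z) \<in> hardy_space" "hardy_coeff (\<lambda>z. c * f z) \<alpha> = c * hardy_coeff f \<alpha>"
proof -
  note f = hardy_coeff[OF assms(1)]
  have eq: "(\<lambda>z. c * f z) = hardy_series (\<lambda>\<alpha>. c * hardy_coeff f \<alpha>)"
    unfolding hardy_series_cmult[OF f(1)] f(2) ..
  show "(\<lambda>z. c * f z) \<in> hardy_space"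
    unfolding eq by (intro hardy_series_in_hardy_space hardy_l2_cmult f)
  show "hardy_coeff (\<lambda>z. c * f z) \<alpha> = c * hardy_coeff f \<alpha>"
    unfolding eq hardy_coeff_series[OF hardy_l2_cmult[OF f(1)]] using f(3) by simp
qed

lemma hardy_norm_square:
  assumes "f \<in> hardy_space"
  shows "((\<lambda>\<alpha>. (cmod (hardy_coeff f \<alpha>))\<^sup>2) has_sum (hardy_norm f)\<^sup>2) hardy_index"
proof -
  note f = hardy_coeff[OF assms]
  have s: "(\<lambda>\<alpha>. (cmod (hardy_coeff f \<alpha>))\<^sup>2) summable_on hardy_index"
    using f(1) by (simp add: hardy_l2_def)
  have "hardy_norm_sq f = ennreal (\<Sum>\<^sub>\<infinity>\<alpha>\<in>hardy_index. (cmod (hardy_coeff f \<alpha>))\<^sup>2)"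
    using hardy_norm_sq_series[OF f(1)] by (simp only: f(2))
  moreover have "0 \<le> (\<Sum>\<^sub>\<infinity>\<alpha>\<in>hardy_index. (cmod (hardy_coeff f \<alpha>))\<^sup>2)" by (rule infsum_nonneg) simp
  ultimately have "(hardy_norm f)\<^sup>2 = (\<Sum>\<^sub>\<infinity>\<alpha>\<in>hardy_index. (cmod (hardy_coeff f \<alpha>))\<^sup>2)"
    by (simp add: hardy_norm_def)
  then show ?thesis using has_sum_infsum[OF s] by simp
qed

lemma hardy_norm_nonneg: "hardy_norm f \<ge> 0"
  by (simp add: hardy_norm_def)

lemma hardy_coeff_sum_le_norm:
  assumes "f \<in> hardy_space" "finite F"
  shows "(\<Sum>\<alpha>\<in>F. (cmod (hardy_coeff f \<alpha>))\<^sup>2) \<le> (hardy_norm f)\<^sup>2"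
proof -
  have "(\<Sum>\<alpha>\<in>F. (cmod (hardy_coeff f \<alpha>))\<^sup>2) = (\<Sum>\<alpha>\<in>F \<inter> hardy_index. (cmod (hardy_coeff f \<alpha>))\<^sup>2)"
    using assms(2) hardy_coeff(3)[OF assms(1)] by (intro sum.mono_neutral_right) auto
  also have "\<dots> \<le> (\<Sum>\<^sub>\<infinity>\<alpha>\<in>hardy_index. (cmod (hardy_coeff f \<alpha>))\<^sup>2)"
    using assms(2) by (intro finite_sum_le_infsum has_sum_imp_summable[OF hardy_norm_square[OF assms(1)]]) auto
  also have "\<dots> = (hardy_norm f)\<^sup>2" by (rule infsumI[OF hardy_norm_square[OF assms(1)]])
  finally show ?thesis .
qed

lemma hardy_coeff_le_norm: "f \<in> hardy_space \<Longrightarrow> cmod (hardy_coeff f \<alpha>) \<le> hardy_norm f"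
  using hardy_coeff_sum_le_norm[of f "{\<alpha>}"] by (simp add: power2_le_iff_abs_le hardy_norm_nonneg)

lemma polarization_pointwise:
  "(\<Sum>k<4. \<i> ^ k * of_real ((cmod (a + \<i> ^ k * b))\<^sup>2)) / 4 = a * cnj b"
proof -
  have "(\<Sum>k<4. \<i> ^ k * complex_of_real ((cmod (a + \<i> ^ k * b))\<^sup>2))
    = of_real ((cmod (a + b))\<^sup>2) + \<i> * of_real ((cmod (a + \<i> * b))\<^sup>2)
      - of_real ((cmod (a - b))\<^sup>2) - \<i> * of_real ((cmod (a - \<i> * b))\<^sup>2)"
    by (simp add: eval_nat_numeral del: of_real_power)
  also have "\<dots> = 4 * (a * cnj b)"
    by (simp only: complex_norm_square complex_cnj_add complex_cnj_diff complex_cnj_mult complex_cnj_i)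
       (simp add: algebra_simps complex_eq_iff)
  finally show ?thesis by simp
qed

lemma has_sum_sum_finite:
  fixes f :: "'k \<Rightarrow> 'i \<Rightarrow> 'b::topological_comm_monoid_add"
  assumes "finite B" "\<And>k. k \<in> B \<Longrightarrow> (f k has_sum s k) A"
  shows "((\<lambda>i. \<Sum>k\<in>B. f k i) has_sum (\<Sum>k\<in>B. s k)) A"
  using assms by (induction B rule: finite_induct) (auto intro!: has_sum_add)

text \<open>
  The polarization identity, applied in each coefficient.
\<close>

lemma hardy_inner_has_sum:
  assumes f: "f \<in> hardy_space" and g: "g \<in> hardy_space"
  shows "((\<lambda>\<alpha>. hardy_coeff f \<alpha> * cnj (hardy_coeff g \<alpha>)) has_sum hardy_inner f g) hardy_index"
proof -
  have "((\<lambda>\<alpha>. \<Sum>k<(4::nat). \<i> ^ k * of_real ((cmod (hardy_coeff f \<alpha> + \<i> ^ k * hardy_coeff g \<alpha>))\<^sup>2)) has_sum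
     (\<Sum>k<4. \<i> ^ k * of_real ((hardy_norm (\<lambda>z. f z + \<i> ^ k * g z))\<^sup>2))) hardy_index"
  proof (rule has_sum_sum_finite)
    fix k :: nat
    have ig: "(\<lambda>z. \<i> ^ k * g z) \<in> hardy_space" by (rule hardy_space_cmult(1)[OF g])
    have "((\<lambda>\<alpha>. (cmod (hardy_coeff f \<alpha> + \<i> ^ k * hardy_coeff g \<alpha>))\<^sup>2) has_sum (hardy_norm (\<lambda>z. f z + \<i> ^ k * g z))\<^sup>2) hardy_index"
      using hardy_norm_square[OF hardy_space_add(1)[OF f ig]]
      by (simp only: hardy_space_add(2)[OF f ig] hardy_space_cmult(2)[OF g])
    then show "((\<lambda>\<alpha>. \<i> ^ k * of_real ((cmod (hardy_coeff f \<alpha> + \<i> ^ k * hardy_coeff g \<alpha>))\<^sup>2)) has_sum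
       \<i> ^ k * of_real ((hardy_norm (\<lambda>z. f z + \<i> ^ k * g z))\<^sup>2)) hardy_index"
      by (intro has_sum_cmult_right has_sum_of_real)
  qed simp
  from has_sum_cmult_left[OF this, of "1/4"] show ?thesis
    unfolding hardy_inner_def times_divide_eq_right mult_1_right polarization_pointwise .
qed

lemma hardy_series_finite:
  assumes "finite F" "F \<subseteq> hardy_index"
  shows "hardy_series (\<lambda>\<alpha>. if \<alpha> \<in> F then a \<alpha> else 0) = (\<lambda>z. if z \<in> hartogs then \<Sum>\<alpha>\<in>F. a \<alpha> * monomial \<alpha> z else 0)"
proof
  fix z
  have "(\<Sum>\<^sub>\<infinity>\<alpha>\<in>hardy_index. (if \<alpha> \<in> F then a \<alpha> else 0) * monomial \<alpha> z) = (\<Sum>\<^sub>\<infinity>\<alpha>\<in>F. a \<alpha> * monomial \<alpha> z)"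
    by (rule infsum_cong_neutral) (use assms in auto)
  then show "hardy_series (\<lambda>\<alpha>. if \<alpha> \<in> F then a \<alpha> else 0) z = (if z \<in> hartogs then \<Sum>\<alpha>\<in>F. a \<alpha> * monomial \<alpha> z else 0)"
    using assms(1) by (simp add: hardy_series_def)
qed

lemma hardy_l2_truncate: "finite F \<Longrightarrow> (\<lambda>\<alpha>. if \<alpha> \<in> F then a \<alpha> else 0) \<in> hardy_l2"
  by (rule hardy_l2_finite[of F]) auto

lemma hardy_space_diff:
  assumes "f \<in> hardy_space" "g \<in> hardy_space"
  shows "(\<lambda>z. f z - g z) \<in> hardy_space" "hardy_coeff (\<lambda>z. f z - g z) \<alpha> = hardy_coeff f \<alpha> - hardy_coeff g \<alpha>"
  using hardy_space_add[OF assms(1) hardy_space_cmult(1)[OF assms(2), of "-1"]] hardy_space_cmult(2)[OF assms(2), of "-1"]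
  by simp_all

lemma hardy_expansion_unique:
  fixes f :: "'n::{finite,linorder} cfun"
  assumes f: "f \<in> hardy_space" and e: "hardy_expansion a f" and \<alpha>: "\<alpha> \<in> hardy_index"
  shows "a \<alpha> = hardy_coeff f \<alpha>"
proof -
  have "((\<lambda>F::(int, 'n) vec set. cmod (hardy_coeff f \<alpha> - a \<alpha>)) \<longlongrightarrow> 0) (finite_subsets_at_top hardy_index)"
  proof (rule tendsto_sandwich[OF _ _ tendsto_const])
    show "((\<lambda>F. hardy_norm (\<lambda>z. f z - (if z \<in> hartogs then \<Sum>\<alpha>\<in>F. a \<alpha> * monomial \<alpha> z else 0))) \<longlongrightarrow> 0) (finite_subsets_at_top hardy_index)"
      using e by (simp add: hardy_expansion_def)
    have "\<forall>\<^sub>F F in finite_subsets_at_top hardy_index. finite F \<and> {\<alpha>} \<subseteq> F \<and> F \<subseteq> hardy_index"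
      unfolding eventually_finite_subsets_at_top by (rule exI[of _ "{\<alpha>}"]) (use \<alpha> in auto)
    then show "\<forall>\<^sub>F F in finite_subsets_at_top hardy_index. cmod (hardy_coeff f \<alpha> - a \<alpha>)
      \<le> hardy_norm (\<lambda>z. f z - (if z \<in> hartogs then \<Sum>\<alpha>\<in>F. a \<alpha> * monomial \<alpha> z else 0))"
    proof eventually_elim
      case (elim F)
      let ?p = "hardy_series (\<lambda>\<alpha>. if \<alpha> \<in> F then a \<alpha> else 0)"
      have p: "?p \<in> hardy_space" using elim by (intro hardy_series_in_hardy_space hardy_l2_truncate) auto
      have "hardy_coeff ?p \<alpha> = a \<alpha>"
        using elim \<alpha> by (subst hardy_coeff_series[OF hardy_l2_truncate]) auto
      then show ?case
        using hardy_coeff_le_norm[OF hardy_space_diff(1)[OF f p], of \<alpha>] hardy_space_diff(2)[OF f p, of \<alpha>] elim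
        by (simp add: hardy_series_finite)
    qed
  qed auto
  then show ?thesis by (simp add: tendsto_const_iff)
qed

text \<open>
  The remainder is the series of the remaining coefficients, so its squared norm is a tail of a
  convergent sum.
\<close>

lemma hardy_expansion_coeff:
  fixes f :: "'n::{finite,linorder} cfun"
  assumes f: "f \<in> hardy_space" shows "hardy_expansion (hardy_coeff f) f"
proof -
  let ?a = "hardy_coeff f"
  let ?d = "\<lambda>F z. f z - (if z \<in> hartogs then \<Sum>\<alpha>\<in>F. ?a \<alpha> * monomial \<alpha> z else 0)"
  have "((\<lambda>F. (hardy_norm f)\<^sup>2 - (\<Sum>\<alpha>\<in>F. (cmod (?a \<alpha>))\<^sup>2)) \<longlongrightarrow> (hardy_norm f)\<^sup>2 - (hardy_norm f)\<^sup>2) (finite_subsets_at_top hardy_index)"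
    using hardy_norm_square[OF f] unfolding has_sum_def by (intro tendsto_diff tendsto_const)
  moreover have "\<forall>\<^sub>F F in finite_subsets_at_top hardy_index. (hardy_norm f)\<^sup>2 - (\<Sum>\<alpha>\<in>F. (cmod (?a \<alpha>))\<^sup>2) = (hardy_norm (?d F))\<^sup>2"
  proof (rule eventually_finite_subsets_at_top_weakI)
    fix F :: "(int, 'n) vec set" assume F: "finite F" "F \<subseteq> hardy_index"
    let ?p = "hardy_series (\<lambda>\<alpha>. if \<alpha> \<in> F then ?a \<alpha> else 0)"
    have p: "?p \<in> hardy_space" using F by (intro hardy_series_in_hardy_space hardy_l2_truncate) auto
    have d: "?d F = (\<lambda>z. f z - ?p z)" by (simp add: hardy_series_finite[OF F])
    have dH: "?d F \<in> hardy_space" unfolding d by (rule hardy_space_diff(1)[OF f p])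
    have c: "hardy_coeff (?d F) \<alpha> = (if \<alpha> \<in> F then 0 else ?a \<alpha>)" if "\<alpha> \<in> hardy_index" for \<alpha>
      unfolding d hardy_space_diff(2)[OF f p] hardy_coeff_series[OF hardy_l2_truncate[OF F(1)]] using that by simp
    have "((\<lambda>\<alpha>. (cmod (?a \<alpha>))\<^sup>2) has_sum ((hardy_norm f)\<^sup>2 - (\<Sum>\<alpha>\<in>F. (cmod (?a \<alpha>))\<^sup>2))) (hardy_index - F)"
      by (intro has_sum_Diff hardy_norm_square[OF f] has_sum_finite F)
    moreover have "((\<lambda>\<alpha>. (cmod (?a \<alpha>))\<^sup>2) has_sum (hardy_norm (?d F))\<^sup>2) (hardy_index - F)"
      using hardy_norm_square[OF dH]
      by (rule has_sum_cong_neutral[THEN iffD1, rotated -1]) (auto simp: c)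
    ultimately show "(hardy_norm f)\<^sup>2 - (\<Sum>\<alpha>\<in>F. (cmod (?a \<alpha>))\<^sup>2) = (hardy_norm (?d F))\<^sup>2"
      by (rule has_sum_unique)
  qed
  ultimately have "((\<lambda>F. (hardy_norm (?d F))\<^sup>2) \<longlongrightarrow> 0) (finite_subsets_at_top hardy_index)"
    by (simp add: filterlim_cong[OF refl refl])
  from tendsto_real_sqrt[OF this] show ?thesis
    unfolding hardy_expansion_def by (simp add: real_sqrt_abs hardy_norm_nonneg)
qed

lemma norm_expansion_cong:
  assumes "\<And>\<alpha>. \<alpha> \<in> J \<Longrightarrow> a \<alpha> = b \<alpha>" and "norm_expansion J a g"
  shows "norm_expansion J b g"
proof -
  have "\<forall>\<^sub>F F in finite_subsets_at_top J. torus_norm (\<lambda>\<zeta>. g \<zeta> - trigpoly F a \<zeta>) = torus_norm (\<lambda>\<zeta>. g \<zeta> - trigpoly F b \<zeta>)"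
  proof (rule eventually_finite_subsets_at_top_weakI)
    fix F assume "F \<subseteq> J"
    then have "trigpoly F a \<zeta> = trigpoly F b \<zeta>" for \<zeta>
      using assms(1) by (intro sum.cong) auto
    then show "torus_norm (\<lambda>\<zeta>. g \<zeta> - trigpoly F a \<zeta>) = torus_norm (\<lambda>\<zeta>. g \<zeta> - trigpoly F b \<zeta>)" by simp
  qed
  then show ?thesis
    using assms(2) unfolding norm_expansion_def by (simp add: filterlim_cong[OF refl refl])
qed

text \<open>
  The identification of the Hardy space with its boundary values is the identification of power series
  and Fourier series with the same coefficients.
\<close>

lemma boundary_related_iff:
  "boundary_related f g \<longleftrightarrow> f \<in> hardy_space \<and> g \<in> torus_L2 \<and> norm_expansion hardy_index (hardy_coeff f) g"
  unfolding boundary_related_def torus_expansion_iff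
  using hardy_expansion_unique hardy_expansion_coeff hardy_coeff(1) norm_expansion_cong by metis

lemma boundary_value:
  assumes f: "f \<in> hardy_space"
  shows "boundary_value f \<in> torus_L2" "norm_expansion hardy_index (hardy_coeff f) (boundary_value f)"
    "fourier (boundary_value f) \<alpha> = hardy_coeff f \<alpha>"
proof -
  have "\<exists>g. boundary_related f g"
    unfolding boundary_related_iff
    using riesz_fischer[of "hardy_coeff f" hardy_index] hardy_coeff(1)[OF f] f by (auto simp: hardy_l2_def)
  from someI_ex[OF this, folded boundary_value_def]
  show b: "boundary_value f \<in> torus_L2" "norm_expansion hardy_index (hardy_coeff f) (boundary_value f)"
    by (auto simp: boundary_related_iff)
  show "fourier (boundary_value f) \<alpha> = hardy_coeff f \<alpha>"
    using norm_expansion_fourier[OF b, of \<alpha>] hardy_coeff(3)[OF f] by simp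
qed

text \<open>
  A function is determined by its coefficients, so the description is definite.
\<close>

lemma from_boundary:
  assumes g: "g \<in> hardy_boundary_space"
  shows "from_boundary g \<in> hardy_space" "\<alpha> \<in> hardy_index \<Longrightarrow> hardy_coeff (from_boundary g) \<alpha> = fourier g \<alpha>"
proof -
  obtain a where gL: "g \<in> torus_L2" and a: "a \<in> hardy_l2" "norm_expansion hardy_index a g"
    using g by (auto simp: hardy_boundary_space_def torus_expansion_iff)
  have "boundary_related (hardy_series a) g"
    unfolding boundary_related_iff
    by (intro conjI hardy_series_in_hardy_space a gL norm_expansion_cong[OF _ a(2)])
       (simp add: hardy_coeff_series[OF a(1)])
  moreover have "f = hardy_series a" if br: "boundary_related f g" for f
  proof (rule hardy_space_eqI)
    show "f \<in> hardy_space" "hardy_series a \<in> hardy_space"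
      using br a(1) by (auto simp: boundary_related_iff hardy_series_in_hardy_space)
    show "hardy_coeff f \<alpha> = hardy_coeff (hardy_series a) \<alpha>" if \<alpha>: "\<alpha> \<in> hardy_index" for \<alpha>
      using norm_expansion_fourier[OF gL a(2), of \<alpha>]
        norm_expansion_fourier[OF gL, of hardy_index "hardy_coeff f" \<alpha>] br \<alpha>
      by (simp add: boundary_related_iff hardy_coeff_series[OF a(1)])
  qed
  ultimately have eq: "from_boundary g = hardy_series a"
    unfolding from_boundary_def by (rule the_equality)
  show "from_boundary g \<in> hardy_space"
    unfolding eq by (rule hardy_series_in_hardy_space[OF a(1)])
  show "hardy_coeff (from_boundary g) \<alpha> = fourier g \<alpha>" if "\<alpha> \<in> hardy_index"
    unfolding eq hardy_coeff_series[OF a(1)] norm_expansion_fourier[OF gL a(2)] using that by simp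
qed

lemma torus_cauchy_schwarz:
  assumes f: "f \<in> torus_L2" and g: "g \<in> torus_L2"
  shows "cmod (torus_inner f g) \<le> torus_norm f * torus_norm g"
proof (rule power2_le_imp_le)
  have [measurable]: "f \<in> borel_measurable borel" "g \<in> borel_measurable borel"
    using f g by (auto simp: torus_L2_iff)
  have "ennreal (cmod (torus_inner f g)) \<le> (\<integral>\<^sup>+\<zeta>. ennreal (norm (f \<zeta> * cnj (g \<zeta>))) \<partial>torus_measure)"
    unfolding torus_inner_def by (rule integral_norm_bound_ennreal[OF torus_L2_mult_integrable[OF f g]])
  also have "\<dots> = (\<integral>\<^sup>+\<zeta>. ennreal (cmod (f \<zeta>)) * ennreal (cmod (g \<zeta>)) \<partial>torus_measure)"
    by (simp add: norm_mult ennreal_mult')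
  finally have "(ennreal (cmod (torus_inner f g)))\<^sup>2 \<le> (\<integral>\<^sup>+\<zeta>. ennreal (cmod (f \<zeta>)) * ennreal (cmod (g \<zeta>)) \<partial>torus_measure)\<^sup>2"
    by (rule power_mono) simp
  also have "\<dots> \<le> (\<integral>\<^sup>+\<zeta>. (ennreal (cmod (f \<zeta>)))\<^sup>2 \<partial>torus_measure) * (\<integral>\<^sup>+\<zeta>. (ennreal (cmod (g \<zeta>)))\<^sup>2 \<partial>torus_measure)"
    by (rule Cauchy_Schwarz_nn_integral) measurable
  also have "\<dots> = ennreal ((torus_norm f)\<^sup>2) * ennreal ((torus_norm g)\<^sup>2)"
    by (simp add: torus_norm_square_nn[OF f] torus_norm_square_nn[OF g] ennreal_power)
  finally show "(cmod (torus_inner f g))\<^sup>2 \<le> (torus_norm f * torus_norm g)\<^sup>2"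
    by (simp add: ennreal_power power_mult_distrib flip: ennreal_mult')
  show "0 \<le> torus_norm f * torus_norm g" by (simp add: torus_norm_nonneg)
qed

lemma torus_inner_expansion_eq_0:
  assumes w: "w \<in> torus_L2" and u: "u \<in> torus_L2" and e: "norm_expansion J a u"
    and 0: "\<And>\<alpha>. \<alpha> \<in> J \<Longrightarrow> fourier w \<alpha> = 0"
  shows "torus_inner w u = 0"
proof -
  have "((\<lambda>_. cmod (torus_inner w u)) \<longlongrightarrow> 0) (finite_subsets_at_top J)"
  proof (rule tendsto_sandwich[OF _ _ tendsto_const])
    show "((\<lambda>F. torus_norm w * torus_norm (\<lambda>\<zeta>. u \<zeta> - trigpoly F a \<zeta>)) \<longlongrightarrow> 0) (finite_subsets_at_top J)"
      using e unfolding norm_expansion_def by (rule tendsto_mult_right_zero)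
    show "\<forall>\<^sub>F F in finite_subsets_at_top J. cmod (torus_inner w u) \<le> torus_norm w * torus_norm (\<lambda>\<zeta>. u \<zeta> - trigpoly F a \<zeta>)"
    proof (rule eventually_finite_subsets_at_top_weakI)
      fix F assume F: "finite F" "F \<subseteq> J"
      have "torus_inner w (\<lambda>\<zeta>. u \<zeta> - trigpoly F a \<zeta>) = torus_inner w u - torus_inner w (trigpoly F a)"
        unfolding torus_inner_def complex_cnj_diff right_diff_distrib
        by (rule Bochner_Integration.integral_diff[OF torus_L2_mult_integrable[OF w u] torus_L2_mult_integrable[OF w trigpoly_L2]])
      also have "torus_inner w (trigpoly F a) = 0"
        unfolding torus_inner_trigpoly[OF w] using 0 F(2) by (intro sum.neutral) auto
      finally show "cmod (torus_inner w u) \<le> torus_norm w * torus_norm (\<lambda>\<zeta>. u \<zeta> - trigpoly F a \<zeta>)"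
        using torus_cauchy_schwarz[OF w torus_L2_diff[OF u trigpoly_L2], of a F] by simp
    qed
  qed auto
  then show ?thesis by (simp add: tendsto_const_iff)
qed

lemma monomial_in_boundary_space:
  assumes "\<alpha> \<in> hardy_index" shows "monomial \<alpha> \<in> hardy_boundary_space"
proof -
  let ?a = "\<lambda>\<beta>. if \<beta> \<in> {\<alpha>} then 1 else (0::complex)"
  have "\<forall>\<^sub>F F in finite_subsets_at_top hardy_index. torus_norm (\<lambda>\<zeta>. monomial \<alpha> \<zeta> - trigpoly F ?a \<zeta>) = 0"
    unfolding eventually_finite_subsets_at_top
  proof (intro exI[of _ "{\<alpha>}"] conjI allI impI)
    fix F assume F: "finite F \<and> {\<alpha>} \<subseteq> F \<and> F \<subseteq> hardy_index"
    have "trigpoly F ?a \<zeta> = monomial \<alpha> \<zeta>" for \<zeta>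
      using F by (simp add: if_distrib[of "\<lambda>x. x * _"] cong: if_cong)
    then show "torus_norm (\<lambda>\<zeta>. monomial \<alpha> \<zeta> - trigpoly F ?a \<zeta>) = 0"
      by (simp add: torus_norm_def)
  qed (use assms in auto)
  then have "norm_expansion hardy_index ?a (monomial \<alpha>)"
    unfolding norm_expansion_def by (rule tendsto_eventually)
  moreover have "?a \<in> hardy_l2" by (rule hardy_l2_truncate) simp
  ultimately show ?thesis
    unfolding hardy_boundary_space_def torus_expansion_iff using monomial_L2 by blast
qed

text \<open>
  Discarding the Fourier coefficients outside \<^const>\<open>hardy_index\<close> gives a projection, by Bessel and
  Riesz--Fischer. Testing orthogonality on monomials shows that every choice of the projection
  has these coefficients.
\<close>

lemma hardy_projection:
  assumes h: "h \<in> torus_L2"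
  shows "hardy_projection h \<in> hardy_boundary_space"
    "\<alpha> \<in> hardy_index \<Longrightarrow> fourier (hardy_projection h) \<alpha> = fourier h \<alpha>"
proof -
  have fh: "fourier h \<in> hardy_l2"
    unfolding hardy_l2_def
  proof (rule CollectI, rule nonneg_bdd_above_summable_on)
    show "bdd_above (sum (\<lambda>\<alpha>. (cmod (fourier h \<alpha>))\<^sup>2) ` {F. F \<subseteq> hardy_index \<and> finite F})"
      by (rule bdd_aboveI2[of _ _ "(torus_norm h)\<^sup>2"]) (use bessel_inequality[OF h] in auto)
  qed simp
  then obtain g where g: "g \<in> torus_L2" "norm_expansion hardy_index (fourier h) g"
    using riesz_fischer[of "fourier h" hardy_index] by (auto simp: hardy_l2_def)
  have "g \<in> hardy_boundary_space"
    unfolding hardy_boundary_space_def torus_expansion_iff using g fh by blast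
  moreover have "torus_inner (\<lambda>\<zeta>. h \<zeta> - g \<zeta>) u = 0" if ub: "u \<in> hardy_boundary_space" for u
  proof -
    obtain a where u: "u \<in> torus_L2" "norm_expansion hardy_index a u"
      using ub by (auto simp: hardy_boundary_space_def torus_expansion_iff)
    show ?thesis
      by (rule torus_inner_expansion_eq_0[OF torus_L2_diff[OF h g(1)] u])
         (simp add: fourier_diff[OF h g(1)] norm_expansion_fourier[OF g])
  qed
  ultimately have "\<exists>g. g \<in> hardy_boundary_space \<and> (\<forall>u\<in>hardy_boundary_space. torus_inner (\<lambda>\<zeta>. h \<zeta> - g \<zeta>) u = 0)"
    by blast
  from someI_ex[OF this, folded hardy_projection_def]
  have P: "hardy_projection h \<in> hardy_boundary_space"
    and o: "\<And>u. u \<in> hardy_boundary_space \<Longrightarrow> torus_inner (\<lambda>\<zeta>. h \<zeta> - hardy_projection h \<zeta>) u = 0" by auto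
  show "hardy_projection h \<in> hardy_boundary_space" by (rule P)
  have PL: "hardy_projection h \<in> torus_L2" using P by (simp add: hardy_boundary_space_def)
  show "fourier (hardy_projection h) \<alpha> = fourier h \<alpha>" if "\<alpha> \<in> hardy_index"
    using o[OF monomial_in_boundary_space[OF that]] fourier_diff[OF h PL, of \<alpha>] by (simp add: fourier_def)
qed

text \<open>
  Coefficients are independent of the representatives chosen for boundary values and projections, so
  in terms of Fourier coefficients the operator multiplies by the symbol and truncates.
\<close>

lemma toeplitz_coeff:
  assumes \<phi>: "\<phi> \<in> torus_Linf" and f: "f \<in> hardy_space"
  shows "toeplitz \<phi> f \<in> hardy_space"
    "\<alpha> \<in> hardy_index \<Longrightarrow> hardy_coeff (toeplitz \<phi> f) \<alpha> = fourier (\<lambda>\<zeta>. \<phi> \<zeta> * boundary_value f \<zeta>) \<alpha>"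
proof -
  obtain C where "\<phi> \<in> borel_measurable borel" "AE \<zeta> in torus_measure. cmod (\<phi> \<zeta>) \<le> C"
    using \<phi> by (auto simp: torus_Linf_def cong: measurable_cong_sets)
  then have L2: "(\<lambda>\<zeta>. \<phi> \<zeta> * boundary_value f \<zeta>) \<in> torus_L2"
    by (rule torus_L2_bounded_mult[OF boundary_value(1)[OF f]])
  note P = hardy_projection[OF L2]
  show "toeplitz \<phi> f \<in> hardy_space"
    unfolding toeplitz_def by (rule from_boundary(1)[OF P(1)])
  show "hardy_coeff (toeplitz \<phi> f) \<alpha> = fourier (\<lambda>\<zeta>. \<phi> \<zeta> * boundary_value f \<zeta>) \<alpha>" if "\<alpha> \<in> hardy_index"
    unfolding toeplitz_def from_boundary(2)[OF P(1) that] P(2)[OF that] ..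
qed

section \<open>Multiplication by coordinates and its adjoint\<close>

abbreviation unit_index :: "'n::finite \<Rightarrow> (int, 'n) vec" where
  "unit_index j \<equiv> axis j 1"

lemma hardy_index_add_nonneg:
  assumes "\<alpha> \<in> hardy_index" "\<And>j. \<gamma> $ j \<ge> 0" shows "\<alpha> + \<gamma> \<in> hardy_index"
proof -
  have "shifted_partial_sum (\<alpha> + \<gamma>) k = shifted_partial_sum \<alpha> k + (\<Sum>j\<in>{..k}. \<gamma> $ j)" for k
    by (simp add: shifted_partial_sum_def sum.distrib)
  then show ?thesis
    using assms by (simp add: hardy_index_iff sum_nonneg)
qed

lemma hardy_index_nonneg:
  assumes "\<And>j. \<gamma> $ j \<ge> 0" shows "\<gamma> \<in> hardy_index"
proof -
  have "shifted_partial_sum \<gamma> k \<ge> 0" for k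
    using sum_nonneg[of "{..k}" "\<lambda>j. \<gamma> $ j"] assms index_pos_pos[of k] by (simp add: shifted_partial_sum_def)
  then show ?thesis by (simp add: hardy_index_iff)
qed

lemma hardy_index_add_unit: "\<alpha> \<in> hardy_index \<Longrightarrow> \<alpha> + unit_index j \<in> hardy_index"
  by (rule hardy_index_add_nonneg) (auto simp: axis_def)

text \<open>
  Multiplication by $z_j$ shifts the exponents by the unit index. The law
  $z_j^{m+1}=z_j\,z_j^m$ also holds at $z_j=0$, because a vanishing coordinate belongs to the smallest
  index, where the exponents are nonnegative.
\<close>

lemma coord_mult_coeff:
  fixes f :: "'n::{finite,linorder} cfun"
  assumes f: "f \<in> hardy_space"
  shows "coord_mult j f \<in> hardy_space" "hardy_coeff (coord_mult j f) \<alpha> = hardy_coeff f (\<alpha> - unit_index j)"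
proof -
  define a where "a = hardy_coeff f"
  have a: "a \<in> hardy_l2" "hardy_series a = f" and off: "\<And>\<alpha>. \<alpha> \<notin> hardy_index \<Longrightarrow> a \<alpha> = 0"
    unfolding a_def using hardy_coeff[OF f] by auto
  let ?s = "\<lambda>\<alpha>. \<alpha> + unit_index j"
  let ?b = "\<lambda>\<alpha>. a (\<alpha> - unit_index j)"
  have inj: "inj_on ?s A" for A by (auto simp: inj_on_def)
  have img: "?s ` hardy_index \<subseteq> hardy_index" using hardy_index_add_unit by auto
  have out: "?b \<alpha> = 0" if "\<alpha> \<notin> ?s ` hardy_index" for \<alpha>
  proof (rule off, rule notI)
    assume "\<alpha> - unit_index j \<in> hardy_index"
    from imageI[OF this, of ?s] that show False by simp
  qed
  have "(\<lambda>\<alpha>. (cmod (?b \<alpha>))\<^sup>2) summable_on ?s ` hardy_index"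
    using a(1) by (subst summable_on_reindex[OF inj]) (simp add: hardy_l2_def o_def)
  then have "(\<lambda>\<alpha>. (cmod (?b \<alpha>))\<^sup>2) summable_on hardy_index"
    by (rule summable_on_cong_neutral[THEN iffD1, rotated -1]) (use img out in auto)
  then have b: "?b \<in> hardy_l2" by (simp add: hardy_l2_def)
  have eq: "coord_mult j f = hardy_series ?b"
  proof
    fix z
    show "coord_mult j f z = hardy_series ?b z"
    proof (cases "z \<in> hartogs")
      case True
      have shift: "monomial (?s \<alpha>) z = z $ j * monomial \<alpha> z" if \<alpha>: "\<alpha> \<in> hardy_index" for \<alpha>
      proof -
        have step: "(z $ i) powi (?s \<alpha> $ i) = (if i = j then z $ j else 1) * (z $ i) powi (\<alpha> $ i)" for i
        proof (cases "i = j")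
          case ij: True
          have "z $ j \<noteq> 0 \<or> \<alpha> $ j \<ge> 0"
          proof (cases "\<forall>i. j \<le> i")
            case True
            then show ?thesis using hardy_index_minimal_nonneg[OF \<alpha>, of j] by simp
          next
            case False
            then obtain i where "i < j" by (auto simp: not_le)
            then show ?thesis using hartogs_pos[OF \<open>z \<in> hartogs\<close>, of i j] by auto
          qed
          then have "(z $ j) powi (\<alpha> $ j + 1) = z $ j * (z $ j) powi (\<alpha> $ j)"
          proof
            assume "\<alpha> $ j \<ge> 0"
            then show ?thesis by (simp add: power_int_def nat_add_distrib)
          qed (simp add: power_int_add mult.commute)
          then show ?thesis using ij by (simp add: axis_def)
        qed (simp add: axis_def)
        show ?thesis
          unfolding monomial_def step prod.distrib by simp
      qed
      have "(\<Sum>\<^sub>\<infinity>\<alpha>\<in>hardy_index. ?b \<alpha> * monomial \<alpha> z) = (\<Sum>\<^sub>\<infinity>\<alpha>\<in>?s ` hardy_index. ?b \<alpha> * monomial \<alpha> z)"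
        by (rule infsum_cong_neutral) (use img out in auto)
      also have "\<dots> = (\<Sum>\<^sub>\<infinity>\<alpha>\<in>hardy_index. a \<alpha> * monomial (?s \<alpha>) z)"
        by (subst infsum_reindex[OF inj]) (simp add: o_def)
      also have "\<dots> = (\<Sum>\<^sub>\<infinity>\<alpha>\<in>hardy_index. z $ j * (a \<alpha> * monomial \<alpha> z))"
        by (rule infsum_cong) (simp add: shift)
      also have "\<dots> = z $ j * hardy_series a z"
        using True by (simp add: infsum_cmult_right' hardy_series_def)
      finally show ?thesis using True a(2) by (simp add: coord_mult_def hardy_series_def)
    next
      case False
      then show ?thesis unfolding coord_mult_def a(2)[symmetric] by (simp add: hardy_series_def)
    qed
  qed
  show "coord_mult j f \<in> hardy_space"
    unfolding eq by (rule hardy_series_in_hardy_space[OF b])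
  show "hardy_coeff (coord_mult j f) \<alpha> = hardy_coeff f (\<alpha> - unit_index j)"
    unfolding eq hardy_coeff_series[OF b] a_def[symmetric] using img out[of \<alpha>] by auto
qed

definition hardy_monomial :: "(int, 'n) vec \<Rightarrow> 'n::{finite,linorder} cfun" where
  "hardy_monomial \<beta> = hardy_series (\<lambda>\<alpha>. if \<alpha> \<in> {\<beta>} then 1 else 0)"

lemma hardy_monomial:
  assumes "\<beta> \<in> hardy_index"
  shows "hardy_monomial \<beta> \<in> hardy_space" "hardy_coeff (hardy_monomial \<beta>) \<alpha> = (if \<alpha> = \<beta> then 1 else 0)"
proof -
  have L: "(\<lambda>\<alpha>. if \<alpha> \<in> {\<beta>} then 1 else 0) \<in> hardy_l2" by (rule hardy_l2_truncate) simp
  show "hardy_monomial \<beta> \<in> hardy_space"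
    unfolding hardy_monomial_def by (rule hardy_series_in_hardy_space[OF L])
  show "hardy_coeff (hardy_monomial \<beta>) \<alpha> = (if \<alpha> = \<beta> then 1 else 0)"
    unfolding hardy_monomial_def hardy_coeff_series[OF L] using assms by auto
qed

lemma coord_mult_hardy_monomial:
  assumes \<beta>: "\<beta> \<in> hardy_index"
  shows "coord_mult j (hardy_monomial \<beta>) = hardy_monomial (\<beta> + unit_index j)"
proof (rule hardy_space_eqI)
  note H = hardy_monomial[OF \<beta>] and H' = hardy_monomial[OF hardy_index_add_unit[OF \<beta>, of j]]
  show "coord_mult j (hardy_monomial \<beta>) \<in> hardy_space" by (rule coord_mult_coeff(1)[OF H(1)])
  show "hardy_monomial (\<beta> + unit_index j) \<in> hardy_space" by (rule H'(1))
  show "hardy_coeff (coord_mult j (hardy_monomial \<beta>)) \<alpha> = hardy_coeff (hardy_monomial (\<beta> + unit_index j)) \<alpha>" for \<alpha>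
    unfolding coord_mult_coeff(2)[OF H(1)] H(2) H'(2) by (simp add: diff_eq_eq)
qed

lemma hardy_inner_monomial_left:
  assumes "\<beta> \<in> hardy_index" "h \<in> hardy_space"
  shows "hardy_inner (hardy_monomial \<beta>) h = cnj (hardy_coeff h \<beta>)"
proof -
  have "((\<lambda>\<alpha>. hardy_coeff (hardy_monomial \<beta>) \<alpha> * cnj (hardy_coeff h \<alpha>)) has_sum (\<Sum>\<alpha>\<in>{\<beta>}. cnj (hardy_coeff h \<alpha>))) hardy_index"
    by (rule has_sum_cong_neutral[THEN iffD1, rotated -1, OF has_sum_finite]) (use assms(1) in \<open>auto simp: hardy_monomial(2)\<close>)
  then show ?thesis
    using has_sum_unique[OF hardy_inner_has_sum[OF hardy_monomial(1)[OF assms(1)] assms(2)]] by simp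
qed

text \<open>
  The adjoint of the shift is the backward shift, truncated to \<^const>\<open>hardy_index\<close>; testing against
  monomials shows that no other function has the defining property.
\<close>

lemma hardy_adjoint_coord_mult:
  fixes g :: "'n::{finite,linorder} cfun"
  assumes g: "g \<in> hardy_space"
  shows "hardy_adjoint (coord_mult j) g \<in> hardy_space"
    "\<alpha> \<in> hardy_index \<Longrightarrow> hardy_coeff (hardy_adjoint (coord_mult j) g) \<alpha> = hardy_coeff g (\<alpha> + unit_index j)"
proof -
  let ?s = "\<lambda>\<alpha>. \<alpha> + unit_index j"
  define b where "b \<alpha> = hardy_coeff g (?s \<alpha>)" for \<alpha>
  have inj: "inj_on ?s A" for A by (auto simp: inj_on_def)
  have img: "?s ` hardy_index \<subseteq> hardy_index" using hardy_index_add_unit by auto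
  have "(\<lambda>\<alpha>. (cmod (hardy_coeff g \<alpha>))\<^sup>2) summable_on ?s ` hardy_index"
    using hardy_coeff(1)[OF g] img by (intro summable_on_subset_banach[OF _ img]) (simp add: hardy_l2_def)
  then have b: "b \<in> hardy_l2"
    by (subst (asm) summable_on_reindex[OF inj]) (simp add: hardy_l2_def o_def b_def)
  define h where "h = hardy_series b"
  have h: "h \<in> hardy_space" unfolding h_def by (rule hardy_series_in_hardy_space[OF b])
  have hc: "hardy_coeff h \<alpha> = hardy_coeff g (?s \<alpha>)" if "\<alpha> \<in> hardy_index" for \<alpha>
    using that by (simp add: h_def hardy_coeff_series[OF b] b_def)
  have adj: "hardy_inner (coord_mult j f) g = hardy_inner f h" if f: "f \<in> hardy_space" for f
  proof -
    let ?t = "\<lambda>\<alpha>. hardy_coeff f (\<alpha> - unit_index j) * cnj (hardy_coeff g \<alpha>)"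
    have out: "?t \<alpha> = 0" if "\<alpha> \<notin> ?s ` hardy_index" for \<alpha>
    proof -
      have "\<alpha> - unit_index j \<notin> hardy_index"
      proof
        assume "\<alpha> - unit_index j \<in> hardy_index"
        from imageI[OF this, of ?s] that show False by simp
      qed
      then show ?thesis using hardy_coeff(3)[OF f] by simp
    qed
    have "(?t has_sum hardy_inner (coord_mult j f) g) hardy_index"
      using hardy_inner_has_sum[OF coord_mult_coeff(1)[OF f] g] unfolding coord_mult_coeff(2)[OF f] .
    then have "(?t has_sum hardy_inner (coord_mult j f) g) (?s ` hardy_index)"
      by (rule has_sum_cong_neutral[THEN iffD1, rotated -1]) (use img out in auto)
    then have "((\<lambda>\<alpha>. hardy_coeff f \<alpha> * cnj (hardy_coeff g (?s \<alpha>))) has_sum hardy_inner (coord_mult j f) g) hardy_index"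
      by (subst (asm) has_sum_reindex[OF inj]) (simp add: o_def)
    then have "((\<lambda>\<alpha>. hardy_coeff f \<alpha> * cnj (hardy_coeff h \<alpha>)) has_sum hardy_inner (coord_mult j f) g) hardy_index"
      by (rule has_sum_cong[THEN iffD1, rotated]) (simp add: hc)
    then show ?thesis
      by (rule has_sum_unique[OF _ hardy_inner_has_sum[OF f h]])
  qed
  have "hardy_adjoint (coord_mult j) g = h"
    unfolding hardy_adjoint_def
  proof (rule the_equality)
    show "h \<in> hardy_space \<and> (\<forall>f\<in>hardy_space. hardy_inner (coord_mult j f) g = hardy_inner f h)"
      using h adj by blast
    fix k assume k: "k \<in> hardy_space \<and> (\<forall>f\<in>hardy_space. hardy_inner (coord_mult j f) g = hardy_inner f k)"
    show "k = h"
    proof (rule hardy_space_eqI)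
      show "k \<in> hardy_space" "h \<in> hardy_space" using k h by auto
      fix \<beta> :: "(int, 'n) vec" assume \<beta>: "\<beta> \<in> hardy_index"
      have "hardy_inner (hardy_monomial \<beta>) k = hardy_inner (hardy_monomial \<beta>) h"
        using k adj hardy_monomial(1)[OF \<beta>] by metis
      then show "hardy_coeff k \<beta> = hardy_coeff h \<beta>"
        using k by (simp add: hardy_inner_monomial_left[OF \<beta>] h)
    qed
  qed
  then show "hardy_adjoint (coord_mult j) g \<in> hardy_space"
    "\<alpha> \<in> hardy_index \<Longrightarrow> hardy_coeff (hardy_adjoint (coord_mult j) g) \<alpha> = hardy_coeff g (\<alpha> + unit_index j)"
    using h hc by auto
qed

text \<open>
  The operator identity in coordinates: the matrix is constant along the direction of the unit index.
\<close>

lemma shift_condition_iff: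
  assumes f: "f \<in> hardy_space" and T: "\<And>f. f \<in> hardy_space \<Longrightarrow> T f \<in> hardy_space"
  shows "hardy_adjoint (coord_mult j) (T (coord_mult j f)) = T f \<longleftrightarrow>
    (\<forall>\<alpha>\<in>hardy_index. hardy_coeff (T (coord_mult j f)) (\<alpha> + unit_index j) = hardy_coeff (T f) \<alpha>)"
proof -
  let ?A = "hardy_adjoint (coord_mult j) (T (coord_mult j f))"
  have A: "?A \<in> hardy_space"
    "\<And>\<alpha>. \<alpha> \<in> hardy_index \<Longrightarrow> hardy_coeff ?A \<alpha> = hardy_coeff (T (coord_mult j f)) (\<alpha> + unit_index j)"
    using hardy_adjoint_coord_mult[OF T[OF coord_mult_coeff(1)[OF f]]] by auto
  show ?thesis
  proof
    assume "?A = T f"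
    then show "\<forall>\<alpha>\<in>hardy_index. hardy_coeff (T (coord_mult j f)) (\<alpha> + unit_index j) = hardy_coeff (T f) \<alpha>"
      using A(2) by simp
  next
    assume "\<forall>\<alpha>\<in>hardy_index. hardy_coeff (T (coord_mult j f)) (\<alpha> + unit_index j) = hardy_coeff (T f) \<alpha>"
    then show "?A = T f"
      by (intro hardy_space_eqI[OF A(1) T[OF f]]) (simp add: A(2))
  qed
qed

text \<open>
  By uniqueness of Fourier coefficients the boundary value of $z_jf$ is $\zeta_j$ times that of $f$
  almost everywhere, and $\zeta_j$ cancels against the shift of the exponent because $|\zeta_j|=1$.
\<close>

lemma toeplitz_satisfies_shift_condition:
  fixes f :: "'n::{finite,linorder} cfun"
  assumes \<phi>: "\<phi> \<in> torus_Linf" and f: "f \<in> hardy_space" and \<alpha>: "\<alpha> \<in> hardy_index"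
  shows "hardy_coeff (toeplitz \<phi> (coord_mult j f)) (\<alpha> + unit_index j) = hardy_coeff (toeplitz \<phi> f) \<alpha>"
proof -
  note Mf = coord_mult_coeff[OF f, of j]
  let ?g = "boundary_value f" and ?h = "boundary_value (coord_mult j f)"
  have g: "?g \<in> torus_L2" and h: "?h \<in> torus_L2" using boundary_value(1) f Mf(1) by auto
  have gm [measurable]: "?g \<in> borel_measurable borel" and hm [measurable]: "?h \<in> borel_measurable borel"
    using g h by (auto simp: torus_L2_iff)
  have \<phi>m [measurable]: "\<phi> \<in> borel_measurable borel"
    using \<phi> by (auto simp: torus_Linf_def cong: measurable_cong_sets)
  have [measurable]: "(\<lambda>\<zeta>::(complex, 'n) vec. \<zeta> $ j) \<in> borel_measurable borel"
    using monomial_measurable[of "unit_index j"] by (simp add: monomial_axis[abs_def])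
  have zj: "\<zeta> $ j * cnj (monomial (\<beta> + unit_index j) \<zeta>) = cnj (monomial \<beta> \<zeta>)" if \<zeta>: "\<zeta> \<in> torus" for \<zeta> \<beta>
  proof -
    have "\<zeta> $ j * cnj (monomial (\<beta> + unit_index j) \<zeta>) = monomial (unit_index j - (\<beta> + unit_index j)) \<zeta>"
      by (simp only: monomial_mult_cnj_torus[OF \<zeta>, symmetric] monomial_axis)
    then show ?thesis by (simp add: cnj_monomial_torus[OF \<zeta>])
  qed
  have zg: "(\<lambda>\<zeta>. \<zeta> $ j * ?g \<zeta>) \<in> torus_L2"
  proof (rule torus_L2_bounded_mult[OF g])
    show "AE \<zeta> in torus_measure. cmod (\<zeta> $ j) \<le> 1"
      using AE_torus by eventually_elim (simp add: torus_def)
  qed measurable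
  have fzg: "fourier (\<lambda>\<zeta>. \<zeta> $ j * ?g \<zeta>) (\<beta> + unit_index j) = fourier ?g \<beta>" for \<beta>
    unfolding fourier_def torus_inner_def
  proof (rule integral_cong_AE)
    show "AE \<zeta> in torus_measure. \<zeta> $ j * ?g \<zeta> * cnj (monomial (\<beta> + unit_index j) \<zeta>) = ?g \<zeta> * cnj (monomial \<beta> \<zeta>)"
      using AE_torus
    proof eventually_elim
      case (elim \<zeta>)
      show ?case unfolding zj[OF elim, of \<beta>, symmetric] by (simp only: ac_simps)
    qed
  qed measurable
  have "fourier (\<lambda>\<zeta>. \<zeta> $ j * ?g \<zeta>) \<beta> = fourier ?h \<beta>" for \<beta>
    using fzg[of "\<beta> - unit_index j"] by (simp add: boundary_value(3)[OF f] boundary_value(3)[OF Mf(1)] Mf(2))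
  then have ae: "AE \<zeta> in torus_measure. ?h \<zeta> - \<zeta> $ j * ?g \<zeta> = 0"
    by (intro AE_eq_0_if_fourier_eq_0 torus_L2_diff h zg) (simp add: fourier_diff[OF h zg])
  have "fourier (\<lambda>\<zeta>. \<phi> \<zeta> * ?h \<zeta>) (\<alpha> + unit_index j) = fourier (\<lambda>\<zeta>. \<phi> \<zeta> * ?g \<zeta>) \<alpha>"
    unfolding fourier_def torus_inner_def
  proof (rule integral_cong_AE)
    show "AE \<zeta> in torus_measure. \<phi> \<zeta> * ?h \<zeta> * cnj (monomial (\<alpha> + unit_index j) \<zeta>) = \<phi> \<zeta> * ?g \<zeta> * cnj (monomial \<alpha> \<zeta>)"
      using ae AE_torus
    proof eventually_elim
      case (elim \<zeta>)
      then have eq: "?h \<zeta> = \<zeta> $ j * ?g \<zeta>" by simp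
      show ?case
        unfolding eq zj[OF elim(2), of \<alpha>, symmetric] by (simp only: ac_simps)
    qed
  qed measurable
  then show ?thesis
    using toeplitz_coeff(2)[OF \<phi> Mf(1) hardy_index_add_unit[OF \<alpha>]] toeplitz_coeff(2)[OF \<phi> f \<alpha>] by simp
qed

section \<open>Operators with shift-invariant matrix\<close>

lemma torus_norm_bounded_mult:
  assumes g: "g \<in> torus_L2" and \<phi>: "\<phi> \<in> borel_measurable borel" "AE \<zeta> in torus_measure. cmod (\<phi> \<zeta>) \<le> C" and C: "C \<ge> 0"
  shows "torus_norm (\<lambda>\<zeta>. \<phi> \<zeta> * g \<zeta>) \<le> C * torus_norm g"
proof (rule power2_le_imp_le)
  have "(torus_norm (\<lambda>\<zeta>. \<phi> \<zeta> * g \<zeta>))\<^sup>2 \<le> (\<integral>\<zeta>. C\<^sup>2 * (cmod (g \<zeta>))\<^sup>2 \<partial>torus_measure)"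
    unfolding torus_norm_square
  proof (rule integral_mono_AE)
    show "integrable torus_measure (\<lambda>\<zeta>. (cmod (\<phi> \<zeta> * g \<zeta>))\<^sup>2)"
      using torus_L2_bounded_mult[OF g \<phi>] by (simp add: torus_L2_iff)
    show "integrable torus_measure (\<lambda>\<zeta>. C\<^sup>2 * (cmod (g \<zeta>))\<^sup>2)"
      using g by (simp add: torus_L2_iff)
    show "AE \<zeta> in torus_measure. (cmod (\<phi> \<zeta> * g \<zeta>))\<^sup>2 \<le> C\<^sup>2 * (cmod (g \<zeta>))\<^sup>2"
      using \<phi>(2) by eventually_elim (simp add: norm_mult power_mult_distrib mult_right_mono power_mono)
  qed
  then show "(torus_norm (\<lambda>\<zeta>. \<phi> \<zeta> * g \<zeta>))\<^sup>2 \<le> (C * torus_norm g)\<^sup>2"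
    by (simp add: torus_norm_square power_mult_distrib)
  show "0 \<le> C * torus_norm g" by (rule mult_nonneg_nonneg[OF C torus_norm_nonneg])
qed

lemma fourier_mult_monomial:
  assumes [measurable]: "\<phi> \<in> borel_measurable borel"
  shows "fourier (\<lambda>\<zeta>. \<phi> \<zeta> * monomial \<beta> \<zeta>) \<alpha> = fourier \<phi> (\<alpha> - \<beta>)"
  unfolding fourier_def torus_inner_def
proof (rule integral_cong_AE)
  show "AE \<zeta> in torus_measure. \<phi> \<zeta> * monomial \<beta> \<zeta> * cnj (monomial \<alpha> \<zeta>) = \<phi> \<zeta> * cnj (monomial (\<alpha> - \<beta>) \<zeta>)"
    using AE_torus
  proof eventually_elim
    case (elim \<zeta>)
    have "monomial \<beta> \<zeta> * cnj (monomial \<alpha> \<zeta>) = cnj (monomial (\<alpha> - \<beta>) \<zeta>)"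
      using monomial_mult_cnj_torus[OF elim] cnj_monomial_torus[OF elim, of "\<alpha> - \<beta>"] by simp
    then show ?case by (simp only: mult.assoc)
  qed
qed measurable

text \<open>
  A nonnegative index that shifts \<open>\<alpha>\<close> to a nonnegative index, hence into \<^const>\<open>hardy_index\<close>.
\<close>

definition abs_index :: "(int, 'n::finite) vec \<Rightarrow> (int, 'n) vec" where
  "abs_index \<alpha> = (\<chi> j. \<bar>\<alpha> $ j\<bar>)"

text \<open>
  A bounded operator whose matrix is unchanged when row and column are shifted by the same unit
  index. Such an operator has a symbol, found on the diagonals of the matrix.
\<close>

locale shift_invariant_operator =
  fixes T :: "'n::{finite,linorder} cfun \<Rightarrow> 'n cfun" and K :: real
  assumes maps: "\<And>f. f \<in> hardy_space \<Longrightarrow> T f \<in> hardy_space"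
    and add: "\<And>f g. f \<in> hardy_space \<Longrightarrow> g \<in> hardy_space \<Longrightarrow> T (\<lambda>z. f z + g z) = (\<lambda>z. T f z + T g z)"
    and cmult: "\<And>c f. f \<in> hardy_space \<Longrightarrow> T (\<lambda>z. c * f z) = (\<lambda>z. c * T f z)"
    and K: "K \<ge> 0" and bounded: "\<And>f. f \<in> hardy_space \<Longrightarrow> hardy_norm (T f) \<le> K * hardy_norm f"
    and shift: "\<And>j f \<alpha>. f \<in> hardy_space \<Longrightarrow> \<alpha> \<in> hardy_index \<Longrightarrow>
       hardy_coeff (T (coord_mult j f)) (\<alpha> + unit_index j) = hardy_coeff (T f) \<alpha>"
begin

text \<open>
  The matrix of the operator in the basis of monomials.
\<close>

definition entry :: "(int, 'n) vec \<Rightarrow> (int, 'n) vec \<Rightarrow> complex" where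
  "entry \<alpha> \<beta> = hardy_coeff (T (hardy_monomial \<beta>)) \<alpha>"

lemma entry_shift_unit:
  assumes "\<alpha> \<in> hardy_index" "\<beta> \<in> hardy_index"
  shows "entry (\<alpha> + unit_index j) (\<beta> + unit_index j) = entry \<alpha> \<beta>"
  using shift[OF hardy_monomial(1)[OF assms(2)] assms(1)]
  by (simp add: entry_def coord_mult_hardy_monomial[OF assms(2)])

lemma entry_shift_axis:
  assumes "\<alpha> \<in> hardy_index" "\<beta> \<in> hardy_index"
  shows "entry (\<alpha> + axis j (int m)) (\<beta> + axis j (int m)) = entry \<alpha> \<beta>"
proof (induction m)
  case 0
  have "axis j (int 0) = (0 :: (int, 'n) vec)" by (simp add: vec_eq_iff axis_def)
  then show ?case by (simp only: add_0_right)
next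
  case (Suc m)
  have eq: "\<gamma> + axis j (int (Suc m)) = (\<gamma> + axis j (int m)) + unit_index j" for \<gamma>
    by (simp add: vec_eq_iff axis_def)
  have in_I: "\<gamma> + axis j (int m) \<in> hardy_index" if "\<gamma> \<in> hardy_index" for \<gamma>
    by (rule hardy_index_add_nonneg[OF that]) (simp add: axis_def)
  show ?case unfolding eq entry_shift_unit[OF in_I[OF assms(1)] in_I[OF assms(2)]] by (rule Suc)
qed

lemma entry_shift:
  assumes \<alpha>: "\<alpha> \<in> hardy_index" and \<beta>: "\<beta> \<in> hardy_index" and \<gamma>: "\<And>j. \<gamma> $ j \<ge> 0"
  shows "entry (\<alpha> + \<gamma>) (\<beta> + \<gamma>) = entry \<alpha> \<beta>"
proof -
  have *: "entry (\<alpha> + (\<Sum>j\<in>S. axis j (\<gamma> $ j))) (\<beta> + (\<Sum>j\<in>S. axis j (\<gamma> $ j))) = entry \<alpha> \<beta>" if "finite S" for S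
    using that
  proof (induction S rule: finite_induct)
    case (insert i S)
    let ?s = "\<Sum>j\<in>S. axis j (\<gamma> $ j)"
    have s: "?s $ k \<ge> 0" for k
      unfolding sum_component using \<gamma> by (intro sum_nonneg) (simp add: axis_def)
    have eq: "\<delta> + (\<Sum>j\<in>insert i S. axis j (\<gamma> $ j)) = (\<delta> + ?s) + axis i (int (nat (\<gamma> $ i)))" for \<delta>
      using insert.hyps \<gamma>[of i] by (simp add: ac_simps)
    show ?case
      unfolding eq entry_shift_axis[OF hardy_index_add_nonneg[OF \<alpha> s] hardy_index_add_nonneg[OF \<beta> s]]
      by (rule insert.IH)
  qed simp
  have "(\<Sum>j\<in>UNIV. axis j (\<gamma> $ j)) = \<gamma>"
    by (simp add: vec_eq_iff sum_component axis_def if_distrib cong: if_cong)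
  then show ?thesis using *[of UNIV] by simp
qed

text \<open>
  The common value of the entries on the diagonal \<open>\<delta>\<close>, taken at a place where both indices are
  nonnegative; it will be the Fourier coefficient of the symbol at \<open>\<delta>\<close>.
\<close>

definition symbol_coeff :: "(int, 'n) vec \<Rightarrow> complex" where
  "symbol_coeff \<delta> = entry (\<delta> + abs_index \<delta>) (abs_index \<delta>)"

text \<open>
  Two pairs of indices with the same difference can be shifted, by nonnegative indices, to a common
  pair.
\<close>

lemma entry_eq_symbol_coeff:
  assumes \<alpha>: "\<alpha> \<in> hardy_index" and \<beta>: "\<beta> \<in> hardy_index"
  shows "entry \<alpha> \<beta> = symbol_coeff (\<alpha> - \<beta>)"
proof -
  define \<delta> where "\<delta> = \<alpha> - \<beta>"
  let ?\<nu> = "abs_index \<delta>"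
  \<comment> \<open>Shifting $(\alpha,\beta)$ by \<open>\<gamma>\<close> and $(\delta+\nu,\nu)$ by $|\beta|$ gives the same pair.\<close>
  define \<gamma> where "\<gamma> = ?\<nu> + (abs_index \<beta> - \<beta>)"
  have nn: "abs_index \<epsilon> $ j \<ge> 0" for \<epsilon> j by (simp add: abs_index_def)
  have \<gamma>: "\<gamma> $ j \<ge> 0" for j by (simp add: \<gamma>_def abs_index_def)
  have \<nu>: "?\<nu> \<in> hardy_index" by (rule hardy_index_nonneg[OF nn])
  have \<delta>\<nu>: "\<delta> + ?\<nu> \<in> hardy_index" by (rule hardy_index_nonneg) (simp add: abs_index_def)
  have "entry \<alpha> \<beta> = entry (\<alpha> + \<gamma>) (\<beta> + \<gamma>)"
    by (rule entry_shift[OF \<alpha> \<beta> \<gamma>, symmetric])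
  also have "\<alpha> + \<gamma> = (\<delta> + ?\<nu>) + abs_index \<beta>" by (simp add: \<gamma>_def \<delta>_def)
  also have "\<beta> + \<gamma> = ?\<nu> + abs_index \<beta>" by (simp add: \<gamma>_def)
  also have "entry ((\<delta> + ?\<nu>) + abs_index \<beta>) (?\<nu> + abs_index \<beta>) = entry (\<delta> + ?\<nu>) ?\<nu>"
    by (rule entry_shift[OF \<delta>\<nu> \<nu> nn])
  finally show ?thesis by (simp add: symbol_coeff_def \<delta>_def)
qed

text \<open>
  This gives access to trigonometric polynomials with arbitrary exponents: multiplied by a suitable
  monomial, each of them has its exponents in \<^const>\<open>hardy_index\<close>.
\<close>

lemma common_shift:
  fixes F :: "(int, 'n) vec set"
  assumes "finite F"
  obtains \<nu> where "\<nu> \<in> hardy_index" "\<And>\<delta>. \<delta> \<in> F \<Longrightarrow> \<delta> + \<nu> \<in> hardy_index"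
proof (rule that)
  let ?\<nu> = "\<chi> j. \<Sum>\<delta>\<in>F. \<bar>\<delta> $ j\<bar>"
  show "?\<nu> \<in> hardy_index" by (rule hardy_index_nonneg) (simp add: sum_nonneg)
  show "\<delta> + ?\<nu> \<in> hardy_index" if "\<delta> \<in> F" for \<delta>
  proof (rule hardy_index_nonneg)
    fix j
    have "\<bar>\<delta> $ j\<bar> \<le> (\<Sum>\<delta>\<in>F. \<bar>\<delta> $ j\<bar>)" using assms that by (intro member_le_sum) auto
    then show "0 \<le> (\<delta> + ?\<nu>) $ j" by simp
  qed
qed

lemma hardy_norm_monomial:
  assumes "\<beta> \<in> hardy_index" shows "(hardy_norm (hardy_monomial \<beta>))\<^sup>2 = 1"
proof -
  have "((\<lambda>\<alpha>. (cmod (hardy_coeff (hardy_monomial \<beta>) \<alpha>))\<^sup>2) has_sum (\<Sum>\<alpha>\<in>{\<beta>}. 1)) hardy_index"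
    by (rule has_sum_cong_neutral[THEN iffD1, rotated -1, OF has_sum_finite]) (use assms in \<open>auto simp: hardy_monomial(2)\<close>)
  then show ?thesis
    using has_sum_unique[OF hardy_norm_square[OF hardy_monomial(1)[OF assms]]] by simp
qed

text \<open>
  After a common shift, finitely many coefficients appear in one column of the matrix, and the norm of
  a column is at most $K$.
\<close>

lemma symbol_coeff_square_summable: "(\<lambda>\<delta>. (cmod (symbol_coeff \<delta>))\<^sup>2) summable_on UNIV"
proof (rule nonneg_bdd_above_summable_on)
  show "bdd_above (sum (\<lambda>\<delta>. (cmod (symbol_coeff \<delta>))\<^sup>2) ` {F. F \<subseteq> UNIV \<and> finite F})"
  proof (rule bdd_aboveI2)
    fix F :: "(int, 'n) vec set" assume "F \<in> {F. F \<subseteq> UNIV \<and> finite F}"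
    then have F: "finite F" by simp
    obtain \<nu> where \<nu>: "\<nu> \<in> hardy_index" and F\<nu>: "\<And>\<delta>. \<delta> \<in> F \<Longrightarrow> \<delta> + \<nu> \<in> hardy_index"
      using common_shift[OF F] by blast
    let ?e = "hardy_monomial \<nu>"
    have "(\<Sum>\<delta>\<in>F. (cmod (symbol_coeff \<delta>))\<^sup>2) = (\<Sum>\<delta>\<in>F. (cmod (hardy_coeff (T ?e) (\<delta> + \<nu>)))\<^sup>2)"
      by (rule sum.cong) (simp_all add: entry_eq_symbol_coeff[OF F\<nu> \<nu>, unfolded entry_def])
    also have "\<dots> = (\<Sum>\<alpha>\<in>(\<lambda>\<delta>. \<delta> + \<nu>) ` F. (cmod (hardy_coeff (T ?e) \<alpha>))\<^sup>2)"
      by (subst sum.reindex) (auto simp: inj_on_def)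
    also have "\<dots> \<le> (hardy_norm (T ?e))\<^sup>2"
      using F by (intro hardy_coeff_sum_le_norm maps hardy_monomial \<nu>) auto
    also have "\<dots> \<le> (K * hardy_norm ?e)\<^sup>2"
      by (intro power_mono bounded hardy_monomial \<nu> hardy_norm_nonneg)
    also have "\<dots> = K\<^sup>2" by (simp add: power_mult_distrib hardy_norm_monomial[OF \<nu>])
    finally show "(\<Sum>\<delta>\<in>F. (cmod (symbol_coeff \<delta>))\<^sup>2) \<le> K\<^sup>2" .
  qed
qed simp

lemma hardy_series_insert:
  assumes "finite F" "\<beta> \<notin> F"
  shows "hardy_series (\<lambda>\<alpha>. if \<alpha> \<in> insert \<beta> F then d \<alpha> else 0)
    = (\<lambda>z. d \<beta> * hardy_monomial \<beta> z + hardy_series (\<lambda>\<alpha>. if \<alpha> \<in> F then d \<alpha> else 0) z)"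
proof -
  have 1: "(\<lambda>\<alpha>. if \<alpha> \<in> {\<beta>} then 1 else 0) \<in> hardy_l2" by (rule hardy_l2_truncate) simp
  have eq: "(\<lambda>\<alpha>. if \<alpha> \<in> insert \<beta> F then d \<alpha> else 0)
     = (\<lambda>\<alpha>. d \<beta> * (if \<alpha> \<in> {\<beta>} then 1 else 0) + (if \<alpha> \<in> F then d \<alpha> else 0))"
    using assms(2) by auto
  show ?thesis
    unfolding eq hardy_series_add[OF hardy_l2_cmult[OF 1] hardy_l2_truncate[OF assms(1)]]
      hardy_series_cmult[OF 1] hardy_monomial_def ..
qed

lemma coeff_finite_combination:
  assumes "finite F" "F \<subseteq> hardy_index"
  shows "hardy_coeff (T (hardy_series (\<lambda>\<alpha>. if \<alpha> \<in> F then d \<alpha> else 0))) \<alpha> = (\<Sum>\<beta>\<in>F. d \<beta> * entry \<alpha> \<beta>)"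
  using assms
proof (induction F rule: finite_induct)
  case empty
  have z: "hardy_series (\<lambda>_. 0) = (\<lambda>z. 0)" by (simp add: hardy_series_def fun_eq_iff)
  have zH: "(\<lambda>z::(complex, 'n) vec. 0) \<in> hardy_space"
    unfolding z[symmetric] by (rule hardy_series_in_hardy_space) (simp add: hardy_l2_def)
  have "T (\<lambda>z. 0) = (\<lambda>z. 0)" using cmult[OF zH, of 0] by simp
  moreover have "hardy_coeff (\<lambda>z::(complex, 'n) vec. 0) \<alpha> = 0" using hardy_space_cmult(2)[OF zH, of 0 \<alpha>] by simp
  ultimately show ?case by (simp add: z)
next
  case (insert \<beta> F)
  let ?p = "hardy_series (\<lambda>\<alpha>. if \<alpha> \<in> F then d \<alpha> else 0)"
  have p: "?p \<in> hardy_space" by (intro hardy_series_in_hardy_space hardy_l2_truncate insert.hyps)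
  have e: "hardy_monomial \<beta> \<in> hardy_space" using insert.prems by (intro hardy_monomial) auto
  have de: "(\<lambda>z. d \<beta> * hardy_monomial \<beta> z) \<in> hardy_space" by (rule hardy_space_cmult(1)[OF e])
  have "hardy_coeff (T (\<lambda>z. d \<beta> * hardy_monomial \<beta> z + ?p z)) \<alpha> = d \<beta> * entry \<alpha> \<beta> + hardy_coeff (T ?p) \<alpha>"
    unfolding add[OF de p] cmult[OF e]
    by (simp add: hardy_space_add(2)[OF hardy_space_cmult(1)[OF maps[OF e]] maps[OF p]]
        hardy_space_cmult(2)[OF maps[OF e]] entry_def)
  then show ?case
    unfolding hardy_series_insert[OF insert.hyps] using insert by simp
qed

text \<open>
  After a common shift the form is $\langle Tp,p\rangle$ for a polynomial $p$ with coefficients $d$, so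
  Cauchy--Schwarz and the boundedness of the operator apply.
\<close>

lemma quadratic_form_bound:
  assumes F: "finite F"
  shows "cmod (\<Sum>\<beta>\<in>F. \<Sum>\<alpha>\<in>F. d \<beta> * cnj (d \<alpha>) * symbol_coeff (\<alpha> - \<beta>)) \<le> K * (\<Sum>\<alpha>\<in>F. (cmod (d \<alpha>))\<^sup>2)"
proof -
  obtain \<nu> where F\<nu>: "\<And>\<delta>. \<delta> \<in> F \<Longrightarrow> \<delta> + \<nu> \<in> hardy_index"
    using common_shift[OF F] by blast
  let ?G = "(\<lambda>\<delta>. \<delta> + \<nu>) ` F"
  have inj: "inj_on (\<lambda>\<delta>. \<delta> + \<nu>) F" by (auto simp: inj_on_def)
  have G: "finite ?G" "?G \<subseteq> hardy_index" using F F\<nu> by auto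
  define p where "p = hardy_series (\<lambda>\<alpha>. if \<alpha> \<in> ?G then d (\<alpha> - \<nu>) else 0)"
  have p: "p \<in> hardy_space" unfolding p_def by (intro hardy_series_in_hardy_space hardy_l2_truncate G)
  let ?x = "\<lambda>\<alpha>. hardy_coeff (T p) (\<alpha> + \<nu>)"
  have x: "?x \<alpha> = (\<Sum>\<beta>\<in>F. d \<beta> * symbol_coeff (\<alpha> - \<beta>))" if "\<alpha> \<in> F" for \<alpha>
  proof -
    have "?x \<alpha> = (\<Sum>\<beta>\<in>?G. d (\<beta> - \<nu>) * entry (\<alpha> + \<nu>) \<beta>)"
      unfolding p_def by (rule coeff_finite_combination[OF G])
    also have "\<dots> = (\<Sum>\<beta>\<in>F. d \<beta> * entry (\<alpha> + \<nu>) (\<beta> + \<nu>))"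
      by (subst sum.reindex[OF inj]) simp
    also have "\<dots> = (\<Sum>\<beta>\<in>F. d \<beta> * symbol_coeff (\<alpha> - \<beta>))"
      by (rule sum.cong) (simp_all add: entry_eq_symbol_coeff[OF F\<nu>[OF that] F\<nu>])
    finally show ?thesis .
  qed
  have pn: "(hardy_norm p)\<^sup>2 = (\<Sum>\<alpha>\<in>F. (cmod (d \<alpha>))\<^sup>2)"
  proof -
    have "((\<lambda>\<alpha>. (cmod (hardy_coeff p \<alpha>))\<^sup>2) has_sum (\<Sum>\<alpha>\<in>?G. (cmod (d (\<alpha> - \<nu>)))\<^sup>2)) hardy_index"
      unfolding p_def hardy_coeff_series[OF hardy_l2_truncate[OF G(1)]]
      by (rule has_sum_cong_neutral[THEN iffD1, rotated -1, OF has_sum_finite[OF G(1)]]) (use G in auto)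
    then have "(hardy_norm p)\<^sup>2 = (\<Sum>\<alpha>\<in>?G. (cmod (d (\<alpha> - \<nu>)))\<^sup>2)"
      by (rule has_sum_unique[OF hardy_norm_square[OF p]])
    then show ?thesis by (simp add: sum.reindex[OF inj])
  qed
  have xs: "(\<Sum>\<alpha>\<in>F. (cmod (?x \<alpha>))\<^sup>2) \<le> (hardy_norm (T p))\<^sup>2"
  proof -
    have "(\<Sum>\<alpha>\<in>F. (cmod (?x \<alpha>))\<^sup>2) = (\<Sum>\<alpha>\<in>?G. (cmod (hardy_coeff (T p) \<alpha>))\<^sup>2)"
      by (simp add: sum.reindex[OF inj])
    also have "\<dots> \<le> (hardy_norm (T p))\<^sup>2" by (rule hardy_coeff_sum_le_norm[OF maps[OF p] G(1)])
    finally show ?thesis .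
  qed
  have "(\<Sum>\<beta>\<in>F. \<Sum>\<alpha>\<in>F. d \<beta> * cnj (d \<alpha>) * symbol_coeff (\<alpha> - \<beta>))
      = (\<Sum>\<alpha>\<in>F. \<Sum>\<beta>\<in>F. d \<beta> * cnj (d \<alpha>) * symbol_coeff (\<alpha> - \<beta>))"
    by (rule sum.swap)
  also have "\<dots> = (\<Sum>\<alpha>\<in>F. ?x \<alpha> * cnj (d \<alpha>))"
  proof (rule sum.cong)
    show "(\<Sum>\<beta>\<in>F. d \<beta> * cnj (d \<alpha>) * symbol_coeff (\<alpha> - \<beta>)) = ?x \<alpha> * cnj (d \<alpha>)" if "\<alpha> \<in> F" for \<alpha>
      unfolding x[OF that] sum_distrib_right by (intro sum.cong refl) (simp only: ac_simps)
  qed simp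
  also have "cmod \<dots> \<le> (\<Sum>\<alpha>\<in>F. \<bar>cmod (?x \<alpha>)\<bar> * \<bar>cmod (d \<alpha>)\<bar>)"
    by (rule order_trans[OF norm_sum]) (simp add: norm_mult)
  also have "\<dots> \<le> L2_set (\<lambda>\<alpha>. cmod (?x \<alpha>)) F * L2_set (\<lambda>\<alpha>. cmod (d \<alpha>)) F"
    by (rule L2_set_mult_ineq)
  also have "\<dots> \<le> hardy_norm (T p) * hardy_norm p"
  proof (rule mult_mono)
    show "L2_set (\<lambda>\<alpha>. cmod (?x \<alpha>)) F \<le> hardy_norm (T p)"
      unfolding L2_set_def by (rule real_le_lsqrt[OF hardy_norm_nonneg xs])
    show "L2_set (\<lambda>\<alpha>. cmod (d \<alpha>)) F \<le> hardy_norm p"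
      unfolding L2_set_def pn[symmetric] by (simp add: hardy_norm_nonneg)
  qed (simp_all add: hardy_norm_nonneg)
  also have "\<dots> \<le> (K * hardy_norm p) * hardy_norm p"
    by (rule mult_right_mono[OF bounded[OF p] hardy_norm_nonneg])
  also have "\<dots> = K * (\<Sum>\<alpha>\<in>F. (cmod (d \<alpha>))\<^sup>2)"
    unfolding pn[symmetric] by (simp add: power2_eq_square)
  finally show ?thesis .
qed

text \<open>
  Riesz--Fischer provides a square-integrable function with the right coefficients, and the bound for
  its quadratic form makes it bounded.
\<close>

lemma ex_symbol:
  "\<exists>\<phi>\<in>torus_L2. (\<forall>\<delta>. fourier \<phi> \<delta> = symbol_coeff \<delta>) \<and> (AE \<zeta> in torus_measure. cmod (\<phi> \<zeta>) \<le> 2 * K)"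
proof -
  obtain \<phi> where \<phi>: "\<phi> \<in> torus_L2" "norm_expansion UNIV symbol_coeff \<phi>"
    using riesz_fischer[OF symbol_coeff_square_summable] by blast
  have f: "fourier \<phi> \<delta> = symbol_coeff \<delta>" for \<delta>
    using norm_expansion_fourier[OF \<phi>] by simp
  have "AE \<zeta> in torus_measure. cmod (\<phi> \<zeta>) \<le> 2 * K"
  proof (rule AE_bounded_if_quadratic_form_bounded[OF \<phi>(1) K])
    fix F :: "(int, 'n) vec set" and c :: "(int, 'n) vec \<Rightarrow> complex" assume "finite F"
    then show "cmod (\<integral>\<zeta>. \<phi> \<zeta> * of_real ((cmod (trigpoly F c \<zeta>))\<^sup>2) \<partial>torus_measure) \<le> K * (\<Sum>\<alpha>\<in>F. (cmod (c \<alpha>))\<^sup>2)"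
      unfolding integral_trigpoly_square[OF \<phi>(1)] f by (rule quadratic_form_bound)
  qed
  then show ?thesis using \<phi>(1) f by blast
qed

text \<open>
  The operator and the Toeplitz operator have the same matrix. Both are continuous, so they agree:
  each coefficient of $Tf$ and of $T_\phi f$ is the limit of the same finite sums.
\<close>

theorem ex_toeplitz: "\<exists>\<phi>\<in>torus_Linf. \<forall>f\<in>hardy_space. T f = toeplitz \<phi> f"
proof -
  obtain \<phi> where \<phi>: "\<phi> \<in> torus_L2" and f\<phi>: "\<And>\<delta>. fourier \<phi> \<delta> = symbol_coeff \<delta>"
    and b: "AE \<zeta> in torus_measure. cmod (\<phi> \<zeta>) \<le> 2 * K"
    using ex_symbol by blast
  have m: "\<phi> \<in> borel_measurable borel" by (rule torus_L2_measurable[OF \<phi>])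
  have Linf: "\<phi> \<in> torus_Linf"
    unfolding torus_Linf_def using m b by (auto cong: measurable_cong_sets)
  have "T f = toeplitz \<phi> f" if f: "f \<in> hardy_space" for f
  proof (rule hardy_space_eqI)
    show "T f \<in> hardy_space" by (rule maps[OF f])
    show "toeplitz \<phi> f \<in> hardy_space" by (rule toeplitz_coeff(1)[OF Linf f])
    fix \<alpha> :: "(int, 'n) vec" assume \<alpha>: "\<alpha> \<in> hardy_index"
    let ?a = "hardy_coeff f" and ?g = "boundary_value f"
    note g = boundary_value[OF f]
    let ?s = "\<lambda>F. \<Sum>\<beta>\<in>F. ?a \<beta> * symbol_coeff (\<alpha> - \<beta>)"
    have "(?s \<longlongrightarrow> hardy_coeff (T f) \<alpha>) (finite_subsets_at_top hardy_index)"
    proof (rule Lim_null[THEN iffD2], rule Lim_null_comparison)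
      show "((\<lambda>F. K * hardy_norm (\<lambda>z. f z - (if z \<in> hartogs then \<Sum>\<beta>\<in>F. ?a \<beta> * monomial \<beta> z else 0))) \<longlongrightarrow> 0) (finite_subsets_at_top hardy_index)"
        using hardy_expansion_coeff[OF f] unfolding hardy_expansion_def by (rule tendsto_mult_right_zero)
      show "\<forall>\<^sub>F F in finite_subsets_at_top hardy_index. norm (?s F - hardy_coeff (T f) \<alpha>)
         \<le> K * hardy_norm (\<lambda>z. f z - (if z \<in> hartogs then \<Sum>\<beta>\<in>F. ?a \<beta> * monomial \<beta> z else 0))"
      proof (rule eventually_finite_subsets_at_top_weakI)
        fix F :: "(int, 'n) vec set" assume F: "finite F" "F \<subseteq> hardy_index"
        let ?p = "hardy_series (\<lambda>\<alpha>. if \<alpha> \<in> F then ?a \<alpha> else 0)"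
        have p: "?p \<in> hardy_space" by (intro hardy_series_in_hardy_space hardy_l2_truncate F)
        have d: "(\<lambda>z. f z - ?p z) \<in> hardy_space" by (rule hardy_space_diff(1)[OF f p])
        have Tf: "T f = (\<lambda>z. T (\<lambda>z. f z - ?p z) z + T ?p z)"
          using add[OF d p] by simp
        have "hardy_coeff (T f) \<alpha> = hardy_coeff (T (\<lambda>z. f z - ?p z)) \<alpha> + hardy_coeff (T ?p) \<alpha>"
          by (subst Tf) (rule hardy_space_add(2)[OF maps[OF d] maps[OF p]])
        moreover have "hardy_coeff (T ?p) \<alpha> = ?s F"
          unfolding coeff_finite_combination[OF F]
          by (rule sum.cong) (use F in \<open>auto simp: entry_eq_symbol_coeff[OF \<alpha>]\<close>)
        ultimately have "norm (?s F - hardy_coeff (T f) \<alpha>) = cmod (hardy_coeff (T (\<lambda>z. f z - ?p z)) \<alpha>)"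
          by (simp add: norm_minus_commute)
        also have "\<dots> \<le> hardy_norm (T (\<lambda>z. f z - ?p z))" by (rule hardy_coeff_le_norm[OF maps[OF d]])
        also have "\<dots> \<le> K * hardy_norm (\<lambda>z. f z - ?p z)" by (rule bounded[OF d])
        finally show "norm (?s F - hardy_coeff (T f) \<alpha>)
          \<le> K * hardy_norm (\<lambda>z. f z - (if z \<in> hartogs then \<Sum>\<beta>\<in>F. ?a \<beta> * monomial \<beta> z else 0))"
          by (simp only: hardy_series_finite[OF F])
      qed
    qed
    moreover have "(?s \<longlongrightarrow> fourier (\<lambda>\<zeta>. \<phi> \<zeta> * ?g \<zeta>) \<alpha>) (finite_subsets_at_top hardy_index)"
    proof (rule Lim_null[THEN iffD2], rule Lim_null_comparison)
      show "((\<lambda>F. (2 * K) * torus_norm (\<lambda>\<zeta>. ?g \<zeta> - trigpoly F ?a \<zeta>)) \<longlongrightarrow> 0) (finite_subsets_at_top hardy_index)"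
        using g(2) unfolding norm_expansion_def by (rule tendsto_mult_right_zero)
      show "\<forall>\<^sub>F F in finite_subsets_at_top hardy_index. norm (?s F - fourier (\<lambda>\<zeta>. \<phi> \<zeta> * ?g \<zeta>) \<alpha>)
         \<le> (2 * K) * torus_norm (\<lambda>\<zeta>. ?g \<zeta> - trigpoly F ?a \<zeta>)"
      proof (rule always_eventually, rule allI)
        fix F :: "(int, 'n) vec set"
        have s: "fourier (\<lambda>\<zeta>. \<phi> \<zeta> * trigpoly F ?a \<zeta>) \<alpha> = ?s F"
        proof -
          have "fourier (\<lambda>\<zeta>. \<phi> \<zeta> * trigpoly F ?a \<zeta>) \<alpha>
            = (\<integral>\<zeta>. (\<Sum>\<beta>\<in>F. ?a \<beta> * ((\<phi> \<zeta> * monomial \<beta> \<zeta>) * cnj (monomial \<alpha> \<zeta>))) \<partial>torus_measure)"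
            unfolding fourier_def torus_inner_def sum_distrib_left sum_distrib_right
            by (intro Bochner_Integration.integral_cong sum.cong refl) (simp only: ac_simps)
          also have "\<dots> = (\<Sum>\<beta>\<in>F. ?a \<beta> * fourier (\<lambda>\<zeta>. \<phi> \<zeta> * monomial \<beta> \<zeta>) \<alpha>)"
            unfolding fourier_def torus_inner_def
            using torus_L2_mult_integrable[OF torus_L2_bounded_mult[OF monomial_L2 m b] monomial_L2]
            by (subst Bochner_Integration.integral_sum) simp_all
          also have "\<dots> = ?s F"
            unfolding fourier_mult_monomial[OF m] f\<phi> ..
          finally show ?thesis .
        qed
        let ?d = "\<lambda>\<zeta>. ?g \<zeta> - trigpoly F ?a \<zeta>"
        have dL: "?d \<in> torus_L2" by (intro torus_L2_diff g trigpoly_L2)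
        have "fourier (\<lambda>\<zeta>. \<phi> \<zeta> * ?g \<zeta>) \<alpha> - ?s F = fourier (\<lambda>\<zeta>. \<phi> \<zeta> * ?g \<zeta> - \<phi> \<zeta> * trigpoly F ?a \<zeta>) \<alpha>"
          unfolding s[symmetric]
          by (rule fourier_diff[symmetric]) (intro torus_L2_bounded_mult[OF _ m b] g trigpoly_L2)+
        also have "\<dots> = fourier (\<lambda>\<zeta>. \<phi> \<zeta> * ?d \<zeta>) \<alpha>"
          by (simp only: right_diff_distrib)
        finally have "fourier (\<lambda>\<zeta>. \<phi> \<zeta> * ?g \<zeta>) \<alpha> - ?s F = fourier (\<lambda>\<zeta>. \<phi> \<zeta> * ?d \<zeta>) \<alpha>" .
        then have "norm (?s F - fourier (\<lambda>\<zeta>. \<phi> \<zeta> * ?g \<zeta>) \<alpha>) = cmod (fourier (\<lambda>\<zeta>. \<phi> \<zeta> * ?d \<zeta>) \<alpha>)"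
          by (subst norm_minus_commute) (rule arg_cong[where f = cmod])
        also have "\<dots> \<le> torus_norm (\<lambda>\<zeta>. \<phi> \<zeta> * ?d \<zeta>)"
          by (rule fourier_bound[OF torus_L2_bounded_mult[OF dL m b]])
        also have "\<dots> \<le> (2 * K) * torus_norm ?d"
          using K by (intro torus_norm_bounded_mult[OF dL m b]) simp
        finally show "norm (?s F - fourier (\<lambda>\<zeta>. \<phi> \<zeta> * ?g \<zeta>) \<alpha>) \<le> (2 * K) * torus_norm ?d" .
      qed
    qed
    ultimately have "hardy_coeff (T f) \<alpha> = fourier (\<lambda>\<zeta>. \<phi> \<zeta> * ?g \<zeta>) \<alpha>"
      by (rule tendsto_unique[OF finite_subsets_at_top_neq_bot])
    then show "hardy_coeff (T f) \<alpha> = hardy_coeff (toeplitz \<phi> f) \<alpha>"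
      using toeplitz_coeff(2)[OF Linf f \<alpha>] by simp
  qed
  with Linf show ?thesis by blast
qed

end

theorem theorem5p1:
  fixes T :: "'n::{finite,linorder} cfun \<Rightarrow> 'n cfun"
  assumes "CARD('n) \<ge> 2"
    and "hardy_bounded_operator T"
  shows "(\<exists>\<phi>\<in>torus_Linf. \<forall>f\<in>hardy_space. T f = toeplitz \<phi> f) \<longleftrightarrow>
         (\<forall>j. \<forall>f\<in>hardy_space. hardy_adjoint (coord_mult j) (T (coord_mult j f)) = T f)"
proof -
  have maps: "\<And>f. f \<in> hardy_space \<Longrightarrow> T f \<in> hardy_space"
    and add: "\<And>f g. f \<in> hardy_space \<Longrightarrow> g \<in> hardy_space \<Longrightarrow> T (\<lambda>z. f z + g z) = (\<lambda>z. T f z + T g z)"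
    and cmult: "\<And>c f. f \<in> hardy_space \<Longrightarrow> T (\<lambda>z. c * f z) = (\<lambda>z. c * T f z)"
    using assms(2) unfolding hardy_bounded_operator_def by auto
  obtain C where C: "\<And>f. f \<in> hardy_space \<Longrightarrow> hardy_norm (T f) \<le> C * hardy_norm f"
    using assms(2) unfolding hardy_bounded_operator_def by blast
  have iff: "hardy_adjoint (coord_mult j) (T (coord_mult j f)) = T f \<longleftrightarrow>
      (\<forall>\<alpha>\<in>hardy_index. hardy_coeff (T (coord_mult j f)) (\<alpha> + unit_index j) = hardy_coeff (T f) \<alpha>)"
    if "f \<in> hardy_space" for j f
    by (rule shift_condition_iff[OF that maps])
  show ?thesis
  proof
    assume "\<exists>\<phi>\<in>torus_Linf. \<forall>f\<in>hardy_space. T f = toeplitz \<phi> f"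
    then obtain \<phi> where \<phi>: "\<phi> \<in> torus_Linf" and T: "\<And>f. f \<in> hardy_space \<Longrightarrow> T f = toeplitz \<phi> f" by blast
    show "\<forall>j. \<forall>f\<in>hardy_space. hardy_adjoint (coord_mult j) (T (coord_mult j f)) = T f"
    proof (intro allI ballI)
      fix j and f :: "'n cfun" assume f: "f \<in> hardy_space"
      have "\<forall>\<alpha>\<in>hardy_index. hardy_coeff (T (coord_mult j f)) (\<alpha> + unit_index j) = hardy_coeff (T f) \<alpha>"
        unfolding T[OF f] T[OF coord_mult_coeff(1)[OF f]]
        by (intro ballI toeplitz_satisfies_shift_condition[OF \<phi> f])
      then show "hardy_adjoint (coord_mult j) (T (coord_mult j f)) = T f"
        by (rule iff[OF f, THEN iffD2])
    qed
  next
    assume shift: "\<forall>j. \<forall>f\<in>hardy_space. hardy_adjoint (coord_mult j) (T (coord_mult j f)) = T f"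
    have "shift_invariant_operator T \<bar>C\<bar>"
    proof
      show "hardy_norm (T f) \<le> \<bar>C\<bar> * hardy_norm f" if "f \<in> hardy_space" for f
        by (rule order_trans[OF C[OF that]]) (intro mult_right_mono hardy_norm_nonneg abs_ge_self)
      show "hardy_coeff (T (coord_mult j f)) (\<alpha> + unit_index j) = hardy_coeff (T f) \<alpha>"
        if "f \<in> hardy_space" "\<alpha> \<in> hardy_index" for j f \<alpha>
        using iff[OF that(1), of j, THEN iffD1, OF shift[rule_format, OF that(1)]] that(2) by (rule bspec)
    qed (simp_all add: maps add cmult)
    then show "\<exists>\<phi>\<in>torus_Linf. \<forall>f\<in>hardy_space. T f = toeplitz \<phi> f"
      by (rule shift_invariant_operator.ex_toeplitz)
  qed
qed

end
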